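(* Let $(\varphi_{s,t})$ be an evolution family in the unit disc $\mathbb{D}$ and $G$ its Herglotz vector field. Suppose $(\varphi_{s,t})$ has a regular contact point $\sigma\in\mathbb{T}=\partial\mathbb{D}$ with spectral function $\Lambda$. Set $\sigma(t):=\varphi_{0,t}(\sigma)$ for $t\ge0$. Then the following statements hold: (i) for a.e. $t\ge0$ the angular limit $G(\sigma(t),t):=\angle\lim_{z\to\sigma(t)}G(z,t)$ exists and $v(t):=-i\,\overline{\sigma(t)}\,G(\sigma(t),t)\in\mathbb{R}$; (ii) the function $[0,+\infty)\ni t\mapsto G(\sigma(t),t)$ is of class $L^1_{\mathrm{loc}}$; (iii) the function $[0,+\infty)\ni t\mapsto\sigma(t)$ is locally absolutely continuous and for any $s,t\ge0$, $$\sigma(t)=\sigma(s)+\int_s^t G(\sigma(\xi),\xi)\,d\xi;$$ (iv) for a.e. $t\ge0$ the angular limit $$G'(\sigma(t),t):=\angle\lim_{z\to\sigma(t)}\frac{G(z,t)-G(\sigma(t),t)}{z-\sigma(t)}$$ exists (finitely) and $\operatorname{Im}G'(\sigma(t),t)=v(t)$; (v) the function $[0,+\infty)\ni t\mapsto G'(\sigma(t),t)$ is of class $L^1_{\mathrm{loc}}$ and for any $t\ge0$, $$\Lambda(t)=-\int_0^t\operatorname{Re}G'(\sigma(\xi),\xi)\,d\xi.$$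
   Context: $\mathbb{D}$ is the open unit disc of $\mathbb{C}$; $\angle\lim$ denotes the angular (non-tangential) limit. Regular contact point: $\sigma\in\mathbb{T}$ is a regular contact point of a holomorphic $\varphi:\mathbb{D}\to\mathbb{D}$ if the angular limit $\varphi(\sigma):=\angle\lim_{z\to\sigma}\varphi(z)$ exists and belongs to $\mathbb{T}$, and the angular derivative $\varphi'(\sigma):=\angle\lim_{z\to\sigma}\frac{\varphi(z)-\varphi(\sigma)}{z-\sigma}$ exists finitely. Infinitesimal generator: a holomorphic $H:\mathbb{D}\to\mathbb{C}$ such that for every $z\in\mathbb{D}$ the Cauchy problem $\dot w=H(w)$, $w(0)=z$, has a solution $w:[0,+\infty)\to\mathbb{D}$. Herglotz vector field of order $d\in[1,+\infty]$: a function $G:\mathbb{D}\times[0,+\infty)\to\mathbb{C}$ such that (1) $t\mapsto G(z,t)$ is measurable for all $z\in\mathbb{D}$; (2) $z\mapsto G(z,t)$ is holomorphic for all $t\ge0$; (3) for any compact $K\subset\mathbb{D}$ and $T>0$ there is a non-negative $k_{K,T}\in L^d([0,T],\mathbb{R})$ with $|G(z,t)|\le k_{K,T}(t)$ for all $z\in K$ and a.e. $t\in[0,T]$; (4) for a.e. $t\ge0$, $G(\cdot,t)$ is an infinitesimal generator. Evolution family of order $d\in[1,+\infty]$: a family $(\varphi_{s,t})_{0\le s\le t<+\infty}$ of holomorphic self-maps of $\mathbb{D}$ such that (1) $\varphi_{s,s}=\mathrm{id}_{\mathbb{D}}$; (2) $\varphi_{s,t}=\varphi_{u,t}\circ\varphi_{s,u}$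 for $0\le s\le u\le t$; (3) for any $z\in\mathbb{D}$ and $T>0$ there is a non-negative $k_{z,T}\in L^d([0,T],\mathbb{R})$ with $|\varphi_{s,u}(z)-\varphi_{s,t}(z)|\le\int_u^t k_{z,T}(\xi)\,d\xi$ for $0\le s\le u\le t\le T$. An "evolution family" with no order mentioned is one of some order $d\in[1,+\infty]$. For every evolution family of order $d$ there is a Herglotz vector field $G$ of order $d$, unique up to changes on a null set of $t$, such that for all $z\in\mathbb{D}$ and $s\ge0$, $\frac{\partial\varphi_{s,t}(z)}{\partial t}=G(\varphi_{s,t}(z),t)$ for a.e. $t\ge s$; it is called the Herglotz vector field of $(\varphi_{s,t})$. $\sigma\in\mathbb{T}$ is a regular contact point of an evolution family $(\varphi_{s,t})$ if it is a regular contact point of $\varphi_{0,t}$ for every $t\ge0$. The spectral function of $(\varphi_{s,t})$ at such $\sigma$ is $\Lambda(t):=-\log|\varphi_{0,t}'(\sigma)|$, $t\ge0$. *)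

theory Defs
  imports "HOL-Complex_Analysis.Complex_Analysis"
begin

section \<open>Angular limits and angular derivatives\<close>

definition stolz_region :: "complex \<Rightarrow> real \<Rightarrow> complex set" where
  "stolz_region \<sigma> M = {z \<in> ball 0 1. cmod (\<sigma> - z) < M * (1 - cmod z)}"

text \<open>Used only at points of the unit circle. Limits are finite; there is no convergence
  to \<open>\<infinity>\<close>.\<close>

definition has_angular_limit :: "(complex \<Rightarrow> complex) \<Rightarrow> complex \<Rightarrow> complex \<Rightarrow> bool" where
  "has_angular_limit f \<sigma> l \<longleftrightarrow> (\<forall>M>1. (f \<longlongrightarrow> l) (at \<sigma> within stolz_region \<sigma> M))"

definition angular_lim :: "(complex \<Rightarrow> complex) \<Rightarrow> complex \<Rightarrow> complex" where
  "angular_lim f \<sigma> = (THE l. has_angular_limit f \<sigma> l)"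

text \<open>The value of \<open>f\<close> at the boundary point is its angular limit; this notion is only
  meaningful when that limit exists.\<close>

definition has_angular_derivative :: "(complex \<Rightarrow> complex) \<Rightarrow> complex \<Rightarrow> complex \<Rightarrow> bool" where
  "has_angular_derivative f \<sigma> l \<longleftrightarrow>
     has_angular_limit (\<lambda>z. (f z - angular_lim f \<sigma>) / (z - \<sigma>)) \<sigma> l"

definition angular_deriv :: "(complex \<Rightarrow> complex) \<Rightarrow> complex \<Rightarrow> complex" where
  "angular_deriv f \<sigma> = (THE l. has_angular_derivative f \<sigma> l)"

lemma stolz_region_islimpt:
  assumes "\<sigma> \<in> sphere 0 1" and "M > 1"
  shows "\<sigma> islimpt stolz_region \<sigma> M"
  unfolding islimpt_approachable
proof (intro allI impI)
  fix e :: real assume "e > 0"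
  define r where "r = min (1/2) (e/2)"
  have r: "0 < r" "r < 1" "r < e" using \<open>e > 0\<close> by (auto simp: r_def)
  have s: "cmod \<sigma> = 1" using assms by simp
  let ?z = "of_real (1 - r) * \<sigma>"
  have d: "\<sigma> - ?z = of_real r * \<sigma>" by (simp add: algebra_simps)
  have n: "cmod (\<sigma> - ?z) = r" unfolding d by (simp add: norm_mult s r less_imp_le)
  have m: "cmod ?z = 1 - r" by (metis abs_of_pos diff_gt_0_iff_gt mult.right_neutral norm_mult norm_of_real r(2) s)
  have "r < M * r" using r assms by simp
  then have "?z \<in> stolz_region \<sigma> M"
    using r by (simp add: stolz_region_def n m del: of_real_diff)
  moreover have "?z \<noteq> \<sigma>" using n r by force
  moreover have "dist ?z \<sigma> < e" using n r by (metis dist_commute dist_norm)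
  ultimately show "\<exists>z\<in>stolz_region \<sigma> M. z \<noteq> \<sigma> \<and> dist z \<sigma> < e" by blast
qed

lemma has_angular_limit_unique:
  assumes "\<sigma> \<in> sphere 0 1" and "has_angular_limit f \<sigma> l" and "has_angular_limit f \<sigma> l'"
  shows "l = l'"
proof (rule tendsto_unique)
  show "at \<sigma> within stolz_region \<sigma> 2 \<noteq> bot"
    using stolz_region_islimpt[OF assms(1), of 2] by (simp add: trivial_limit_within)
  show "(f \<longlongrightarrow> l) (at \<sigma> within stolz_region \<sigma> 2)" "(f \<longlongrightarrow> l') (at \<sigma> within stolz_region \<sigma> 2)"
    using assms by (auto simp: has_angular_limit_def)
qed

lemma angular_lim_eq:
  assumes "\<sigma> \<in> sphere 0 1" and "has_angular_limit f \<sigma> l"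
  shows "angular_lim f \<sigma> = l"
  unfolding angular_lim_def using assms has_angular_limit_unique by blast

lemma angular_deriv_eq:
  assumes "\<sigma> \<in> sphere 0 1" and "has_angular_derivative f \<sigma> l"
  shows "angular_deriv f \<sigma> = l"
  unfolding angular_deriv_def
  using assms has_angular_limit_unique has_angular_derivative_def by blast

definition regular_contact_point :: "(complex \<Rightarrow> complex) \<Rightarrow> complex \<Rightarrow> bool" where
  "regular_contact_point f \<sigma> \<longleftrightarrow>
     \<sigma> \<in> sphere 0 1 \<and>
     (\<exists>l \<in> sphere 0 1. has_angular_limit f \<sigma> l) \<and>
     (\<exists>l. has_angular_derivative f \<sigma> l)"


section \<open>Function classes on intervals\<close>

text \<open>Measurability and null sets refer to the completed (Lebesgue) measure. This matters because
  boundary values such as \<open>angular_lim (\<lambda>z. G z t) \<sigma>\<close> are arbitrary on a null set of times.\<close>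

definition Lspace_Icc :: "ereal \<Rightarrow> real \<Rightarrow> (real \<Rightarrow> real) set" where
  "Lspace_Icc d T =
     {k \<in> borel_measurable (lebesgue_on {0..T}).
        if d = \<infinity> then \<exists>C. AE t in lebesgue_on {0..T}. \<bar>k t\<bar> \<le> C
        else integrable (lebesgue_on {0..T}) (\<lambda>t. \<bar>k t\<bar> powr real_of_ereal d)}"

definition L1_loc_on :: "real set \<Rightarrow> (real \<Rightarrow> complex) \<Rightarrow> bool" where
  "L1_loc_on S f \<longleftrightarrow> (\<forall>K. compact K \<and> K \<subseteq> S \<longrightarrow> f absolutely_integrable_on K)"

text \<open>A pair \<open>(u, v)\<close> in \<open>P\<close> encodes the interval with endpoints \<open>u \<le> v\<close>.\<close>

definition absolutely_continuous_Icc :: "real \<Rightarrow> real \<Rightarrow> (real \<Rightarrow> complex) \<Rightarrow> bool" where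
  "absolutely_continuous_Icc a b f \<longleftrightarrow>
     (\<forall>\<epsilon>>0. \<exists>\<delta>>0. \<forall>P. finite P \<longrightarrow>
        (\<forall>(u, v) \<in> P. a \<le> u \<and> u \<le> v \<and> v \<le> b) \<longrightarrow>
        pairwise (\<lambda>p q. {fst p<..<snd p} \<inter> {fst q<..<snd q} = {}) P \<longrightarrow>
        (\<Sum>(u, v) \<in> P. v - u) < \<delta> \<longrightarrow>
        (\<Sum>(u, v) \<in> P. cmod (f v - f u)) < \<epsilon>)"

definition locally_absolutely_continuous_on :: "real set \<Rightarrow> (real \<Rightarrow> complex) \<Rightarrow> bool" where
  "locally_absolutely_continuous_on S f \<longleftrightarrow>
     (\<forall>a b. a \<le> b \<and> {a..b} \<subseteq> S \<longrightarrow> absolutely_continuous_Icc a b f)"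


section \<open>Infinitesimal generators, Herglotz vector fields, evolution families\<close>

definition infinitesimal_generator :: "(complex \<Rightarrow> complex) \<Rightarrow> bool" where
  "infinitesimal_generator H \<longleftrightarrow>
     H holomorphic_on ball 0 1 \<and>
     (\<forall>z \<in> ball 0 1. \<exists>w :: real \<Rightarrow> complex.
        w 0 = z \<and>
        (\<forall>t\<ge>0. w t \<in> ball 0 1 \<and> (w has_vector_derivative H (w t)) (at t within {0..})))"

definition herglotz_vector_field :: "ereal \<Rightarrow> (complex \<Rightarrow> real \<Rightarrow> complex) \<Rightarrow> bool" where
  "herglotz_vector_field d G \<longleftrightarrow>
     1 \<le> d \<and>
     (\<forall>z \<in> ball 0 1. (\<lambda>t. G z t) \<in> borel_measurable (lebesgue_on {0..})) \<and>
     (\<forall>t\<ge>0. (\<lambda>z. G z t) holomorphic_on ball 0 1) \<and>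
     (\<forall>K T. compact K \<and> K \<subseteq> ball 0 1 \<and> T > 0 \<longrightarrow>
        (\<exists>k \<in> Lspace_Icc d T.
           (\<forall>t \<in> {0..T}. 0 \<le> k t) \<and>
           (AE t\<in>{0..T} in lebesgue. \<forall>z \<in> K. cmod (G z t) \<le> k t))) \<and>
     (AE t\<in>{0..} in lebesgue. infinitesimal_generator (\<lambda>z. G z t))"

text \<open>Only the values \<open>\<phi> s t z\<close> with \<open>0 \<le> s \<le> t\<close> and \<open>z\<close> in the unit disc are relevant.\<close>

definition evolution_family :: "ereal \<Rightarrow> (real \<Rightarrow> real \<Rightarrow> complex \<Rightarrow> complex) \<Rightarrow> bool" where
  "evolution_family d \<phi> \<longleftrightarrow>
     1 \<le> d \<and>
     (\<forall>s t. 0 \<le> s \<and> s \<le> t \<longrightarrow>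
        \<phi> s t holomorphic_on ball 0 1 \<and> \<phi> s t ` ball 0 1 \<subseteq> ball 0 1) \<and>
     (\<forall>s\<ge>0. \<forall>z \<in> ball 0 1. \<phi> s s z = z) \<and>
     (\<forall>s u t. 0 \<le> s \<and> s \<le> u \<and> u \<le> t \<longrightarrow>
        (\<forall>z \<in> ball 0 1. \<phi> s t z = \<phi> u t (\<phi> s u z))) \<and>
     (\<forall>z \<in> ball 0 1. \<forall>T>0.
        \<exists>k \<in> Lspace_Icc d T.
          (\<forall>\<xi> \<in> {0..T}. 0 \<le> k \<xi>) \<and>
          (\<forall>s u t. 0 \<le> s \<and> s \<le> u \<and> u \<le> t \<and> t \<le> T \<longrightarrow>
             cmod (\<phi> s u z - \<phi> s t z) \<le> (LINT \<xi>=u..t|lebesgue. k \<xi>)))"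

text \<open>The vector field is unique only up to a null set of times, so this is a relation between
  \<open>\<phi>\<close> and \<open>G\<close>. The exceptional set of times may depend on \<open>s\<close> and \<open>z\<close>.\<close>

definition herglotz_vector_field_of ::
    "ereal \<Rightarrow> (real \<Rightarrow> real \<Rightarrow> complex \<Rightarrow> complex) \<Rightarrow> (complex \<Rightarrow> real \<Rightarrow> complex) \<Rightarrow> bool" where
  "herglotz_vector_field_of d \<phi> G \<longleftrightarrow>
     herglotz_vector_field d G \<and>
     (\<forall>z \<in> ball 0 1. \<forall>s\<ge>0. AE t\<in>{s..} in lebesgue.
        ((\<lambda>\<tau>. \<phi> s \<tau> z) has_vector_derivative G (\<phi> s t z) t) (at t within {s..}))"

definition regular_contact_point_of_family ::
    "(real \<Rightarrow> real \<Rightarrow> complex \<Rightarrow> complex) \<Rightarrow> complex \<Rightarrow> bool" where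
  "regular_contact_point_of_family \<phi> \<sigma> \<longleftrightarrow> (\<forall>t\<ge>0. regular_contact_point (\<phi> 0 t) \<sigma>)"

definition spectral_function ::
    "(real \<Rightarrow> real \<Rightarrow> complex \<Rightarrow> complex) \<Rightarrow> complex \<Rightarrow> real \<Rightarrow> real" where
  "spectral_function \<phi> \<sigma> t = - ln (cmod (angular_deriv (\<phi> 0 t) \<sigma>))"

end

theory Submission
  imports Defs "HOL-Real_Asymp.Real_Asymp"
begin

text \<open>
  For almost every \<open>t\<close> write \<open>G(z,t) = a - cnj a * z\<^sup>2 - z * q(z)\<close> with \<open>a = G(0,t)\<close>. That \<open>Re q \<ge> 0\<close>
  follows by differentiating the Schwarz--Pick inequality along two trajectories. For the trajectory
  \<open>z\<^sub>r(t) = \<phi>\<^sub>0\<^sub>,\<^sub>t(r \<sigma>\<^sub>0)\<close>, integration of the equation for \<open>log (1 - |z\<^sub>r(t)|\<^sup>2)\<close> gives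
  \<open>log ((1 - |z\<^sub>r(t)|\<^sup>2) / (1 - r\<^sup>2)) = \<integral> (2 |z\<^sub>r|\<^sup>2 Re q(z\<^sub>r) / (1 - |z\<^sub>r|\<^sup>2) - 2 Re (a cnj z\<^sub>r)) ds\<close>,
  and as \<open>r\<close> tends to \<open>1\<close> the left-hand side tends to the logarithm of the angular derivative of
  \<open>\<phi>\<^sub>0\<^sub>,\<^sub>t\<close>. By Fatou's lemma \<open>Re q(z\<^sub>r) / (1 - |z\<^sub>r|\<^sup>2)\<close> has a finite lower limit for almost every time,
  which by the Julia--Wolff--Caratheodory theorem for \<open>q\<close> yields the angular limit and the angular
  derivative of \<open>G(\<cdot>,t)\<close> at \<open>\<sigma>(t)\<close>. Julia's inequality for \<open>\<phi>\<^sub>0\<^sub>,\<^sub>t\<close> keeps all \<open>z\<^sub>r(t)\<close> in one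
  Stolz angle at \<open>\<sigma>(t)\<close>, and Julia's inequality for \<open>q\<close> then provides integrable majorants, so that
  dominated convergence turns the integrated equations for \<open>z\<^sub>r\<close> and \<open>log (1 - |z\<^sub>r|\<^sup>2)\<close> into the claimed
  formulas.
\<close>

section \<open>Schwarz--Pick inequalities\<close>

text \<open>For a single time nothing is known about G(z,t) near the circle; only integrals over
  time along trajectories are controlled. Fatou's lemma applies because of a sign: Re q >= 0 makes
  the integrand non-negative once the integrable function 2 |G(0,t)| is added. The same sign bounds
  from below the rate of change of log (1 - |z_r|^2), independently of r; this keeps the angular
  derivative away from 0 and makes the Stolz angle independent of the time in [0,T]. The majorants
  close a circle. Fatou gives an integrable h and, for almost every time, a subsequence of radii,
  chosen for that time, along which the hypothesis of Julia's lemma holds. The boundary theory then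
  gives convergence along all radii, so the limit of the integrand must be h itself. This bounds the
  boundary dilation \<delta> of q by 2 h, and \<delta> controls q on the whole Stolz angle.
  Measurability in time of boundary values is inherited from sequences of interior values. The
  imaginary part of G' comes from the identity Im G' = v, not from a limit of integrals.\<close>

lemma blaschke_identity:
  fixes a z :: complex
  shows "(cmod (1 - cnj a * z))\<^sup>2 - (cmod (a - z))\<^sup>2 = (1 - (cmod a)\<^sup>2) * (1 - (cmod z)\<^sup>2)"
  by (simp only: cmod_power2 complex_cnj minus_complex.simps times_complex.simps one_complex.simps cnj.simps) algebra

lemma blaschke_denominator_nonzero:
  fixes a z :: complex
  assumes "cmod a < 1" "cmod z < 1"
  shows "1 - cnj a * z \<noteq> 0"
proof -
  have "cmod a * cmod z < 1"
    using assms by (metis less_eq_real_def mult_less_cancel_left2 norm_ge_zero order_le_less_trans mult_left_le not_less)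
  then have "cmod (cnj a * z) < 1" by (simp add: norm_mult)
  then show ?thesis by fastforce
qed

lemma blaschke_in_disc:
  fixes a z :: complex
  assumes "cmod a < 1" "cmod z < 1"
  shows "cmod ((a - z) / (1 - cnj a * z)) < 1"
proof -
  have "(1 - (cmod a)\<^sup>2) * (1 - (cmod z)\<^sup>2) > 0"
    using assms by (simp add: power_less_one_iff)
  then have "(cmod (a - z))\<^sup>2 < (cmod (1 - cnj a * z))\<^sup>2"
    using blaschke_identity[of a z] by linarith
  then have "cmod (a - z) < cmod (1 - cnj a * z)"
    using power2_less_imp_less norm_ge_zero by blast
  then show ?thesis using blaschke_denominator_nonzero[OF assms] by (simp add: norm_divide)
qed

text \<open>Conjugation with the involutions that exchange 0 with \<open>w\<close> and 0 with
  \<open>f w\<close> reduces this to the Schwarz lemma. The form without quotients is the one that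
  can later be differentiated in time and divided by \<open>1 - |w|^2\<close> as \<open>w\<close>
  tends to the circle.\<close>

lemma schwarz_pick:
  assumes hol: "f holomorphic_on ball 0 1" and im: "f ` ball 0 1 \<subseteq> ball 0 1"
    and z: "z \<in> ball 0 1" and w: "w \<in> ball 0 1"
  shows "(cmod (f z - f w))\<^sup>2 * ((1 - (cmod z)\<^sup>2) * (1 - (cmod w)\<^sup>2))
       \<le> (cmod (z - w))\<^sup>2 * ((1 - (cmod (f z))\<^sup>2) * (1 - (cmod (f w))\<^sup>2))"
proof -
  define B where "B = (\<lambda>a z::complex. (a - z) / (1 - cnj a * z))"
  have zw: "cmod z < 1" "cmod w < 1" using z w by auto
  have fzw: "cmod (f x) < 1" if "cmod x < 1" for x using im that by force
  have Bin: "cmod (B a x) < 1" if "cmod a < 1" "cmod x < 1" for a x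
    using blaschke_in_disc[OF that] by (simp add: B_def)
  have Bhol: "B a holomorphic_on ball 0 1" if "cmod a < 1" for a
    unfolding B_def using blaschke_denominator_nonzero[OF that]
    by (intro holomorphic_intros) auto
  have BB: "B w (B w z) = z"
  proof -
    have n1: "1 - cnj w * z \<noteq> 0" and n2: "1 - cnj w * w \<noteq> 0"
      using blaschke_denominator_nonzero zw by blast+
    have "w - (w - z) / (1 - cnj w * z) = z * (1 - cnj w * w) / (1 - cnj w * z)"
      using n1 by (simp add: field_simps)
    moreover have "1 - cnj w * ((w - z) / (1 - cnj w * z)) = (1 - cnj w * w) / (1 - cnj w * z)"
      using n1 by (simp add: field_simps)
    ultimately show ?thesis using n1 n2 by (simp add: B_def)
  qed
  define h where "h = B (f w) \<circ> (f \<circ> B w)"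
  have h1: "f \<circ> B w holomorphic_on ball 0 1"
    by (rule holomorphic_on_compose_gen[OF Bhol hol]) (use zw Bin in auto)
  have "h holomorphic_on ball 0 1" unfolding h_def
    by (rule holomorphic_on_compose_gen[OF h1 Bhol]) (use zw Bin fzw in auto)
  moreover have "h 0 = 0" by (simp add: h_def B_def)
  moreover have "cmod (h x) < 1" if "cmod x < 1" for x
    using that zw Bin fzw by (simp add: h_def)
  ultimately have "cmod (h (B w z)) \<le> cmod (B w z)"
    using Schwarz_Lemma' Bin zw by blast
  then have "cmod (B (f w) (f z)) \<le> cmod (B w z)" by (simp add: h_def BB)
  then have le: "(cmod (B (f w) (f z)))\<^sup>2 \<le> (cmod (B w z))\<^sup>2" by (simp add: power_mono)
  define X where "X = (cmod (1 - cnj w * z))\<^sup>2"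
  define Y where "Y = (cmod (1 - cnj (f w) * f z))\<^sup>2"
  have X: "X > 0" and Y: "Y > 0"
    using blaschke_denominator_nonzero zw fzw by (simp_all add: X_def Y_def)
  have "(cmod (f w - f z))\<^sup>2 / Y \<le> (cmod (w - z))\<^sup>2 / X"
    using le by (simp add: B_def norm_divide power_divide X_def Y_def)
  then have le2: "(cmod (f w - f z))\<^sup>2 * X \<le> (cmod (w - z))\<^sup>2 * Y"
    using X Y by (simp add: field_simps)
  \<comment> \<open>Once both identities are inserted in \<open>le2\<close>, the product of the two
    squared distances appears on both sides and cancels; the claim is what remains.\<close>
  have eX: "X = (cmod (w - z))\<^sup>2 + (1 - (cmod w)\<^sup>2) * (1 - (cmod z)\<^sup>2)"
    using blaschke_identity[of w z] by (simp add: X_def)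
  have eY: "Y = (cmod (f w - f z))\<^sup>2 + (1 - (cmod (f w))\<^sup>2) * (1 - (cmod (f z))\<^sup>2)"
    using blaschke_identity[of "f w" "f z"] by (simp add: Y_def)
  show ?thesis using le2 unfolding eX eY
    by (simp add: algebra_simps norm_minus_commute)
qed

text \<open>The Cayley transform \<open>(h - 1) / (h + 1)\<close> carries the right half-plane to
  the disc, where \<open>schwarz_pick\<close> applies; the powers of \<open>|h + 1|\<close>
  cancel.\<close>

lemma schwarz_pick_halfplane:
  assumes hol: "g holomorphic_on ball 0 1" and re: "\<And>z. z \<in> ball 0 1 \<Longrightarrow> 0 \<le> Re (g z)"
    and z: "z \<in> ball 0 1" and w: "w \<in> ball 0 1"
  shows "(cmod (g z - g w))\<^sup>2 * ((1 - (cmod z)\<^sup>2) * (1 - (cmod w)\<^sup>2))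
       \<le> 4 * (cmod (z - w))\<^sup>2 * (Re (g z) * Re (g w))"
proof -
  \<comment> \<open>Only \<open>Re g >= 0\<close> is assumed, so the Cayley transform of
    \<open>g\<close> may reach the circle; a shift by \<open>e > 0\<close> keeps it inside the open
    disc, and \<open>e\<close> tends to 0 at the end.\<close>
  have eps: "(cmod (g z - g w))\<^sup>2 * ((1 - (cmod z)\<^sup>2) * (1 - (cmod w)\<^sup>2))
       \<le> 4 * (cmod (z - w))\<^sup>2 * ((Re (g z) + e) * (Re (g w) + e))" if e: "e > 0" for e
  proof -
    define h where "h = (\<lambda>x. g x + of_real e)"
    define f where "f = (\<lambda>x. (h x - 1) / (h x + 1))"
    have hre: "0 < Re (h x)" if "x \<in> ball 0 1" for x using re[OF that] e by (simp add: h_def)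
    have h1: "h x + 1 \<noteq> 0" if "x \<in> ball 0 1" for x
      using hre[OF that] by (metis add_cancel_right_left add_eq_0_iff add_strict_increasing2 less_irrefl one_complex.simps(1) plus_complex.simps(1) uminus_complex.simps(1) zero_complex.simps(1) zero_less_one less_imp_le)
    have id: "(cmod (h x + 1))\<^sup>2 - (cmod (h x - 1))\<^sup>2 = 4 * Re (h x)" for x
      unfolding cmod_power2 by (simp add: power2_eq_square algebra_simps)
    have f1: "1 - (cmod (f x))\<^sup>2 = 4 * Re (h x) / (cmod (h x + 1))\<^sup>2" if "x \<in> ball 0 1" for x
    proof -
      have "1 - (cmod (f x))\<^sup>2 = ((cmod (h x + 1))\<^sup>2 - (cmod (h x - 1))\<^sup>2) / (cmod (h x + 1))\<^sup>2"
        using h1[OF that] by (subst diff_divide_distrib) (simp add: f_def norm_divide power_divide)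
      then show ?thesis by (simp only: id)
    qed
    have f2: "f holomorphic_on ball 0 1"
      unfolding f_def h_def using h1 hol by (intro holomorphic_intros) (auto simp: h_def)
    have f3: "f ` ball 0 1 \<subseteq> ball 0 1"
    proof clarify
      fix x :: complex assume x: "x \<in> ball 0 1"
      have "0 < 1 - (cmod (f x))\<^sup>2" unfolding f1[OF x] using hre[OF x] h1[OF x] by simp
      then have "cmod (f x) < 1" by (simp add: power_less_one_iff abs_square_less_1)
      then show "f x \<in> ball 0 1" by simp
    qed
    have fd: "(cmod (f z - f w))\<^sup>2 = 4 * (cmod (h z - h w))\<^sup>2 / ((cmod (h z + 1))\<^sup>2 * (cmod (h w + 1))\<^sup>2)"
    proof -
      have "f z - f w = 2 * (h z - h w) / ((h z + 1) * (h w + 1))"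
        using h1[OF z] h1[OF w] by (simp add: f_def field_simps)
      then show ?thesis by (simp only: norm_divide norm_mult power_divide power_mult_distrib) simp
    qed
    define X where "X = (cmod (h z + 1))\<^sup>2 * (cmod (h w + 1))\<^sup>2"
    have X: "X > 0" using h1 z w by (simp add: X_def)
    define Q where "Q = (1 - (cmod z)\<^sup>2) * (1 - (cmod w)\<^sup>2)"
    have "4 * (cmod (h z - h w))\<^sup>2 / X * Q \<le> (cmod (z - w))\<^sup>2 * (16 * (Re (h z) * Re (h w)) / X)"
      using schwarz_pick[OF f2 f3 z w] unfolding fd f1[OF z] f1[OF w] Q_def X_def by (simp add: field_simps)
    then have "4 * (cmod (h z - h w))\<^sup>2 * Q \<le> (cmod (z - w))\<^sup>2 * (16 * (Re (h z) * Re (h w)))"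
      using X by (simp add: field_simps)
    then have "(cmod (h z - h w))\<^sup>2 * Q \<le> 4 * (cmod (z - w))\<^sup>2 * (Re (h z) * Re (h w))"
      by linarith
    moreover have "h z - h w = g z - g w" "Re (h z) = Re (g z) + e" "Re (h w) = Re (g w) + e"
      by (simp_all add: h_def)
    ultimately show ?thesis by (simp only: Q_def)
  qed
  show ?thesis
  proof (rule tendsto_lowerbound)
    show "((\<lambda>e. 4 * (cmod (z - w))\<^sup>2 * ((Re (g z) + e) * (Re (g w) + e))) \<longlongrightarrow>
       4 * (cmod (z - w))\<^sup>2 * (Re (g z) * Re (g w))) (at_right 0)"
      by (auto intro!: tendsto_eq_intros)
    show "\<forall>\<^sub>F e in at_right 0. (cmod (g z - g w))\<^sup>2 * ((1 - (cmod z)\<^sup>2) * (1 - (cmod w)\<^sup>2))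
       \<le> 4 * (cmod (z - w))\<^sup>2 * ((Re (g z) + e) * (Re (g w) + e))"
      using eps by (auto simp: eventually_at_right_less intro: eventually_mono[OF eventually_at_right_less])
  qed simp
qed

section \<open>Julia--Wolff--Caratheodory theory for functions with non-negative real part\<close>

text \<open>Schwarz--Pick and the Poisson kernel involve \<open>1 - |z|^2\<close>, Stolz regions
  \<open>1 - |z|\<close>; since \<open>|z|^2 <= |z|\<close>, the aperture need not change.\<close>

lemma stolz_regionD:
  assumes "z \<in> stolz_region \<sigma> M" "M > 1"
  shows "z \<in> ball 0 1" "cmod z < 1" "cmod (\<sigma> - z) \<le> M * (1 - (cmod z)\<^sup>2)"
proof -
  show 1: "z \<in> ball 0 1" using assms by (simp add: stolz_region_def)
  then show 2: "cmod z < 1" by simp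
  have "(cmod z)\<^sup>2 \<le> cmod z" using 2 by (simp add: power2_eq_square mult_left_le)
  then have "M * (1 - cmod z) \<le> M * (1 - (cmod z)\<^sup>2)" using assms by simp
  moreover have "cmod (\<sigma> - z) < M * (1 - cmod z)" using assms by (simp add: stolz_region_def)
  ultimately show "cmod (\<sigma> - z) \<le> M * (1 - (cmod z)\<^sup>2)" by linarith
qed

lemma at_within_stolz_cong:
  assumes "\<And>z. z \<in> ball 0 1 \<Longrightarrow> f z = g z"
  shows "(f \<longlongrightarrow> l) (at \<sigma> within stolz_region \<sigma> M) \<longleftrightarrow> (g \<longlongrightarrow> l) (at \<sigma> within stolz_region \<sigma> M)"
  by (intro Lim_cong_within refl) (auto simp: stolz_region_def assms)

lemma one_minus_norm_sq_pos: "z \<in> ball 0 1 \<Longrightarrow> 0 < 1 - (cmod z)\<^sup>2"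
  by (simp add: power_less_one_iff abs_square_less_1)

text \<open>In the language of Herglotz measures: a positive harmonic function whose quotient by the
  Poisson kernel at \<sigma> has infimum 0 carries no point mass at \<sigma>. Schwarz--Pick against
  one point \<open>w\<close> with a small quotient controls \<open>g\<close> near \<sigma>; the
  blow-up rate \<open>1 / (1 - |z|^2)\<close> is absorbed by \<open>|\<sigma> - z|\<close> inside a
  Stolz region.\<close>

lemma angular_limit_zero_of_vanishing_poisson_ratio:
  assumes hol: "g holomorphic_on ball 0 1" and re: "\<And>z. z \<in> ball 0 1 \<Longrightarrow> 0 \<le> Re (g z)"
    and \<sigma>: "\<sigma> \<in> sphere 0 1"
    and small: "\<And>e. e > 0 \<Longrightarrow> \<exists>w\<in>ball 0 1. Re (g w) * (cmod (\<sigma> - w))\<^sup>2 \<le> e * (1 - (cmod w)\<^sup>2)"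
  shows "has_angular_limit (\<lambda>z. (\<sigma> - z) * g z) \<sigma> 0"
  unfolding has_angular_limit_def
proof (intro allI impI tendstoI)
  fix M \<epsilon> :: real assume M: "M > 1" and \<epsilon>: "\<epsilon> > 0"
  \<comment> \<open>The bound \<open>U\<close> below tends to \<open>4 * e * M\<close> at \<sigma>,
    which this choice makes \<open>\<epsilon> / 2\<close>.\<close>
  define e where "e = \<epsilon> / (8 * M)"
  have e: "e > 0" "4 * e * M < \<epsilon>" using M \<epsilon> by (auto simp: e_def)
  obtain w where w: "w \<in> ball 0 1" and we: "Re (g w) * (cmod (\<sigma> - w))\<^sup>2 \<le> e * (1 - (cmod w)\<^sup>2)"
    using small[OF e(1)] by blast
  have sw: "cmod (\<sigma> - w) > 0" using \<sigma> w by auto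
  define U where "U = (\<lambda>z. 2 * cmod (g w) * cmod (\<sigma> - z) + 4 * e * M * ((cmod (z - w))\<^sup>2 / (cmod (\<sigma> - w))\<^sup>2))"
  have bound: "cmod ((\<sigma> - z) * g z) \<le> U z" if zs: "z \<in> stolz_region \<sigma> M" for z
  proof -
    note z = stolz_regionD[OF zs M]
    have pz: "1 - (cmod z)\<^sup>2 > 0" and pw: "1 - (cmod w)\<^sup>2 > 0"
      using one_minus_norm_sq_pos z(1) w by auto
    define D where "D = cmod (g z - g w)"
    define X where "X = 4 * (cmod (z - w))\<^sup>2 * Re (g w) / ((1 - (cmod z)\<^sup>2) * (1 - (cmod w)\<^sup>2))"
    have rw: "0 \<le> Re (g w)" using re w by auto
    have X0: "X \<ge> 0" unfolding X_def using pz pw rw by (intro divide_nonneg_pos mult_nonneg_nonneg) auto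
    have "D\<^sup>2 * ((1 - (cmod z)\<^sup>2) * (1 - (cmod w)\<^sup>2)) \<le> 4 * (cmod (z - w))\<^sup>2 * (Re (g z) * Re (g w))"
      using schwarz_pick_halfplane[OF hol re z(1) w] by (simp add: D_def)
    then have "D\<^sup>2 \<le> 4 * (cmod (z - w))\<^sup>2 * (Re (g z) * Re (g w)) / ((1 - (cmod z)\<^sup>2) * (1 - (cmod w)\<^sup>2))"
      using pz pw by (simp add: pos_le_divide_eq)
    also have "\<dots> = X * Re (g z)" by (simp add: X_def)
    finally have DX: "D\<^sup>2 \<le> X * Re (g z)" .
    have "Re (g z) \<le> Re (g w) + D" unfolding D_def
      using complex_Re_le_cmod[of "g z - g w"] by simp
    then have "D\<^sup>2 \<le> X * (Re (g w) + D)" using DX X0 by (meson mult_left_mono order_trans)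
    then have DD: "D * D \<le> X * D + X * Re (g w)" by (simp add: power2_eq_square algebra_simps)
    \<comment> \<open>A quadratic inequality in \<open>D\<close>: beyond \<open>X + Re (g w)\<close>
      the left side of \<open>DD\<close> outgrows the right side.\<close>
    have D: "D \<le> X + Re (g w)"
    proof (rule ccontr)
      assume "\<not> ?thesis"
      then have gt: "D > X + Re (g w)" by simp
      then have "D * D > (X + Re (g w)) * D" using X0 rw by (intro mult_strict_right_mono) auto
      moreover have "Re (g w) * D \<ge> Re (g w) * X" using gt rw by (intro mult_left_mono) auto
      ultimately show False using DD by (simp add: algebra_simps)
    qed
    have "cmod (g z) \<le> cmod (g w) + D" unfolding D_def
      by (metis add.commute norm_triangle_sub)
    also have "\<dots> \<le> 2 * cmod (g w) + X" using D complex_Re_le_cmod[of "g w"] by simp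
    finally have gz: "cmod (g z) \<le> 2 * cmod (g w) + X" .
    have t: "Re (g w) / (1 - (cmod w)\<^sup>2) \<le> e / (cmod (\<sigma> - w))\<^sup>2"
      using we sw pw by (simp add: field_simps)
    have t2: "cmod (\<sigma> - z) / (1 - (cmod z)\<^sup>2) \<le> M" using z(3) pz by (simp add: pos_divide_le_eq)
    have "cmod (\<sigma> - z) * X = 4 * (cmod (z - w))\<^sup>2 * (Re (g w) / (1 - (cmod w)\<^sup>2) * (cmod (\<sigma> - z) / (1 - (cmod z)\<^sup>2)))"
      by (simp add: X_def mult_ac)
    also have "\<dots> \<le> 4 * (cmod (z - w))\<^sup>2 * (e / (cmod (\<sigma> - w))\<^sup>2 * M)"
      using e M pz by (intro mult_left_mono mult_mono t t2) auto
    also have "\<dots> = 4 * e * M * ((cmod (z - w))\<^sup>2 / (cmod (\<sigma> - w))\<^sup>2)" by simp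
    finally have X2: "cmod (\<sigma> - z) * X \<le> 4 * e * M * ((cmod (z - w))\<^sup>2 / (cmod (\<sigma> - w))\<^sup>2)" .
    have "cmod ((\<sigma> - z) * g z) \<le> cmod (\<sigma> - z) * (2 * cmod (g w) + X)"
      unfolding norm_mult using gz by (intro mult_left_mono) auto
    also have "\<dots> \<le> U z" using X2 by (simp add: U_def algebra_simps)
    finally show ?thesis .
  qed
  have "(U \<longlongrightarrow> 2 * cmod (g w) * cmod (\<sigma> - \<sigma>) + 4 * e * M * ((cmod (\<sigma> - w))\<^sup>2 / (cmod (\<sigma> - w))\<^sup>2))
      (at \<sigma> within stolz_region \<sigma> M)" unfolding U_def
    using sw by (intro tendsto_intros) auto
  then have "(U \<longlongrightarrow> 4 * e * M) (at \<sigma> within stolz_region \<sigma> M)" using sw by simp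
  then have "\<forall>\<^sub>F z in at \<sigma> within stolz_region \<sigma> M. U z < \<epsilon>" using e order_tendstoD(2) by blast
  moreover have "\<forall>\<^sub>F z in at \<sigma> within stolz_region \<sigma> M. z \<in> stolz_region \<sigma> M"
    by (simp add: eventually_at_filter)
  ultimately show "\<forall>\<^sub>F z in at \<sigma> within stolz_region \<sigma> M. dist ((\<sigma> - z) * g z) 0 < \<epsilon>"
    by eventually_elim (use bound in fastforce)
qed

text \<open>Schwarz--Pick between \<open>z\<close> and \<open>x n\<close>: the hypothesis on
  \<open>Re (q (x n))\<close> supplies the factor \<open>1 - |x n|^2\<close> that cancels, so the
  inequality survives at the boundary. The number \<beta> arises from a subsequential limit of
  \<open>q (x n)\<close>, purely imaginary because the real parts tend to 0.\<close>

lemma julia_halfplane: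
  assumes hol: "q holomorphic_on ball 0 1" and re: "\<And>z. z \<in> ball 0 1 \<Longrightarrow> 0 \<le> Re (q z)"
    and x: "\<And>n. x n \<in> ball 0 1" and lim: "x \<longlonglongrightarrow> \<sigma>" and \<sigma>: "\<sigma> \<in> sphere 0 1"
    and A: "\<And>n. Re (q (x n)) \<le> A * (1 - (cmod (x n))\<^sup>2)"
  shows "\<exists>\<beta>::real. \<forall>z\<in>ball 0 1.
    (cmod (q z - \<i> * \<beta>))\<^sup>2 * (1 - (cmod z)\<^sup>2) \<le> 4 * A * Re (q z) * (cmod (\<sigma> - z))\<^sup>2"
proof -
  have px: "1 - (cmod (x n))\<^sup>2 > 0" for n using one_minus_norm_sq_pos x by auto
  have key: "(cmod (q z - q (x n)))\<^sup>2 * (1 - (cmod z)\<^sup>2) \<le> 4 * A * Re (q z) * (cmod (x n - z))\<^sup>2"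
    if z: "z \<in> ball 0 1" for z n
  proof -
    have "(cmod (q z - q (x n)))\<^sup>2 * ((1 - (cmod z)\<^sup>2) * (1 - (cmod (x n))\<^sup>2))
       \<le> 4 * (cmod (z - x n))\<^sup>2 * (Re (q z) * Re (q (x n)))"
      by (rule schwarz_pick_halfplane[OF hol re z x])
    also have "\<dots> \<le> 4 * (cmod (z - x n))\<^sup>2 * (Re (q z) * (A * (1 - (cmod (x n))\<^sup>2)))"
      using re[OF z] by (intro mult_left_mono A) auto
    finally have "((cmod (q z - q (x n)))\<^sup>2 * (1 - (cmod z)\<^sup>2)) * (1 - (cmod (x n))\<^sup>2)
       \<le> (4 * A * Re (q z) * (cmod (x n - z))\<^sup>2) * (1 - (cmod (x n))\<^sup>2)"
      by (simp add: algebra_simps norm_minus_commute)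
    then show ?thesis using px by (simp only: mult_le_cancel_right_pos)
  qed
  have A0: "A \<ge> 0"
    using A[of 0] re[OF x] px[of 0] by (meson linorder_not_le mult_neg_pos order_trans)
  \<comment> \<open>The case \<open>z = 0\<close> bounds the values \<open>q (x n)\<close>, as
    compactness requires.\<close>
  have "(cmod (q 0 - q (x n)))\<^sup>2 \<le> 4 * A * Re (q 0)" for n
  proof -
    have "(cmod (x n))\<^sup>2 \<le> 1" using px[of n] by linarith
    then have "4 * A * Re (q 0) * (cmod (x n))\<^sup>2 \<le> 4 * A * Re (q 0)"
      using A0 re[of 0] by (intro mult_left_le) auto
    then show ?thesis using key[of 0 n] by simp
  qed
  then have "cmod (q 0 - q (x n)) \<le> sqrt (4 * A * Re (q 0))" for n by (simp add: real_le_rsqrt)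
  then have "cmod (q (x n)) \<le> cmod (q 0) + sqrt (4 * A * Re (q 0))" for n
    by (smt (verit) norm_minus_commute norm_triangle_sub)
  then have "bounded (range (q \<circ> x))" by (auto simp: bounded_iff)
  then obtain l r where r: "strict_mono (r :: nat \<Rightarrow> nat)" and l: "((q \<circ> x) \<circ> r) \<longlonglongrightarrow> l"
    using bounded_imp_convergent_subsequence by blast
  have xr: "(x \<circ> r) \<longlonglongrightarrow> \<sigma>" using lim r LIMSEQ_subseq_LIMSEQ by blast
  have "Re l = 0"
  proof (rule antisym)
    have "(\<lambda>n. A * (1 - (cmod ((x \<circ> r) n))\<^sup>2)) \<longlonglongrightarrow> A * (1 - (cmod \<sigma>)\<^sup>2)"
      by (intro tendsto_intros xr)
    moreover have "(\<lambda>n. Re (((q \<circ> x) \<circ> r) n)) \<longlonglongrightarrow> Re l" by (intro tendsto_intros l)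
    ultimately have "Re l \<le> A * (1 - (cmod \<sigma>)\<^sup>2)"
      using LIMSEQ_le[of _ "Re l" _ "A * (1 - (cmod \<sigma>)\<^sup>2)"] A by auto
    then show "Re l \<le> 0" using \<sigma> by simp
    show "0 \<le> Re l"
      by (rule LIMSEQ_le_const[OF \<open>(\<lambda>n. Re (((q \<circ> x) \<circ> r) n)) \<longlonglongrightarrow> Re l\<close>]) (use re x in auto)
  qed
  then have l_eq: "l = \<i> * Im l" by (simp add: complex_eq_iff)
  show ?thesis
  proof (intro exI ballI)
    fix z :: complex assume z: "z \<in> ball 0 1"
    have "(\<lambda>n. (cmod (q z - ((q \<circ> x) \<circ> r) n))\<^sup>2 * (1 - (cmod z)\<^sup>2)) \<longlonglongrightarrow> (cmod (q z - l))\<^sup>2 * (1 - (cmod z)\<^sup>2)"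
      by (intro tendsto_intros l)
    moreover have "(\<lambda>n. 4 * A * Re (q z) * (cmod ((x \<circ> r) n - z))\<^sup>2) \<longlonglongrightarrow> 4 * A * Re (q z) * (cmod (\<sigma> - z))\<^sup>2"
      by (intro tendsto_intros xr)
    ultimately have "(cmod (q z - l))\<^sup>2 * (1 - (cmod z)\<^sup>2) \<le> 4 * A * Re (q z) * (cmod (\<sigma> - z))\<^sup>2"
      by (rule LIMSEQ_le) (use key z in auto)
    then show "(cmod (q z - \<i> * Im l))\<^sup>2 * (1 - (cmod z)\<^sup>2) \<le> 4 * A * Re (q z) * (cmod (\<sigma> - z))\<^sup>2"
      using l_eq by simp
  qed
qed

section \<open>Caratheodory's theorem: extraction of the boundary mass\<close>

lemma Re_poisson_kernel:
  assumes "cmod \<sigma> = 1"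
  shows "Re ((\<sigma> + z) / (\<sigma> - z)) = (1 - (cmod z)\<^sup>2) / (cmod (\<sigma> - z))\<^sup>2"
proof -
  have s: "(Re \<sigma>)\<^sup>2 + (Im \<sigma>)\<^sup>2 = 1" using assms cmod_power2[of \<sigma>] by simp
  have "Re ((\<sigma> + z) / (\<sigma> - z)) = (Re (\<sigma> + z) * Re (\<sigma> - z) + Im (\<sigma> + z) * Im (\<sigma> - z)) / (cmod (\<sigma> - z))\<^sup>2"
    by (simp add: Re_divide cmod_power2)
  also have "Re (\<sigma> + z) * Re (\<sigma> - z) + Im (\<sigma> + z) * Im (\<sigma> - z) = 1 - (cmod z)\<^sup>2"
    using s unfolding cmod_power2[of z] by (simp add: power2_eq_square algebra_simps)
  finally show ?thesis .
qed

text \<open>The function \<open>F = 1 / (q - \<i> * \<beta>)\<close> has positive real part, at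
  least \<open>1 / B\<close> times the Poisson kernel \<open>P\<close>. Removing the largest
  multiple \<open>c * P\<close> leaves no point mass at \<sigma>, so
  \<open>(\<sigma> - z) * F z\<close> tends to \<open>2 * c * \<sigma>\<close>. The optimal constant
  \<open>\<delta> = 1 / c\<close> in Julia's inequality is therefore the one read off from the
  angular derivative.\<close>

lemma julia_caratheodory_halfplane:
  fixes \<beta> B :: real
  assumes hol: "q holomorphic_on ball 0 1" and re: "\<And>z. z \<in> ball 0 1 \<Longrightarrow> 0 \<le> Re (q z)"
    and \<sigma>: "\<sigma> \<in> sphere 0 1"
    and B: "\<And>z. z \<in> ball 0 1 \<Longrightarrow>
      (cmod (q z - \<i> * \<beta>))\<^sup>2 * (1 - (cmod z)\<^sup>2) \<le> B * Re (q z) * (cmod (\<sigma> - z))\<^sup>2"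
  shows "\<exists>\<delta>\<ge>0. (\<forall>z\<in>ball 0 1. (cmod (q z - \<i> * \<beta>))\<^sup>2 * (1 - (cmod z)\<^sup>2) \<le> \<delta> * Re (q z) * (cmod (\<sigma> - z))\<^sup>2)
    \<and> has_angular_limit (\<lambda>z. (q z - \<i> * \<beta>) / (z - \<sigma>)) \<sigma> (- of_real \<delta> * cnj \<sigma> / 2)"
proof (cases "\<exists>w\<in>ball 0 1. q w = \<i> * \<beta>")
  \<comment> \<open>A value on the imaginary axis inside the disc forces \<open>q\<close> to be
    constant, by Schwarz--Pick; then \<open>\<delta> = 0\<close>. Otherwise \<open>F\<close> below
    has no poles.\<close>
  case True
  then obtain w where w: "w \<in> ball 0 1" "q w = \<i> * \<beta>" by blast
  have const: "q z = \<i> * \<beta>" if z: "z \<in> ball 0 1" for z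
  proof -
    have "(cmod (q z - q w))\<^sup>2 * ((1 - (cmod z)\<^sup>2) * (1 - (cmod w)\<^sup>2)) \<le> 0"
      using schwarz_pick_halfplane[OF hol re z w(1)] w(2) by simp
    moreover have "(1 - (cmod z)\<^sup>2) * (1 - (cmod w)\<^sup>2) > 0" using one_minus_norm_sq_pos z w by simp
    ultimately have "(cmod (q z - q w))\<^sup>2 \<le> 0" by (meson linorder_not_le mult_pos_pos)
    then show ?thesis using w by simp
  qed
  have "has_angular_limit (\<lambda>z. (q z - \<i> * \<beta>) / (z - \<sigma>)) \<sigma> 0"
    unfolding has_angular_limit_def
    using at_within_stolz_cong[of "\<lambda>z. (q z - \<i> * \<beta>) / (z - \<sigma>)" "\<lambda>z. 0"] const by simp
  then show ?thesis using const by (intro exI[of _ 0]) simp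
next
  case False
  have ps: "cmod \<sigma> = 1" using \<sigma> by simp
  have sz: "\<sigma> - z \<noteq> 0" "cmod (\<sigma> - z) > 0" if "z \<in> ball 0 1" for z using that ps by auto
  define F where "F = (\<lambda>z. 1 / (q z - \<i> * \<beta>))"
  define P where "P = (\<lambda>z. (1 - (cmod z)\<^sup>2) / (cmod (\<sigma> - z))\<^sup>2)"
  have P: "P z > 0" if "z \<in> ball 0 1" for z
    using that sz one_minus_norm_sq_pos by (simp add: P_def)
  have nz: "q z - \<i> * \<beta> \<noteq> 0" if "z \<in> ball 0 1" for z using False that by auto
  have BR: "B * Re (q z) > 0" if z: "z \<in> ball 0 1" for z
  proof -
    have "0 < (cmod (q z - \<i> * \<beta>))\<^sup>2 * (1 - (cmod z)\<^sup>2)" using nz[OF z] one_minus_norm_sq_pos z by simp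
    also have "\<dots> \<le> B * Re (q z) * (cmod (\<sigma> - z))\<^sup>2" by (rule B[OF z])
    finally show ?thesis using sz[OF z] by (simp add: zero_less_mult_iff)
  qed
  have Rq: "Re (q z) > 0" if z: "z \<in> ball 0 1" for z using BR[OF z] re[OF z] by (metis less_eq_real_def mult_zero_right less_irrefl)
  have B0: "B > 0" using BR[of 0] Rq[of 0] by (simp add: zero_less_mult_iff)
  have ReF: "Re (F z) = Re (q z) / (cmod (q z - \<i> * \<beta>))\<^sup>2" for z
    by (simp add: F_def Re_divide cmod_power2)
  have FB: "Re (F z) / P z \<ge> 1 / B" if z: "z \<in> ball 0 1" for z
    using B[OF z] nz[OF z] P[OF z] sz[OF z] B0 one_minus_norm_sq_pos[OF z] unfolding ReF P_def by (simp add: field_simps)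
  \<comment> \<open>An infimum rather than a limit: it gives the sharp inequality at every point,
    and points that nearly attain it give the smallness required for \<open>g\<close>.\<close>
  define c where "c = Inf ((\<lambda>z. Re (F z) / P z) ` ball 0 1)"
  have bdd: "bdd_below ((\<lambda>z. Re (F z) / P z) ` ball 0 1)" using FB by (intro bdd_belowI2) auto
  have c1: "c \<ge> 1 / B" unfolding c_def using FB by (intro cINF_greatest) auto
  then have c0: "c > 0" using B0 by (metis less_le_trans zero_less_divide_1_iff)
  have cF: "Re (F z) / P z \<ge> c" if z: "z \<in> ball 0 1" for z
    unfolding c_def using bdd z by (intro cINF_lower) auto
  define g where "g = (\<lambda>z. F z - c * ((\<sigma> + z) / (\<sigma> - z)))"
  have Reg: "Re (g z) = Re (F z) - c * P z" for z
  proof -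
    have "Re (of_real c * x) = c * Re x" for x by simp
    then show ?thesis unfolding g_def P_def Re_poisson_kernel[OF ps, symmetric] by (simp only: minus_complex.simps)
  qed
  have "has_angular_limit (\<lambda>z. (\<sigma> - z) * g z) \<sigma> 0"
  proof (rule angular_limit_zero_of_vanishing_poisson_ratio[OF _ _ \<sigma>])
    show "g holomorphic_on ball 0 1" unfolding g_def F_def
      using hol nz sz by (intro holomorphic_intros) auto
    show "0 \<le> Re (g z)" if "z \<in> ball 0 1" for z
      using cF[OF that] P[OF that] by (simp add: Reg pos_le_divide_eq)
    show "\<exists>w\<in>ball 0 1. Re (g w) * (cmod (\<sigma> - w))\<^sup>2 \<le> e * (1 - (cmod w)\<^sup>2)" if e: "e > 0" for e
    proof -
      obtain w where w: "w \<in> ball 0 1" "Re (F w) / P w < c + e"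
        using cInf_lessD[of "(\<lambda>z. Re (F z) / P z) ` ball 0 1" "c + e"] e by (auto simp: c_def)
      then have "Re (g w) \<le> e * P w" using P[OF w(1)] by (simp add: Reg pos_divide_less_eq algebra_simps)
      then show ?thesis using w sz[OF w(1)] by (intro bexI[OF _ w(1)]) (simp add: P_def pos_le_divide_eq)
    qed
  qed
  then have lim: "((\<lambda>z. (\<sigma> - z) * g z) \<longlongrightarrow> 0) (at \<sigma> within stolz_region \<sigma> M)" if "M > 1" for M
    using that by (simp add: has_angular_limit_def)
  have "((\<lambda>z. (q z - \<i> * \<beta>) / (z - \<sigma>)) \<longlongrightarrow> - of_real (1 / c) * cnj \<sigma> / 2) (at \<sigma> within stolz_region \<sigma> M)"
    if M: "M > 1" for M
  proof -
    have s0: "\<sigma> \<noteq> 0" using ps by auto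
    have "((\<lambda>z. - 1 / ((\<sigma> - z) * g z + c * (\<sigma> + z))) \<longlongrightarrow> - 1 / (0 + c * (\<sigma> + \<sigma>))) (at \<sigma> within stolz_region \<sigma> M)"
      using c0 s0 by (intro tendsto_intros lim M) auto
    moreover have "- 1 / (0 + c * (\<sigma> + \<sigma>)) = - of_real (1 / c) * cnj \<sigma> / 2"
    proof -
      have "\<sigma> * cnj \<sigma> = 1" using ps by (simp add: complex_norm_square[symmetric])
      then have "cnj \<sigma> = 1 / \<sigma>" using s0 by (simp add: field_simps)
      then show ?thesis using s0 c0 by (simp add: field_simps)
    qed
    moreover have "- 1 / ((\<sigma> - z) * g z + c * (\<sigma> + z)) = (q z - \<i> * \<beta>) / (z - \<sigma>)" if "z \<in> ball 0 1" for z
    proof -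
      have "(\<sigma> - z) * g z + c * (\<sigma> + z) = (\<sigma> - z) * F z" using sz[OF that] by (simp add: g_def field_simps)
      also have "\<dots> = (\<sigma> - z) / (q z - \<i> * \<beta>)" by (simp add: F_def)
      finally have "- 1 / ((\<sigma> - z) * g z + c * (\<sigma> + z)) = - (q z - \<i> * \<beta>) / (\<sigma> - z)" by simp
      then show ?thesis by (metis minus_diff_eq minus_divide_divide)
    qed
    ultimately show ?thesis
      using at_within_stolz_cong[of "\<lambda>z. - 1 / ((\<sigma> - z) * g z + c * (\<sigma> + z))" "\<lambda>z. (q z - \<i> * \<beta>) / (z - \<sigma>)"]
      by simp
  qed
  moreover have "(cmod (q z - \<i> * \<beta>))\<^sup>2 * (1 - (cmod z)\<^sup>2) \<le> 1 / c * Re (q z) * (cmod (\<sigma> - z))\<^sup>2"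
    if z: "z \<in> ball 0 1" for z
  proof -
    have "c * P z \<le> Re (q z) / (cmod (q z - \<i> * \<beta>))\<^sup>2"
      using cF[OF z] P[OF z] unfolding ReF[symmetric] by (simp add: pos_le_divide_eq)
    then show ?thesis using sz[OF z] nz[OF z] c0 by (simp add: P_def field_simps)
  qed
  ultimately show ?thesis using c0 unfolding has_angular_limit_def by (intro exI[of _ "1 / c"]) auto
qed

text \<open>Writing \<open>H z = a - cnj a * z\<^sup>2 - z * q z\<close> with \<open>a = H 0\<close>, the hypothesis on \<open>H\<close> says that
  \<open>Re q \<ge> 0\<close>, and \<open>R z = (cmod z)\<^sup>2 * Re (q z) / (1 - (cmod z)\<^sup>2)\<close>. The numbers \<open>\<beta>\<close> and \<open>\<delta>\<close>
  describe \<open>q\<close> at \<open>\<sigma>\<close>: its angular limit is \<open>\<i> * \<beta>\<close> and its angular derivative \<open>- \<delta> * cnj \<sigma> / 2\<close>.\<close>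

lemma boundary_behaviour_of_generator:
  fixes H :: "complex \<Rightarrow> complex"
  defines "R \<equiv> \<lambda>z. (Re (H 0 * cnj z) * (1 - (cmod z)\<^sup>2) - Re (cnj z * H z)) / (1 - (cmod z)\<^sup>2)"
  assumes hol: "H holomorphic_on ball 0 1"
    and gen: "\<forall>z\<in>ball 0 1. Re (cnj z * H z) \<le> Re (H 0 * cnj z) * (1 - (cmod z)\<^sup>2)"
    and \<sigma>: "\<sigma> \<in> sphere 0 1"
    and x: "\<And>n. x n \<in> ball 0 1" and lim: "x \<longlonglongrightarrow> \<sigma>"
    and A: "\<And>n. R (x n) \<le> A"
  shows "\<exists>\<beta> \<delta>::real. \<delta> \<ge> 0
    \<and> has_angular_limit H \<sigma> (H 0 - cnj (H 0) * \<sigma>\<^sup>2 - \<sigma> * (\<i> * \<beta>))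
    \<and> has_angular_derivative H \<sigma> (- 2 * cnj (H 0) * \<sigma> - \<i> * \<beta> + \<delta> / 2)
    \<and> (\<forall>M>1. (R \<longlongrightarrow> \<delta> / 4) (at \<sigma> within stolz_region \<sigma> M))
    \<and> (\<forall>z\<in>ball 0 1. R z * (1 - (cmod z)\<^sup>2)\<^sup>2 \<le> \<delta> * (cmod (\<sigma> - z))\<^sup>2)
    \<and> (\<forall>z\<in>ball 0 1. cmod (H z) * (1 - (cmod z)\<^sup>2)
          \<le> (2 * cmod (H 0) + \<bar>\<beta>\<bar>) * (1 - (cmod z)\<^sup>2) + \<delta> * (cmod (\<sigma> - z))\<^sup>2)
    \<and> \<bar>\<beta>\<bar> \<le> 4 * cmod (H 0) + 2 * cmod (H (1/2)) + 3 * \<delta>"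
proof -
  define a where "a = H 0"
  \<comment> \<open>On the circle the field \<open>a - cnj a * z^2\<close> is tangential, as
    \<open>Re (cnj z * (a - cnj a * z^2)) = 0\<close> for \<open>|z| = 1\<close>; \<open>q\<close>
    carries the inward part. The value at 0 fills a removable singularity.\<close>
  define q where "q = (\<lambda>z. if z = 0 then deriv (\<lambda>z. a - H z - cnj a * z\<^sup>2) 0 else (a - H z - cnj a * z\<^sup>2) / z)"
  have ps: "cmod \<sigma> = 1" using \<sigma> by simp
  have q_hol: "q holomorphic_on ball 0 1"
  proof (rule pole_theorem_open_0)
    show "(\<lambda>z. a - H z - cnj a * z\<^sup>2) holomorphic_on ball 0 1" by (intro holomorphic_intros hol)
  qed (auto simp: q_def a_def)
  have Hq: "H z = a - cnj a * z\<^sup>2 - z * q z" for z by (simp add: q_def a_def)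
  have p: "1 - (cmod z)\<^sup>2 > 0" if "z \<in> ball 0 1" for z using one_minus_norm_sq_pos that .
  have zq: "Re (H 0 * cnj z) * (1 - (cmod z)\<^sup>2) - Re (cnj z * H z) = (cmod z)\<^sup>2 * Re (q z)" for z
  proof -
    have "Re (cnj z * H z) = Re (a * cnj z) - Re (cnj a * z * (cnj z * z)) - Re ((cnj z * z) * q z)"
      unfolding Hq by (simp add: algebra_simps power2_eq_square)
    also have "cnj z * z = of_real ((cmod z)\<^sup>2)" by (metis complex_norm_square mult.commute)
    also have "Re (cnj a * z * of_real ((cmod z)\<^sup>2)) = Re (a * cnj z) * (cmod z)\<^sup>2" by simp
    also have "Re (of_real ((cmod z)\<^sup>2) * q z) = (cmod z)\<^sup>2 * Re (q z)" by simp
    finally show ?thesis by (simp add: a_def algebra_simps)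
  qed
  have R: "R z = (cmod z)\<^sup>2 * Re (q z) / (1 - (cmod z)\<^sup>2)" for z unfolding R_def zq ..
  have q_re: "0 \<le> Re (q z)" if z: "z \<in> ball 0 1" for z
  proof -
    have *: "0 \<le> Re (q z)" if "z \<in> ball 0 1" "z \<noteq> 0" for z
    proof -
      have "0 \<le> (cmod z)\<^sup>2 * Re (q z)" using gen[rule_format, OF that(1)] zq[of z] by linarith
      then show ?thesis using that(2) by (simp add: zero_le_mult_iff)
    qed
    show ?thesis
    proof (cases "z = 0")
      case True
      have "isCont q 0" using q_hol
        by (metis centre_in_ball continuous_on_eq_continuous_at holomorphic_on_imp_continuous_on open_ball zero_less_one)
      then have "((\<lambda>z. Re (q z)) \<longlongrightarrow> Re (q 0)) (at 0)" by (intro tendsto_intros) (simp add: isCont_def)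
      moreover have "\<forall>\<^sub>F z in at (0::complex). 0 \<le> Re (q z)"
        by (rule eventually_mono[OF eventually_at_in_open[of "ball 0 1"]]) (use * in auto)
      ultimately show ?thesis using True tendsto_lowerbound by (metis at_neq_bot)
    qed (use * z in auto)
  qed
  \<comment> \<open>\<open>R\<close> carries the factor \<open>|z|^2\<close>, which has to be
    divided out to reach \<open>Re q\<close>. From \<open>N\<close> on it exceeds
    \<open>1/4\<close>, so \<open>A\<close> becomes \<open>4 * A\<close>; a tail of \<open>x\<close>
    serves as well.\<close>
  obtain N where N: "\<And>n. n \<ge> N \<Longrightarrow> (cmod (x n))\<^sup>2 > 1/4"
  proof -
    have "(\<lambda>n. (cmod (x n))\<^sup>2) \<longlonglongrightarrow> (cmod \<sigma>)\<^sup>2" by (intro tendsto_intros lim)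
    then have "\<forall>\<^sub>F n in sequentially. (cmod (x n))\<^sup>2 > 1/4" using ps by (intro order_tendstoD(1)) auto
    then show ?thesis using that by (auto simp: eventually_sequentially)
  qed
  have Aq: "Re (q (x (n + N))) \<le> 4 * A * (1 - (cmod (x (n + N)))\<^sup>2)" for n
  proof -
    have "(cmod (x (n + N)))\<^sup>2 * Re (q (x (n + N))) \<le> A * (1 - (cmod (x (n + N)))\<^sup>2)"
      using A[of "n + N"] p[OF x] by (simp add: R pos_divide_le_eq)
    moreover have "1/4 * Re (q (x (n + N))) \<le> (cmod (x (n + N)))\<^sup>2 * Re (q (x (n + N)))"
      using N[of "n + N"] q_re[OF x] by (intro mult_right_mono) auto
    ultimately show ?thesis by linarith
  qed
  obtain \<beta> :: real where "\<forall>z\<in>ball 0 1.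
      (cmod (q z - \<i> * \<beta>))\<^sup>2 * (1 - (cmod z)\<^sup>2) \<le> 4 * (4 * A) * Re (q z) * (cmod (\<sigma> - z))\<^sup>2"
    using julia_halfplane[OF q_hol q_re x LIMSEQ_ignore_initial_segment[OF lim] \<sigma> Aq] by blast
  then obtain \<delta> where \<delta>0: "\<delta> \<ge> 0"
    and J: "\<And>z. z \<in> ball 0 1 \<Longrightarrow> (cmod (q z - \<i> * \<beta>))\<^sup>2 * (1 - (cmod z)\<^sup>2) \<le> \<delta> * Re (q z) * (cmod (\<sigma> - z))\<^sup>2"
    and D: "has_angular_limit (\<lambda>z. (q z - \<i> * \<beta>) / (z - \<sigma>)) \<sigma> (- of_real \<delta> * cnj \<sigma> / 2)"
    using julia_caratheodory_halfplane[OF q_hol q_re \<sigma>] by blast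
  \<comment> \<open>Since \<open>Re q <= |q - \<i> * \<beta>|\<close>, one factor
    \<open>|q - \<i> * \<beta>|\<close> cancels from \<open>J\<close>, leaving a growth bound that
    is linear in \<open>q\<close>.\<close>
  have J1: "cmod (q z - \<i> * \<beta>) * (1 - (cmod z)\<^sup>2) \<le> \<delta> * (cmod (\<sigma> - z))\<^sup>2" if z: "z \<in> ball 0 1" for z
  proof (cases "q z = \<i> * \<beta>")
    case False
    have "Re (q z) \<le> cmod (q z - \<i> * \<beta>)" using complex_Re_le_cmod[of "q z - \<i> * \<beta>"] by simp
    then have "\<delta> * (cmod (\<sigma> - z))\<^sup>2 * Re (q z) \<le> \<delta> * (cmod (\<sigma> - z))\<^sup>2 * cmod (q z - \<i> * \<beta>)"
      using \<delta>0 by (intro mult_left_mono) auto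
    with J[OF z] have "cmod (q z - \<i> * \<beta>) * (cmod (q z - \<i> * \<beta>) * (1 - (cmod z)\<^sup>2))
       \<le> cmod (q z - \<i> * \<beta>) * (\<delta> * (cmod (\<sigma> - z))\<^sup>2)"
      by (simp add: power2_eq_square mult_ac)
    then show ?thesis by (rule mult_left_le_imp_le) (use False in simp)
  qed (use \<delta>0 in auto)
  define Q where "Q = (\<lambda>z. (q z - \<i> * \<beta>) / (z - \<sigma>))"
  have Qeq: "q z = \<i> * \<beta> + Q z * (z - \<sigma>)" if "z \<in> ball 0 1" for z
    using that ps by (auto simp: Q_def)
  have Qlim: "(Q \<longlongrightarrow> - of_real \<delta> * cnj \<sigma> / 2) (at \<sigma> within stolz_region \<sigma> M)" if "M > 1" for M
    using D that by (simp add: has_angular_limit_def Q_def)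
  have idlim: "((\<lambda>z. z) \<longlongrightarrow> \<sigma>) (at \<sigma> within S)" for S by (rule tendsto_ident_at)
  have qlim: "(q \<longlongrightarrow> \<i> * \<beta>) (at \<sigma> within stolz_region \<sigma> M)" if M: "M > 1" for M
  proof -
    have "((\<lambda>z. \<i> * \<beta> + Q z * (z - \<sigma>)) \<longlongrightarrow> \<i> * \<beta> + (- of_real \<delta> * cnj \<sigma> / 2) * (\<sigma> - \<sigma>)) (at \<sigma> within stolz_region \<sigma> M)"
      by (intro tendsto_intros Qlim[OF M])
    then show ?thesis using at_within_stolz_cong[of q "\<lambda>z. \<i> * \<beta> + Q z * (z - \<sigma>)"] Qeq by simp
  qed
  have Hlim: "has_angular_limit H \<sigma> (a - cnj a * \<sigma>\<^sup>2 - \<sigma> * (\<i> * \<beta>))"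
    unfolding has_angular_limit_def by (intro allI impI, unfold Hq) (intro tendsto_intros qlim)
  have "((\<lambda>z. (H z - angular_lim H \<sigma>) / (z - \<sigma>)) \<longlongrightarrow> - 2 * cnj a * \<sigma> - \<i> * \<beta> + \<delta> / 2) (at \<sigma> within stolz_region \<sigma> M)"
    if M: "M > 1" for M
  proof -
    have c1: "(H z - angular_lim H \<sigma>) / (z - \<sigma>) = - cnj a * (z + \<sigma>) - \<i> * \<beta> - z * Q z" if z: "z \<in> ball 0 1" for z
    proof -
      have nz: "z - \<sigma> \<noteq> 0" using z ps by auto
      have "H z - angular_lim H \<sigma> = (- cnj a * (z + \<sigma>) - \<i> * \<beta> - z * Q z) * (z - \<sigma>)"
        unfolding angular_lim_eq[OF \<sigma> Hlim] Hq Qeq[OF z] by (simp add: algebra_simps power2_eq_square)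
      then show ?thesis using nz by simp
    qed
    have c2: "((\<lambda>z. - cnj a * (z + \<sigma>) - \<i> * \<beta> - z * Q z) \<longlongrightarrow> - cnj a * (\<sigma> + \<sigma>) - \<i> * \<beta> - \<sigma> * (- of_real \<delta> * cnj \<sigma> / 2))
       (at \<sigma> within stolz_region \<sigma> M)" by (intro tendsto_intros Qlim[OF M])
    have c3: "- cnj a * (\<sigma> + \<sigma>) - \<i> * \<beta> - \<sigma> * (- of_real \<delta> * cnj \<sigma> / 2) = - 2 * cnj a * \<sigma> - \<i> * \<beta> + \<delta> / 2"
    proof -
      have "\<sigma> * cnj \<sigma> = 1" using ps by (simp add: complex_norm_square[symmetric])
      then have "\<sigma> * (- of_real \<delta> * cnj \<sigma> / 2) = - \<delta> / 2" by (simp add: mult.left_commute)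
      then show ?thesis by (simp add: algebra_simps)
    qed
    show ?thesis using c2 unfolding c3 by (subst at_within_stolz_cong[OF c1])
  qed
  then have Hder: "has_angular_derivative H \<sigma> (- 2 * cnj a * \<sigma> - \<i> * \<beta> + \<delta> / 2)"
    by (simp add: has_angular_derivative_def has_angular_limit_def)
  have Rlim: "(R \<longlongrightarrow> \<delta> / 4) (at \<sigma> within stolz_region \<sigma> M)" if M: "M > 1" for M
  proof -
    define E where "E = (\<lambda>z. cmod (Q z + of_real \<delta> * cnj \<sigma> / 2) * M + \<delta> / 4 * M * cmod (\<sigma> - z))"
    have "(E \<longlongrightarrow> cmod (- of_real \<delta> * cnj \<sigma> / 2 + of_real \<delta> * cnj \<sigma> / 2) * M + \<delta> / 4 * M * cmod (\<sigma> - \<sigma>))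
       (at \<sigma> within stolz_region \<sigma> M)" unfolding E_def by (intro tendsto_intros Qlim[OF M])
    then have E: "(E \<longlongrightarrow> 0) (at \<sigma> within stolz_region \<sigma> M)" by simp
    have "norm (Re (q z) / (1 - (cmod z)\<^sup>2) - \<delta> / 4) \<le> E z" if zs: "z \<in> stolz_region \<sigma> M" for z
    proof -
      note z = stolz_regionD[OF zs M]
      define y where "y = 1 - (cmod z)\<^sup>2"
      have y: "y > 0" using p[OF z(1)] by (simp add: y_def)
      have t: "cmod (\<sigma> - z) / y \<le> M" using z(3) y by (simp add: y_def pos_divide_le_eq)
      have s: "(Re \<sigma>)\<^sup>2 + (Im \<sigma>)\<^sup>2 = 1" using ps cmod_power2[of \<sigma>] by simp
      \<comment> \<open>The linear part \<open>\<delta> / 2 * cnj \<sigma> * (\<sigma> - z)\<close>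
        of \<open>q\<close> thus has real part \<open>\<delta> / 4 * (y + |\<sigma> - z|^2)\<close>.
        Divided by \<open>y\<close> it gives the constant \<open>\<delta> / 4\<close> whatever the
        direction of approach, with an error of at most
        \<open>\<delta> / 4 * M * |\<sigma> - z|\<close>.\<close>
      have rs: "Re (cnj \<sigma> * (\<sigma> - z)) = (y + (cmod (\<sigma> - z))\<^sup>2) / 2"
        using s unfolding y_def cmod_power2 by (simp add: power2_eq_square algebra_simps)
      have "q z = \<i> * \<beta> + (Q z + of_real \<delta> * cnj \<sigma> / 2) * (z - \<sigma>) + of_real (\<delta> / 2) * (cnj \<sigma> * (\<sigma> - z))"
        unfolding Qeq[OF z(1)] by (simp add: field_simps)
      then have "Re (q z) = Re ((Q z + of_real \<delta> * cnj \<sigma> / 2) * (z - \<sigma>)) + Re (of_real (\<delta> / 2) * (cnj \<sigma> * (\<sigma> - z)))"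
        by (simp only: plus_complex.simps) simp
      also have "Re (of_real (\<delta> / 2) * (cnj \<sigma> * (\<sigma> - z))) = \<delta> / 2 * Re (cnj \<sigma> * (\<sigma> - z))"
        by (metis Re_complex_of_real Im_complex_of_real times_complex.simps(1) mult_zero_left diff_zero)
      finally have "Re (q z) / y - \<delta> / 4 = Re ((Q z + of_real \<delta> * cnj \<sigma> / 2) * (z - \<sigma>)) / y
          + \<delta> / 4 * (cmod (\<sigma> - z))\<^sup>2 / y"
        unfolding rs using y by (simp add: field_simps)
      also have "norm \<dots> \<le> cmod ((Q z + of_real \<delta> * cnj \<sigma> / 2) * (z - \<sigma>)) / y + \<delta> / 4 * (cmod (\<sigma> - z))\<^sup>2 / y"
        using abs_Re_le_cmod[of "(Q z + of_real \<delta> * cnj \<sigma> / 2) * (z - \<sigma>)"] y \<delta>0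
        by (intro order_trans[OF norm_triangle_ineq] add_mono) (auto simp: divide_right_mono)
      also have "\<dots> = cmod (Q z + of_real \<delta> * cnj \<sigma> / 2) * (cmod (\<sigma> - z) / y) + \<delta> / 4 * (cmod (\<sigma> - z) / y) * cmod (\<sigma> - z)"
        by (simp add: norm_mult norm_minus_commute power2_eq_square)
      also have "\<dots> \<le> E z" unfolding E_def
        using \<delta>0 by (intro add_mono mult_mono t mult_left_mono mult_right_mono) (use M y in auto)
      finally show ?thesis by (simp add: y_def)
    qed
    then have "\<forall>\<^sub>F z in at \<sigma> within stolz_region \<sigma> M. norm (Re (q z) / (1 - (cmod z)\<^sup>2) - \<delta> / 4) \<le> E z"
      by (simp add: eventually_at_filter)
    then have "((\<lambda>z. Re (q z) / (1 - (cmod z)\<^sup>2) - \<delta> / 4) \<longlongrightarrow> 0) (at \<sigma> within stolz_region \<sigma> M)"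
      using E by (rule Lim_null_comparison)
    then have "((\<lambda>z. Re (q z) / (1 - (cmod z)\<^sup>2)) \<longlongrightarrow> \<delta> / 4) (at \<sigma> within stolz_region \<sigma> M)"
      by (simp add: LIM_zero_iff)
    then have "((\<lambda>z. (cmod z)\<^sup>2 * (Re (q z) / (1 - (cmod z)\<^sup>2))) \<longlongrightarrow> (cmod \<sigma>)\<^sup>2 * (\<delta> / 4)) (at \<sigma> within stolz_region \<sigma> M)"
      by (intro tendsto_mult tendsto_power tendsto_norm idlim)
    then show ?thesis using ps by (simp add: R[abs_def])
  qed
  have "R z * (1 - (cmod z)\<^sup>2)\<^sup>2 \<le> \<delta> * (cmod (\<sigma> - z))\<^sup>2" if z: "z \<in> ball 0 1" for z
  proof -
    have "R z * (1 - (cmod z)\<^sup>2)\<^sup>2 = (cmod z)\<^sup>2 * (Re (q z) * (1 - (cmod z)\<^sup>2))"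
      using p[OF z] by (simp add: R power2_eq_square)
    also have "\<dots> \<le> 1 * (Re (q z) * (1 - (cmod z)\<^sup>2))"
      using p[OF z] q_re[OF z] by (intro mult_right_mono) auto
    also have "\<dots> \<le> cmod (q z - \<i> * \<beta>) * (1 - (cmod z)\<^sup>2)"
      using complex_Re_le_cmod[of "q z - \<i> * \<beta>"] p[OF z] by (simp add: mult_right_mono)
    also have "\<dots> \<le> \<delta> * (cmod (\<sigma> - z))\<^sup>2" by (rule J1[OF z])
    finally show ?thesis .
  qed
  moreover have "cmod (H z) * (1 - (cmod z)\<^sup>2) \<le> (2 * cmod a + \<bar>\<beta>\<bar>) * (1 - (cmod z)\<^sup>2) + \<delta> * (cmod (\<sigma> - z))\<^sup>2"
    if z: "z \<in> ball 0 1" for z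
  proof -
    have z1: "cmod z \<le> 1" "(cmod z)\<^sup>2 \<le> 1" using z p[OF z] by auto
    have "H z = a - cnj a * z\<^sup>2 - z * (\<i> * \<beta>) - z * (q z - \<i> * \<beta>)" unfolding Hq by (simp add: algebra_simps)
    also have "cmod \<dots> \<le> cmod a + cmod (cnj a * z\<^sup>2) + cmod (z * (\<i> * \<beta>)) + cmod (z * (q z - \<i> * \<beta>))"
      by (intro order_trans[OF norm_triangle_ineq4] add_mono order_refl)
    also have "\<dots> \<le> cmod a + cmod a + \<bar>\<beta>\<bar> + cmod (q z - \<i> * \<beta>)"
      using z1 by (intro add_mono order_refl) (auto simp: norm_mult norm_power mult_left_le mult_left_le_one_le)
    finally have "cmod (H z) * (1 - (cmod z)\<^sup>2) \<le> (2 * cmod a + \<bar>\<beta>\<bar> + cmod (q z - \<i> * \<beta>)) * (1 - (cmod z)\<^sup>2)"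
      using p[OF z] by (intro mult_right_mono) auto
    then show ?thesis using J1[OF z] by (simp add: distrib_right)
  qed
  \<comment> \<open>\<beta> is a boundary value without an a priori size. Comparison with
    \<open>q (1/2)\<close> bounds it by values of \<open>H\<close> at interior points, which will be
    integrable in time; the 3 is \<open>(3/2)^2\<close> divided by
    \<open>1 - (1/2)^2\<close>.\<close>
  moreover have "\<bar>\<beta>\<bar> \<le> 4 * cmod a + 2 * cmod (H (1/2)) + 3 * \<delta>"
  proof -
    have h: "(1/2 :: complex) \<in> ball 0 1" by simp
    have "cmod (\<sigma> - 1/2) \<le> 3/2" using norm_triangle_ineq4[of \<sigma> "1/2"] ps by simp
    then have "(cmod (\<sigma> - 1/2))\<^sup>2 \<le> (3/2)\<^sup>2" by (intro power_mono) auto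
    then have "\<delta> * (cmod (\<sigma> - 1/2))\<^sup>2 \<le> \<delta> * (3/2)\<^sup>2" using \<delta>0 by (intro mult_left_mono) auto
    moreover have "(1 - (cmod (1/2))\<^sup>2) = 3/4" by (simp add: power2_eq_square)
    ultimately have "cmod (q (1/2) - \<i> * \<beta>) * (3/4) \<le> \<delta> * (9/4)" using J1[OF h] by (simp add: power2_eq_square)
    then have c1: "cmod (q (1/2) - \<i> * \<beta>) \<le> 3 * \<delta>" by simp
    have "q (1/2) = 2 * a - 2 * H (1/2) - cnj a / 2" by (simp add: q_def power2_eq_square)
    also have "cmod \<dots> \<le> cmod (2 * a) + cmod (2 * H (1/2)) + cmod (cnj a / 2)"
      by (intro order_trans[OF norm_triangle_ineq4] add_mono order_refl)
    also have "\<dots> \<le> 4 * cmod a + 2 * cmod (H (1/2))" by (simp add: norm_mult norm_divide)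
    finally have c2: "cmod (q (1/2)) \<le> 4 * cmod a + 2 * cmod (H (1/2))" .
    have "\<bar>\<beta>\<bar> = cmod (\<i> * \<beta>)" by (simp add: norm_mult)
    also have "\<dots> \<le> cmod (q (1/2)) + cmod (q (1/2) - \<i> * \<beta>)" 
      by (metis add.commute norm_minus_commute norm_triangle_sub)
    finally show ?thesis using c1 c2 by linarith
  qed
  ultimately show ?thesis using \<delta>0 Hlim Hder Rlim unfolding a_def
    by (intro exI[of _ \<beta>] exI[of _ \<delta>]) blast
qed

section \<open>Regular contact points of self-maps of the disc\<close>

text \<open>A sequence of radii, because Fatou's lemma and dominated convergence are applied along
  it. The shift by 2 keeps the step in \<open>(0, 1/2]\<close>, hence the points in the disc and
  away from its centre.\<close>

definition radial_points :: "complex \<Rightarrow> nat \<Rightarrow> complex" where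
  "radial_points \<sigma> n = \<sigma> * (1 - of_real (1 / (real n + 2)))"

lemma radial_points_in_disc: "\<sigma> \<in> sphere 0 1 \<Longrightarrow> radial_points \<sigma> n \<in> ball 0 1"
proof -
  assume "\<sigma> \<in> sphere 0 1"
  then have "cmod (radial_points \<sigma> n) = cmod (of_real (1 - 1 / (real n + 2)))"
    by (simp add: radial_points_def norm_mult)
  also have "\<dots> = 1 - 1 / (real n + 2)" unfolding norm_of_real by simp
  finally show ?thesis by simp
qed

text \<open>Approach to \<sigma> in the direction \<open>u\<close>, not only radially. The step
  \<open>t\<close> is scaled so that \<open>|u|^2 * t <= Re u / 2\<close> already at
  \<open>n = 0\<close>; the quadratic term of \<open>1 - |z|^2\<close> then never spoils the linear
  one, and all points lie in a Stolz region of explicit aperture.\<close>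

lemma filterlim_stolz_sequence:
  fixes u :: complex
  assumes \<sigma>: "\<sigma> \<in> sphere 0 1" and u: "Re u > 0"
  defines "t \<equiv> \<lambda>n. Re u / ((cmod u)\<^sup>2 * (real n + 2))"
  shows "filterlim (\<lambda>n. \<sigma> * (1 - u * of_real (t n))) (at \<sigma> within stolz_region \<sigma> (4 * cmod u / Re u)) sequentially"
proof -
  have u0: "cmod u > 0" using u by auto
  have s: "cmod \<sigma> = 1" using \<sigma> by simp
  have t: "t n > 0" for n using u u0 by (simp add: t_def)
  have t0: "t \<longlonglongrightarrow> 0"
  proof -
    have "(\<lambda>n. Re u / (cmod u)\<^sup>2 * (1 / (real n + 2))) \<longlonglongrightarrow> Re u / (cmod u)\<^sup>2 * 0"
      by (intro tendsto_intros) real_asymp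
    then show ?thesis by (simp add: t_def[abs_def])
  qed
  have in_stolz: "\<sigma> * (1 - u * of_real (t n)) \<in> stolz_region \<sigma> (4 * cmod u / Re u)" (is "?z \<in> _") for n
  proof -
    have d: "cmod (\<sigma> - ?z) = cmod u * t n"
    proof -
      have "\<sigma> - ?z = \<sigma> * (u * of_real (t n))" by (simp add: algebra_simps)
      then show ?thesis using t[of n] s by (simp add: norm_mult)
    qed
    have "(cmod ?z)\<^sup>2 = (cmod (1 - u * of_real (t n)))\<^sup>2" using s by (simp add: norm_mult)
    also have "\<dots> = 1 - 2 * t n * Re u + (cmod u)\<^sup>2 * (t n)\<^sup>2"
      unfolding cmod_power2 by (simp add: power2_eq_square algebra_simps)
    finally have z2: "1 - (cmod ?z)\<^sup>2 = t n * (2 * Re u - (cmod u)\<^sup>2 * t n)"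
      by (simp add: power2_eq_square algebra_simps)
    have "(cmod u)\<^sup>2 * t n = Re u / (real n + 2)" using u0 by (simp add: t_def)
    also have "\<dots> \<le> Re u / 2" using u by (intro divide_left_mono) auto
    finally have "2 * Re u - (cmod u)\<^sup>2 * t n \<ge> 3/2 * Re u" by simp
    then have ge: "1 - (cmod ?z)\<^sup>2 \<ge> t n * (3/2 * Re u)" unfolding z2 using t[of n] by (intro mult_left_mono) auto
    moreover have "t n * (3/2 * Re u) > 0" using t[of n] u by simp
    ultimately have "(cmod ?z)\<^sup>2 < 1" by linarith
    then have z1: "cmod ?z < 1" by (simp add: power_less_one_iff abs_square_less_1)
    have "1 - (cmod ?z)\<^sup>2 = (1 + cmod ?z) * (1 - cmod ?z)" by (simp add: power2_eq_square algebra_simps)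
    also have "\<dots> \<le> 2 * (1 - cmod ?z)" using z1 by (intro mult_right_mono) auto
    finally have "1 - cmod ?z \<ge> t n * (3/4 * Re u)" using ge by simp
    then have "(4 * cmod u / Re u) * (1 - cmod ?z) \<ge> (4 * cmod u / Re u) * (t n * (3/4 * Re u))"
      using u by (intro mult_left_mono) auto
    also have "(4 * cmod u / Re u) * (t n * (3/4 * Re u)) = 3 * (cmod u * t n)" using u by simp
    finally have "cmod (\<sigma> - ?z) < (4 * cmod u / Re u) * (1 - cmod ?z)"
      unfolding d using mult_pos_pos[OF u0 t[of n]] by linarith
    then show ?thesis using z1 by (simp add: stolz_region_def)
  qed
  have "(\<lambda>n. \<sigma> * (1 - u * of_real (t n))) \<longlonglongrightarrow> \<sigma> * (1 - u * of_real 0)" by (intro tendsto_intros t0)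
  moreover have "\<sigma> * (1 - u * of_real (t n)) \<noteq> \<sigma>" for n
    using s t[of n] u by auto
  ultimately show ?thesis unfolding filterlim_at using in_stolz by simp
qed

lemma filterlim_radial_points:
  assumes "\<sigma> \<in> sphere 0 1"
  shows "filterlim (radial_points \<sigma>) (at \<sigma> within stolz_region \<sigma> 4) sequentially"
  using filterlim_stolz_sequence[OF assms, of 1] by (simp add: radial_points_def[abs_def])

text \<open>A regular contact point comes with a complex derivative, whereas Julia's inequality
  needs the limit of \<open>(1 - |f|^2) / (1 - |z|^2)\<close> along the radius. A priori that limit
  is only the real part of the normalised derivative \<kappa>. As the disc is mapped into itself,
  multiplication by \<kappa> sends the right half-plane of inward directions into its closure; hence
  \<kappa> is real and non-negative, so it equals \<alpha>.\<close>

lemma julia_at_regular_contact_point: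
  assumes hol: "f holomorphic_on ball 0 1" and im: "f ` ball 0 1 \<subseteq> ball 0 1"
    and reg: "regular_contact_point f \<sigma>"
  defines "\<tau> \<equiv> angular_lim f \<sigma>" and "\<alpha> \<equiv> cmod (angular_deriv f \<sigma>)"
  shows "\<tau> \<in> sphere 0 1"
    and "(\<lambda>n. f (radial_points \<sigma> n)) \<longlonglongrightarrow> \<tau>"
    and "(\<lambda>n. (1 - (cmod (f (radial_points \<sigma> n)))\<^sup>2) / (1 - (cmod (radial_points \<sigma> n))\<^sup>2)) \<longlonglongrightarrow> \<alpha>"
    and "\<And>z. z \<in> ball 0 1 \<Longrightarrow>
      (cmod (\<tau> - f z))\<^sup>2 * (1 - (cmod z)\<^sup>2) \<le> \<alpha> * (cmod (\<sigma> - z))\<^sup>2 * (1 - (cmod (f z))\<^sup>2)"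
proof -
  have \<sigma>: "\<sigma> \<in> sphere 0 1" and s: "cmod \<sigma> = 1" using reg by (auto simp: regular_contact_point_def)
  obtain l where l: "l \<in> sphere 0 1" "has_angular_limit f \<sigma> l" using reg by (auto simp: regular_contact_point_def)
  then have \<tau>l: "\<tau> = l" using angular_lim_eq[OF \<sigma>] by (simp add: \<tau>_def)
  show \<tau>: "\<tau> \<in> sphere 0 1" using l \<tau>l by simp
  then have s\<tau>: "cmod \<tau> = 1" by simp
  obtain d where d: "has_angular_derivative f \<sigma> d" using reg by (auto simp: regular_contact_point_def)
  then have \<alpha>d: "\<alpha> = cmod d" using angular_deriv_eq[OF \<sigma>] by (simp add: \<alpha>_def)
  have lim: "(f \<longlongrightarrow> \<tau>) (at \<sigma> within stolz_region \<sigma> M)"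
       "((\<lambda>z. (f z - \<tau>) / (z - \<sigma>)) \<longlongrightarrow> d) (at \<sigma> within stolz_region \<sigma> M)" if "M > 1" for M
    using l d that unfolding \<tau>l[symmetric] has_angular_derivative_def has_angular_limit_def \<tau>_def by auto
  note rad = filterlim_radial_points[OF \<sigma>]
  show f_rad: "(\<lambda>n. f (radial_points \<sigma> n)) \<longlonglongrightarrow> \<tau>"
    by (rule filterlim_compose[OF lim(1) rad]) simp
  have f1: "cmod (f z) < 1" if "z \<in> ball 0 1" for z using im that by force
  have inv: "cnj \<sigma> * \<sigma> = 1" "cnj \<tau> * \<tau> = 1"
    using s s\<tau> by (simp_all add: mult.commute[of "cnj _"] complex_norm_square[symmetric])
  \<comment> \<open>The derivative after rotating both \<sigma> and \<tau> to 1.\<close>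
  define \<kappa> where "\<kappa> = cnj \<tau> * \<sigma> * d"
  have \<kappa>\<alpha>: "cmod \<kappa> = \<alpha>" using s s\<tau> by (simp add: \<kappa>_def norm_mult \<alpha>d)
  define T where "T = (\<lambda>u n. Re u / ((cmod u)\<^sup>2 * (real n + 2)))"
  define Z where "Z = (\<lambda>u n. \<sigma> * (1 - u * complex_of_real (T u n)))"
  have T: "T u n > 0" if "Re u > 0" for u n
    using that by (auto simp: T_def intro!: divide_pos_pos mult_pos_pos)
  have directional: "(\<lambda>n. (1 - cnj \<tau> * f (Z u n)) / of_real (T u n)) \<longlonglongrightarrow> \<kappa> * u" if u: "Re u > 0" for u
  proof -
    have M: "4 * cmod u / Re u > 1" using complex_Re_le_cmod[of u] u by (simp add: less_divide_eq)
    have "filterlim (Z u) (at \<sigma> within stolz_region \<sigma> (4 * cmod u / Re u)) sequentially"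
      using filterlim_stolz_sequence[OF \<sigma> u] by (simp add: Z_def[abs_def] T_def[abs_def])
    then have "(\<lambda>n. (f (Z u n) - \<tau>) / (Z u n - \<sigma>)) \<longlonglongrightarrow> d"
      using filterlim_compose[OF lim(2)[OF M]] by blast
    then have "(\<lambda>n. cnj \<tau> * \<sigma> * ((f (Z u n) - \<tau>) / (Z u n - \<sigma>)) * u) \<longlonglongrightarrow> cnj \<tau> * \<sigma> * d * u"
      by (intro tendsto_intros)
    moreover have "cnj \<tau> * \<sigma> * ((f (Z u n) - \<tau>) / (Z u n - \<sigma>)) * u = (1 - cnj \<tau> * f (Z u n)) / of_real (T u n)" for n
    proof -
      have n0: "\<sigma> \<noteq> 0" "u \<noteq> 0" "complex_of_real (T u n) \<noteq> 0" using s u T[OF u, of n] by auto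
      have "Z u n - \<sigma> = - \<sigma> * u * of_real (T u n)" by (simp add: Z_def algebra_simps)
      moreover have "1 - cnj \<tau> * f (Z u n) = - (cnj \<tau> * (f (Z u n) - \<tau>))" using inv by (simp add: algebra_simps)
      moreover have "cnj \<tau> * \<sigma> * (y / (- \<sigma> * u * c)) * u = - (cnj \<tau> * y) / c" if "c \<noteq> 0" for y c
        using n0 that by (simp add: field_simps)
      ultimately show ?thesis using n0 by simp
    qed
    ultimately show ?thesis by (simp add: \<kappa>_def)
  qed
  have Z_in: "Z u n \<in> ball 0 1" if u: "Re u > 0" for u n
  proof -
    have u0: "cmod u > 0" using u by auto
    have "(cmod (Z u n))\<^sup>2 = (cmod (1 - u * of_real (T u n)))\<^sup>2" using s by (simp add: norm_mult Z_def)
    also have "\<dots> = 1 - T u n * (2 * Re u - (cmod u)\<^sup>2 * T u n)"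
      unfolding cmod_power2 by (simp add: power2_eq_square algebra_simps)
    also have "(cmod u)\<^sup>2 * T u n = Re u / (real n + 2)" using u0 by (simp add: T_def)
    finally have "(cmod (Z u n))\<^sup>2 = 1 - T u n * (2 * Re u - Re u / (real n + 2))" .
    moreover have "Re u / (real n + 2) < 2 * Re u" using u by (simp add: divide_less_eq)
    ultimately have "(cmod (Z u n))\<^sup>2 < 1" using T[OF u, of n] by simp
    then show ?thesis by (simp add: power_less_one_iff abs_square_less_1)
  qed
  \<comment> \<open>Approaching \<open>\<sigma>\<close> in every direction \<open>u\<close> of the right half-plane shows that \<open>\<kappa>\<close> is real.\<close>
  have cone: "Re (\<kappa> * u) \<ge> 0" if u: "Re u > 0" for u
  proof (rule LIMSEQ_le_const)
    show "(\<lambda>n. Re ((1 - cnj \<tau> * f (Z u n)) / of_real (T u n))) \<longlonglongrightarrow> Re (\<kappa> * u)"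
      by (intro tendsto_intros directional[OF u])
    have "0 \<le> Re ((1 - cnj \<tau> * f (Z u n)) / of_real (T u n))" for n
    proof -
      have "cmod (cnj \<tau> * f (Z u n)) \<le> 1" using f1[OF Z_in[OF u]] s\<tau> by (simp add: norm_mult less_imp_le)
      then have "Re (cnj \<tau> * f (Z u n)) \<le> 1" using complex_Re_le_cmod order_trans by blast
      then show ?thesis using T[OF u, of n] by (simp add: Re_divide_of_real)
    qed
    then show "\<exists>N. \<forall>n\<ge>N. 0 \<le> Re ((1 - cnj \<tau> * f (Z u n)) / of_real (T u n))" by blast
  qed
  have Re\<kappa>: "Re \<kappa> \<ge> 0" using cone[of 1] by simp
  have Im\<kappa>: "Im \<kappa> = 0"
  proof (rule ccontr)
    assume "Im \<kappa> \<noteq> 0"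
    \<comment> \<open>The direction \<open>Complex e (sgn (Im \<kappa>))\<close> turns
      \<open>Re (\<kappa> * u)\<close> into \<open>e * Re \<kappa> - |Im \<kappa>|\<close>, negative
      for this \<open>e\<close>. The \<open>+ 1\<close> covers the case
      \<open>Re \<kappa> = 0\<close>.\<close>
    define e where "e = \<bar>Im \<kappa>\<bar> / (2 * (Re \<kappa> + 1))"
    have e: "e > 0" using \<open>Im \<kappa> \<noteq> 0\<close> Re\<kappa> by (simp add: e_def)
    have "e * Re \<kappa> < \<bar>Im \<kappa>\<bar>"
    proof -
      have "e * Re \<kappa> \<le> e * (Re \<kappa> + 1)" using e by (intro mult_left_mono) auto
      also have "\<dots> = \<bar>Im \<kappa>\<bar> / 2"
      proof -
        have "x / (2 * b) * b = x / 2" if "b \<noteq> 0" for x b :: real using that by simp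
        moreover have "Re \<kappa> + 1 \<noteq> 0" using Re\<kappa> by linarith
        ultimately show ?thesis unfolding e_def by blast
      qed
      finally show ?thesis using \<open>Im \<kappa> \<noteq> 0\<close> by linarith
    qed
    moreover have "Re (\<kappa> * Complex e (sgn (Im \<kappa>))) \<ge> 0"
      using cone[of "Complex e (sgn (Im \<kappa>))"] e by simp
    moreover have "Re (\<kappa> * Complex e (sgn (Im \<kappa>))) = e * Re \<kappa> - \<bar>Im \<kappa>\<bar>"
      by (simp add: abs_sgn mult.commute)
    ultimately show False by linarith
  qed
  have \<kappa>: "\<kappa> = of_real \<alpha>" using Re\<kappa> Im\<kappa> \<kappa>\<alpha> by (simp add: complex_eq_iff cmod_def)
  define r where "r = (\<lambda>n. radial_points \<sigma> n)"
  have r_in: "r n \<in> ball 0 1" for n using radial_points_in_disc[OF \<sigma>] by (simp add: r_def)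
  define h where "h = (\<lambda>n. 1 / (real n + 2))"
  have h: "h n > 0" "h n < 1" for n by (simp_all add: h_def)
  have h0: "h \<longlonglongrightarrow> 0" unfolding h_def by real_asymp
  define k where "k = (\<lambda>n. (1 - cnj \<tau> * f (r n)) / of_real (h n))"
  have k: "k \<longlonglongrightarrow> of_real \<alpha>"
    using directional[of 1] unfolding \<kappa> k_def r_def h_def Z_def T_def radial_points_def by simp
  have ratio: "(1 - (cmod (f (r n)))\<^sup>2) / (1 - (cmod (r n))\<^sup>2) = (2 * Re (k n) - h n * (cmod (k n))\<^sup>2) / (2 - h n)" for n
  proof -
    define y where "y = cnj \<tau> * f (r n)"
    have "cmod (r n) = cmod (of_real (1 - h n))" using s by (simp add: r_def radial_points_def h_def norm_mult)
    then have r1: "cmod (r n) = 1 - h n" using h[of n] unfolding norm_of_real by simp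
    have e1: "1 - (cmod (r n))\<^sup>2 = h n * (2 - h n)" unfolding r1 by (simp add: power2_eq_square algebra_simps)
    have "cmod (f (r n)) = cmod y" using s\<tau> by (simp add: y_def norm_mult)
    then have e2: "1 - (cmod (f (r n)))\<^sup>2 = 2 * Re (1 - y) - (cmod (1 - y))\<^sup>2"
      unfolding cmod_power2[of "1 - y"] by (simp add: cmod_power2[of y]) (simp add: power2_eq_square algebra_simps)
    have ky: "1 - y = k n * of_real (h n)" using h[of n] by (simp add: k_def y_def)
    have "1 - (cmod (f (r n)))\<^sup>2 = h n * (2 * Re (k n) - h n * (cmod (k n))\<^sup>2)"
      unfolding e2 ky using h[of n] by (simp add: norm_mult power2_eq_square algebra_simps)
    then show ?thesis unfolding e1 using h[of n] by simp
  qed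
  have "(\<lambda>n. (2 * Re (k n) - h n * (cmod (k n))\<^sup>2) / (2 - h n)) \<longlonglongrightarrow> (2 * Re (of_real \<alpha>) - 0 * (cmod (of_real \<alpha>))\<^sup>2) / (2 - 0)"
    by (intro tendsto_intros k h0) simp
  then have ratio_lim: "(\<lambda>n. (1 - (cmod (f (r n)))\<^sup>2) / (1 - (cmod (r n))\<^sup>2)) \<longlonglongrightarrow> \<alpha>"
    unfolding ratio by simp
  then show "(\<lambda>n. (1 - (cmod (f (radial_points \<sigma> n)))\<^sup>2) / (1 - (cmod (radial_points \<sigma> n))\<^sup>2)) \<longlonglongrightarrow> \<alpha>"
    by (simp add: r_def)
  fix z :: complex assume z: "z \<in> ball 0 1"
  have r_lim: "r \<longlonglongrightarrow> \<sigma>" using rad unfolding r_def filterlim_at by simp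
  have "(\<lambda>n. (cmod (f (r n) - f z))\<^sup>2 * (1 - (cmod z)\<^sup>2)) \<longlonglongrightarrow> (cmod (\<tau> - f z))\<^sup>2 * (1 - (cmod z)\<^sup>2)"
    using f_rad unfolding r_def by (intro tendsto_intros)
  moreover have "(\<lambda>n. (1 - (cmod (f (r n)))\<^sup>2) / (1 - (cmod (r n))\<^sup>2) * (cmod (r n - z))\<^sup>2 * (1 - (cmod (f z))\<^sup>2))
      \<longlonglongrightarrow> \<alpha> * (cmod (\<sigma> - z))\<^sup>2 * (1 - (cmod (f z))\<^sup>2)"
    by (intro tendsto_intros ratio_lim r_lim)
  \<comment> \<open>Schwarz--Pick between \<open>r n\<close> and \<open>z\<close>, divided by
    \<open>1 - |r n|^2\<close>: in this form every term that depends on \<open>n\<close>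
    converges.\<close>
  moreover have "(cmod (f (r n) - f z))\<^sup>2 * (1 - (cmod z)\<^sup>2)
     \<le> (1 - (cmod (f (r n)))\<^sup>2) / (1 - (cmod (r n))\<^sup>2) * (cmod (r n - z))\<^sup>2 * (1 - (cmod (f z))\<^sup>2)" for n
    using schwarz_pick[OF hol im r_in z, of n] one_minus_norm_sq_pos[OF r_in, of n]
    by (simp add: field_simps)
  ultimately show "(cmod (\<tau> - f z))\<^sup>2 * (1 - (cmod z)\<^sup>2) \<le> \<alpha> * (cmod (\<sigma> - z))\<^sup>2 * (1 - (cmod (f z))\<^sup>2)"
    using LIMSEQ_le by blast
qed

section \<open>Absolutely continuous functions\<close>

lemma sum_integrals_disjoint_intervals_le:
  fixes h :: "real \<Rightarrow> real"
  assumes h: "h integrable_on {a..b}" and h0: "\<And>x. x \<in> {a..b} \<Longrightarrow> 0 \<le> h x"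
    and I: "finite I" and uv: "\<And>i. i \<in> I \<Longrightarrow> a \<le> u i \<and> u i \<le> v i \<and> v i \<le> b"
    and disj: "disjoint_family_on (\<lambda>i. {u i<..<v i}) I"
  shows "(\<Sum>i\<in>I. integral {u i..v i} h) \<le> integral {a..b} h"
proof -
  have "(h has_integral integral {u i..v i} h) {u i<..<v i}" if "i \<in> I" for i
  proof -
    have "h integrable_on {u i..v i}"
      using h uv[OF that] by (auto intro: integrable_on_subinterval)
    then show ?thesis by (simp flip: has_integral_Icc_iff_Ioo add: integrable_integral)
  qed
  then have *: "(h has_integral (\<Sum>i\<in>I. integral {u i..v i} h)) (\<Union>i\<in>I. {u i<..<v i})"
    using I disj by (intro has_integral_UN) (auto simp: pairwise_def disjoint_family_on_def)
  have "(\<Union>i\<in>I. {u i<..<v i}) \<subseteq> {a..b}" using uv by force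
  then show ?thesis
    using integral_subset_le[OF _ has_integral_integrable[OF *] h] h0 integral_unique[OF *] by simp
qed

text \<open>Truncation at height \<open>n\<close>: the excess over \<open>n\<close> has small
  integral by dominated convergence, and the truncated part contributes at most \<open>n\<close>
  times the total length. The free index type lets one statement serve tagged intervals, pairs of
  endpoints and a single interval.\<close>

lemma absolute_continuity_of_integral:
  fixes k :: "real \<Rightarrow> real"
  assumes k: "k integrable_on {a..b}" and k0: "\<forall>x\<in>{a..b}. 0 \<le> k x" and e: "e > 0"
  shows "\<exists>d>0. \<forall>(I :: 'i set) u v. finite I \<longrightarrow> (\<forall>i\<in>I. a \<le> u i \<and> u i \<le> v i \<and> v i \<le> b) \<longrightarrow>
    disjoint_family_on (\<lambda>i. {u i<..<v i}) I \<longrightarrow> (\<Sum>i\<in>I. v i - u i) < d \<longrightarrow>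
    (\<Sum>i\<in>I. integral {u i..v i} k) < e"
proof -
  let ?S = "{a..b}"
  define m where "m = (\<lambda>n x. min (k x) (real n))"
  have ka: "k absolutely_integrable_on ?S" using k k0 by (intro nonnegative_absolutely_integrable_1) auto
  have m_int: "m n integrable_on ?S" for n
  proof -
    have "(\<lambda>x. min (k x) (real n)) absolutely_integrable_on ?S"
      using ka by (intro absolutely_integrable_min_1) auto
    then show ?thesis unfolding m_def by (rule set_lebesgue_integral_eq_integral(1))
  qed
  have "(\<lambda>n. integral ?S (m n)) \<longlonglongrightarrow> integral ?S k"
  proof (rule dominated_convergence(2)[OF m_int k])
    show "norm (m n x) \<le> k x" if "x \<in> ?S" for n x using k0 that by (simp add: m_def)
    show "(\<lambda>n. m n x) \<longlonglongrightarrow> k x" if "x \<in> ?S" for x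
    proof (rule tendsto_eventually)
      obtain N where "k x \<le> real N" using real_arch_simple by blast
      then show "\<forall>\<^sub>F n in sequentially. m n x = k x"
        by (auto simp: eventually_sequentially m_def min_def intro!: exI[of _ N])
    qed
  qed
  then have "\<forall>\<^sub>F n in sequentially. integral ?S (m n) > integral ?S k - e/2"
    using e by (intro order_tendstoD(1)) auto
  then obtain n where n: "integral ?S (m n) > integral ?S k - e/2" by (auto simp: eventually_sequentially)
  define h where "h = (\<lambda>x. k x - m n x)"
  have h_int: "h integrable_on ?S" unfolding h_def by (intro integrable_diff k m_int)
  have h0: "0 \<le> h x" for x by (simp add: h_def m_def)
  have h_small: "integral ?S h < e/2" using n k m_int by (simp add: h_def integral_diff)
  show ?thesis
  proof (intro exI conjI allI impI)
    show "e / (2 * (real n + 1)) > 0" using e by simp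
    fix I :: "'i set" and u v
    assume I: "finite I" and uvb: "\<forall>i\<in>I. a \<le> u i \<and> u i \<le> v i \<and> v i \<le> b"
      and disj: "disjoint_family_on (\<lambda>i. {u i<..<v i}) I"
      and small: "(\<Sum>i\<in>I. v i - u i) < e / (2 * (real n + 1))"
    have uv: "\<And>i. i \<in> I \<Longrightarrow> a \<le> u i \<and> u i \<le> v i \<and> v i \<le> b" using uvb by blast
    have "integral {u i..v i} k \<le> integral {u i..v i} h + real n * (v i - u i)" if i: "i \<in> I" for i
    proof -
      have sub: "{u i..v i} \<subseteq> ?S" using uv[OF i] by auto
      have 1: "h integrable_on {u i..v i}" "m n integrable_on {u i..v i}"
        using integrable_on_subinterval[OF h_int sub] integrable_on_subinterval[OF m_int sub] by auto
      have "integral {u i..v i} k = integral {u i..v i} (\<lambda>x. h x + m n x)" by (simp add: h_def)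
      also have "\<dots> = integral {u i..v i} h + integral {u i..v i} (m n)" by (rule integral_add[OF 1])
      also have "integral {u i..v i} (m n) \<le> integral {u i..v i} (\<lambda>x. real n)"
        by (rule integral_le[OF 1(2)]) (auto simp: m_def)
      finally show ?thesis using uv[OF i] by (simp add: mult.commute)
    qed
    then have "(\<Sum>i\<in>I. integral {u i..v i} k) \<le> (\<Sum>i\<in>I. integral {u i..v i} h) + real n * (\<Sum>i\<in>I. v i - u i)"
      by (simp add: sum_mono sum_distrib_left flip: sum.distrib)
    also have "\<dots> \<le> integral ?S h + real n * (e / (2 * (real n + 1)))"
      using small by (intro add_mono sum_integrals_disjoint_intervals_le h_int h0 I uv disj mult_left_mono) auto
    also have "real n * (e / (2 * (real n + 1))) \<le> e / 2" using e by (simp add: field_simps)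
    finally show "(\<Sum>i\<in>I. integral {u i..v i} k) < e" using h_small by linarith
  qed
qed

text \<open>Intervals tagged in the exceptional set \<open>N\<close> need a separate argument: they
  are fitted into an open set of small measure, where absolute continuity of the integral of
  \<open>k\<close> makes their total increment small. Elsewhere differentiability gives the usual
  estimate. Integrability of \<open>g\<close> is part of the conclusion, which spares a proof that
  \<open>g\<close> is measurable.\<close>

lemma fundamental_theorem_of_calculus_absolutely_continuous:
  fixes f g :: "real \<Rightarrow> 'a::euclidean_space" and k :: "real \<Rightarrow> real"
  assumes ab: "a \<le> b"
    and k: "k integrable_on {a..b}" and k0: "\<And>x. x \<in> {a..b} \<Longrightarrow> 0 \<le> k x"
    and fk: "\<And>u v. a \<le> u \<Longrightarrow> u \<le> v \<Longrightarrow> v \<le> b \<Longrightarrow> norm (f v - f u) \<le> integral {u..v} k"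
    and N: "negligible N"
    and deriv: "\<And>x. x \<in> {a..b} - N \<Longrightarrow> (f has_vector_derivative g x) (at x within {a..b})"
  shows "(g has_integral f b - f a) {a..b}"
proof -
  have k0': "\<forall>x\<in>{a..b}. 0 \<le> k x" using k0 by blast
  \<comment> \<open>With value 0 on \<open>N\<close>, tags in \<open>N\<close> add nothing to a
    Riemann sum, and only their increments of \<open>f\<close> remain.\<close>
  define g' where "g' = (\<lambda>x. if x \<in> N then 0 else g x)"
  have "(g' has_integral f b - f a) {a..b}"
    unfolding has_integral_real
  proof (intro allI impI)
    fix e :: real assume e: "e > 0"
    \<comment> \<open>The \<open>+ 1\<close> keeps the quotient positive when
      \<open>a = b\<close>.\<close>
    define e1 where "e1 = e / (2 * (b - a + 1))"
    have e1: "e1 > 0" "e1 * (b - a) < e / 2"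
    proof -
      show "e1 > 0" using e ab by (simp add: e1_def)
      then have "e1 * (b - a) < e1 * (b - a + 1)" by simp
      also have "e1 * (b - a + 1) = e / 2" using ab by (simp add: e1_def divide_simps)
      finally show "e1 * (b - a) < e / 2" .
    qed
    obtain \<eta> where \<eta>: "\<eta> > 0" and small: "\<forall>(I :: (real \<times> real set) set) u v. finite I \<longrightarrow>
      (\<forall>i\<in>I. a \<le> u i \<and> u i \<le> v i \<and> v i \<le> b) \<longrightarrow>
      disjoint_family_on (\<lambda>i. {u i<..<v i}) I \<longrightarrow> (\<Sum>i\<in>I. v i - u i) < \<eta> \<longrightarrow>
      (\<Sum>i\<in>I. integral {u i..v i} k) < e / 2"
      using absolute_continuity_of_integral[OF k k0' half_gt_zero[OF e]] by (elim exE conjE)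
    obtain W where W: "open W" "N \<subseteq> W" "W \<in> lmeasurable" "measure lebesgue W < \<eta>"
    proof -
      have Nl: "N \<in> sets lebesgue" "N \<in> null_sets lebesgue" using N negligible_iff_null_sets by auto
      obtain W where W: "open W" "N \<subseteq> W" "W - N \<in> lmeasurable" "emeasure lebesgue (W - N) < ennreal \<eta>"
        using sets_lebesgue_outer_open[OF Nl(1) \<eta>] by blast
      have "emeasure lebesgue W = emeasure lebesgue (W - N)"
        using W(1) Nl(2) by (simp add: emeasure_Diff_null_set)
      then have em: "emeasure lebesgue W < ennreal \<eta>" using W(4) by simp
      then have "W \<in> lmeasurable" using W(1) by (intro fmeasurableI) (auto intro: less_trans)
      moreover have "measure lebesgue W < \<eta>"
      proof -
        have "ennreal (measure lebesgue W) < ennreal \<eta>" using em emeasure_eq_measure2[OF \<open>W \<in> lmeasurable\<close>] by metis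
        then show ?thesis by (rule ennreal_less_iff[THEN iffD1, rotated]) simp
      qed
      ultimately show ?thesis using W that by blast
    qed
    \<comment> \<open>The gauge: around points of \<open>N\<close> it stays inside \<open>W\<close>;
      elsewhere it is a radius within which the linear approximation of \<open>f\<close> has error
      rate \<open>e1\<close>.\<close>
    define Q where "Q = (\<lambda>x d. (x \<in> N \<longrightarrow> ball x d \<subseteq> W) \<and>
       (x \<in> {a..b} - N \<longrightarrow> (\<forall>y\<in>{a..b}. norm (y - x) < d \<longrightarrow> norm (f y - f x - (y - x) *\<^sub>R g x) \<le> e1 * norm (y - x))))"
    have "\<exists>d>0. Q x d" for x
    proof (cases "x \<in> N")
      case True
      then obtain d where "d > 0" "ball x d \<subseteq> W" using W(1,2) open_contains_ball by blast
      then show ?thesis using True by (auto simp: Q_def)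
    next
      case False
      show ?thesis
      proof (cases "x \<in> {a..b}")
        case True
        then obtain d where "d > 0" "\<forall>y\<in>{a..b}. norm (y - x) < d \<longrightarrow> norm (f y - f x - (y - x) *\<^sub>R g x) \<le> e1 * norm (y - x)"
          using deriv[of x] False e1(1) unfolding has_vector_derivative_def has_derivative_within_alt by blast
        then show ?thesis using False unfolding Q_def by blast
      next
        case False
        then have "Q x 1" using \<open>x \<notin> N\<close> unfolding Q_def by blast
        then show ?thesis using zero_less_one by blast
      qed
    qed
    then obtain d where d: "\<forall>x. d x > 0 \<and> Q x (d x)" by metis
    have d0: "d x > 0" for x using d by blast
    have dQ: "Q x (d x)" for x using d by blast
    have dN: "ball x (d x) \<subseteq> W" if "x \<in> N" for x using dQ[of x] that unfolding Q_def by blast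
    have dg: "norm (f y - f x - (y - x) *\<^sub>R g x) \<le> e1 * norm (y - x)"
      if "x \<in> {a..b} - N" "y \<in> {a..b}" "norm (y - x) < d x" for x y
      using dQ[of x] that unfolding Q_def by blast
    show "\<exists>\<gamma>. gauge \<gamma> \<and> (\<forall>p. p tagged_division_of {a..b} \<and> \<gamma> fine p \<longrightarrow>
        norm ((\<Sum>(x, K)\<in>p. measure lborel K *\<^sub>R g' x) - (f b - f a)) < e)"
    proof (intro exI conjI allI impI; (elim conjE)?)
      show "gauge (\<lambda>x. ball x (d x))" using d0 gauge_ball_dependent by blast
      fix p assume p: "p tagged_division_of {a..b}" and fine: "(\<lambda>x. ball x (d x)) fine p"
      have fin: "finite p" using p by blast
      define u where "u = (\<lambda>i :: real \<times> real set. Inf (snd i))"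
      define v where "v = (\<lambda>i :: real \<times> real set. Sup (snd i))"
      have K: "snd i = {u i..v i}" "u i \<le> fst i" "fst i \<le> v i" "a \<le> u i" "v i \<le> b" if ip: "i \<in> p" for i
      proof -
        obtain x K where i: "i = (x, K)" by (cases i)
        obtain c c' where c: "K = {c..c'}" "x \<in> K" "K \<subseteq> {a..b}"
          using tagged_division_ofD(2,3,4)[OF p ip[unfolded i]] by (auto simp: cbox_interval)
        then have "c \<le> c'" by auto
        then show "snd i = {u i..v i}" "u i \<le> fst i" "fst i \<le> v i" "a \<le> u i" "v i \<le> b"
          using c by (auto simp: u_def v_def i)
      qed
      have uv_le: "u i \<le> v i" if "i \<in> p" for i using K(2,3)[OF that] by simp
      have disj: "disjoint_family_on (\<lambda>i. {u i<..<v i}) p"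
        unfolding disjoint_family_on_def
      proof (intro ballI impI)
        fix i j assume ij: "i \<in> p" "j \<in> p" "i \<noteq> j"
        have "interior (snd i) \<inter> interior (snd j) = {}"
          using tagged_division_ofD(5)[OF p, of "fst i" "snd i" "fst j" "snd j"] ij by auto
        then show "{u i<..<v i} \<inter> {u j<..<v j} = {}"
          using K(1)[OF ij(1)] K(1)[OF ij(2)] by simp
      qed
      define B where "B = {i \<in> p. fst i \<in> N}"
      define C where "C = {i \<in> p. fst i \<notin> N}"
      have BC: "p = B \<union> C" "B \<inter> C = {}" "finite B" "finite C" "B \<subseteq> p" "C \<subseteq> p" using fin by (auto simp: B_def C_def)
      have len: "(\<Sum>i\<in>p. v i - u i) = b - a"
        using additive_tagged_division_1[OF ab p, of "\<lambda>x. x"] by (simp add: u_def v_def case_prod_unfold)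
      have tele: "(\<Sum>i\<in>p. f (v i) - f (u i)) = f b - f a"
        using additive_tagged_division_1[OF ab p, of f] by (simp add: u_def v_def case_prod_unfold)
      have "(\<Sum>(x, K)\<in>p. measure lborel K *\<^sub>R g' x) - (f b - f a)
          = (\<Sum>i\<in>p. (v i - u i) *\<^sub>R g' (fst i) - (f (v i) - f (u i)))"
      proof -
        have "(\<Sum>(x, K)\<in>p. measure lborel K *\<^sub>R g' x) = (\<Sum>i\<in>p. (v i - u i) *\<^sub>R g' (fst i))"
        proof (rule sum.cong[OF refl])
          fix i assume i: "i \<in> p"
          have "u i \<le> v i" using K(2,3)[OF i] by simp
          then show "(case i of (x, K) \<Rightarrow> measure lborel K *\<^sub>R g' x) = (v i - u i) *\<^sub>R g' (fst i)"
            using K(1)[OF i] by (simp add: case_prod_unfold)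
        qed
        then show ?thesis by (simp only: tele[symmetric] sum_subtractf)
      qed
      also have "\<dots> = (\<Sum>i\<in>B. (v i - u i) *\<^sub>R g' (fst i) - (f (v i) - f (u i)))
          + (\<Sum>i\<in>C. (v i - u i) *\<^sub>R g' (fst i) - (f (v i) - f (u i)))"
        unfolding BC(1) using BC by (intro sum.union_disjoint) auto
      finally have split: "norm ((\<Sum>(x, K)\<in>p. measure lborel K *\<^sub>R g' x) - (f b - f a))
         \<le> norm (\<Sum>i\<in>B. (v i - u i) *\<^sub>R g' (fst i) - (f (v i) - f (u i)))
          + norm (\<Sum>i\<in>C. (v i - u i) *\<^sub>R g' (fst i) - (f (v i) - f (u i)))"
        by (simp add: norm_triangle_ineq)
      have inball: "y \<in> ball (fst i) (d (fst i))" if "i \<in> p" "y \<in> snd i" for i y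
        using fineD[OF fine, of "fst i" "snd i"] that by auto
      have "norm (\<Sum>i\<in>B. (v i - u i) *\<^sub>R g' (fst i) - (f (v i) - f (u i))) \<le> (\<Sum>i\<in>B. integral {u i..v i} k)"
      proof (rule sum_norm_le)
        fix i assume i: "i \<in> B"
        then have "i \<in> p" "g' (fst i) = 0" by (auto simp: B_def g'_def)
        then show "norm ((v i - u i) *\<^sub>R g' (fst i) - (f (v i) - f (u i))) \<le> integral {u i..v i} k"
          using fk[of "u i" "v i"] K[of i] by (simp add: norm_minus_commute)
      qed
      also have "\<dots> < e / 2"
      proof (rule small[rule_format])
        show "finite B" by fact
        show "a \<le> u i \<and> u i \<le> v i \<and> v i \<le> b" if "i \<in> B" for i using K[of i] that by (auto simp: B_def)
        show dB: "disjoint_family_on (\<lambda>i. {u i<..<v i}) B" by (rule disjoint_family_on_mono[OF BC(5) disj])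
        have "(\<Sum>i\<in>B. v i - u i) = (\<Sum>i\<in>B. measure lebesgue {u i<..<v i})"
          using uv_le by (intro sum.cong) (auto simp: B_def)
        also have "\<dots> = measure lebesgue (\<Union>i\<in>B. {u i<..<v i})"
        proof (rule measure_finite_Union[symmetric])
          show "emeasure lebesgue {u i<..<v i} \<noteq> \<infinity>" if "i \<in> B" for i
            using uv_le[of i] that by (simp add: B_def)
        qed (use dB BC(3) in auto)
        also have "\<dots> \<le> measure lebesgue W"
        proof (rule measure_mono_fmeasurable[OF _ _ W(3)])
          show "(\<Union>i\<in>B. {u i<..<v i}) \<subseteq> W"
          proof (intro UN_least subsetI)
            fix i y assume i: "i \<in> B" and y: "y \<in> {u i<..<v i}"
            then have "y \<in> snd i" using K(1)[of i] by (auto simp: B_def)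
            then show "y \<in> W" using inball[of i y] dN[of "fst i"] i by (auto simp: B_def)
          qed
          show "(\<Union>i\<in>B. {u i<..<v i}) \<in> sets lebesgue"
            using BC(3) by (intro sets.finite_UN) auto
        qed
        also have "\<dots> < \<eta>" by fact
        finally show "(\<Sum>i\<in>B. v i - u i) < \<eta>" .
      qed
      finally have small_B: "norm (\<Sum>i\<in>B. (v i - u i) *\<^sub>R g' (fst i) - (f (v i) - f (u i))) < e / 2" .
      have "norm (\<Sum>i\<in>C. (v i - u i) *\<^sub>R g' (fst i) - (f (v i) - f (u i))) \<le> (\<Sum>i\<in>C. e1 * (v i - u i))"
      proof (rule sum_norm_le)
        fix i assume i: "i \<in> C"
        define x where "x = fst i"
        have ip: "i \<in> p" and g: "g' x = g x" and xN: "x \<notin> N" using i by (auto simp: C_def g'_def x_def)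
        note Ki = K[OF ip, folded x_def]
        have x: "x \<in> {a..b} - N" using Ki xN by auto
        \<comment> \<open>The tag lies between the endpoints, so the errors towards both ends add up
          to \<open>e1\<close> times the length of the interval.\<close>
        have "norm (f (v i) - f x - (v i - x) *\<^sub>R g x) \<le> e1 * norm (v i - x)"
          using inball[OF ip, of "v i"] Ki by (intro dg x) (auto simp: dist_real_def x_def[symmetric])
        moreover have "norm (f (u i) - f x - (u i - x) *\<^sub>R g x) \<le> e1 * norm (u i - x)"
          using inball[OF ip, of "u i"] Ki by (intro dg x) (auto simp: dist_real_def x_def[symmetric])
        moreover have "(v i - u i) *\<^sub>R g x - (f (v i) - f (u i))
           = (f (u i) - f x - (u i - x) *\<^sub>R g x) - (f (v i) - f x - (v i - x) *\<^sub>R g x)"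
          by (simp add: algebra_simps)
        moreover have "norm (u i - x) = x - u i" "norm (v i - x) = v i - x" using Ki by auto
        ultimately have "norm ((v i - u i) *\<^sub>R g x - (f (v i) - f (u i))) \<le> e1 * (x - u i) + e1 * (v i - x)"
          by (smt (verit) norm_triangle_ineq4)
        also have "\<dots> = e1 * (v i - u i)" by (simp add: algebra_simps)
        finally show "norm ((v i - u i) *\<^sub>R g' (fst i) - (f (v i) - f (u i))) \<le> e1 * (v i - u i)"
          using g by (simp add: x_def)
      qed
      also have "\<dots> \<le> (\<Sum>i\<in>p. e1 * (v i - u i))"
        using uv_le e1 fin BC(6) by (intro sum_mono2) (auto intro!: mult_nonneg_nonneg)
      also have "\<dots> < e / 2" using e1 len by (simp flip: sum_distrib_left)
      finally show "norm ((\<Sum>(x, K)\<in>p. measure lborel K *\<^sub>R g' x) - (f b - f a)) < e"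
        using small_B split by linarith
    qed
  qed
  then show ?thesis by (rule has_integral_spike[OF N, rotated]) (auto simp: g'_def)
qed

lemma absolutely_continuous_Icc_of_integral_bound:
  assumes k: "k integrable_on {a..b}" and k0: "\<And>x. x \<in> {a..b} \<Longrightarrow> 0 \<le> k x"
    and fk: "\<And>u v. a \<le> u \<Longrightarrow> u \<le> v \<Longrightarrow> v \<le> b \<Longrightarrow> norm (f v - f u) \<le> integral {u..v} k"
  shows "absolutely_continuous_Icc a b f"
  unfolding absolutely_continuous_Icc_def
proof (intro allI impI)
  fix e :: real assume "e > 0"
  have k0': "\<forall>x\<in>{a..b}. 0 \<le> k x" using k0 by blast
  obtain d where d: "d > 0" and small: "\<forall>(I :: (real \<times> real) set) u v. finite I \<longrightarrow>
      (\<forall>i\<in>I. a \<le> u i \<and> u i \<le> v i \<and> v i \<le> b) \<longrightarrow>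
      disjoint_family_on (\<lambda>i. {u i<..<v i}) I \<longrightarrow> (\<Sum>i\<in>I. v i - u i) < d \<longrightarrow>
      (\<Sum>i\<in>I. integral {u i..v i} k) < e"
    using absolute_continuity_of_integral[OF k k0' \<open>e > 0\<close>] by (elim exE conjE)
  show "\<exists>\<delta>>0. \<forall>P. finite P \<longrightarrow> (\<forall>(u, v)\<in>P. a \<le> u \<and> u \<le> v \<and> v \<le> b) \<longrightarrow>
    pairwise (\<lambda>p q. {fst p<..<snd p} \<inter> {fst q<..<snd q} = {}) P \<longrightarrow>
    (\<Sum>(u, v)\<in>P. v - u) < \<delta> \<longrightarrow> (\<Sum>(u, v)\<in>P. cmod (f v - f u)) < e"
  proof (intro exI[of _ d] conjI d allI impI)
    fix P :: "(real \<times> real) set"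
    assume P: "finite P" "\<forall>(u, v)\<in>P. a \<le> u \<and> u \<le> v \<and> v \<le> b"
      "pairwise (\<lambda>p q. {fst p<..<snd p} \<inter> {fst q<..<snd q} = {}) P" "(\<Sum>(u, v)\<in>P. v - u) < d"
    have "(\<Sum>(u, v)\<in>P. cmod (f v - f u)) \<le> (\<Sum>i\<in>P. integral {fst i..snd i} k)"
      using P(2) by (intro sum_mono) (auto intro!: fk)
    also have "\<dots> < e"
      using P by (intro small[rule_format]) (auto simp: disjoint_family_on_def pairwise_def case_prod_unfold)
    finally show "(\<Sum>(u, v)\<in>P. cmod (f v - f u)) < e" .
  qed
qed

section \<open>Null sets of times, and Lebesgue integrals as gauge integrals\<close>

lemma negligible_exceptions:
  assumes "AE x\<in>S in lebesgue. P x"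
  shows "negligible {x \<in> S. \<not> P x}"
proof -
  obtain N where "N \<in> null_sets lebesgue" "{x. \<not> (x \<in> S \<longrightarrow> P x)} \<subseteq> N"
    using assms by (auto simp: eventually_ae_filter)
  moreover from this have "{x \<in> S. \<not> P x} \<subseteq> N" by auto
  ultimately show ?thesis using negligible_iff_null_sets negligible_subset by blast
qed

lemma AE_of_negligible_exceptions:
  assumes "negligible N" "\<And>x. x \<in> S - N \<Longrightarrow> P x"
  shows "AE x\<in>S in lebesgue. P x"
  using assms by (auto simp: negligible_iff_null_sets eventually_ae_filter intro!: bexI[of _ N])

lemma interval_lebesgue_integral_eq_integral:
  fixes f :: "real \<Rightarrow> 'a::euclidean_space"
  assumes "u \<le> t" "f absolutely_integrable_on {u..t}"
  shows "(LINT \<xi>=u..t|lebesgue. f \<xi>) = integral {u..t} f"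
proof -
  have "f absolutely_integrable_on {u<..<t}"
    using assms(2) by (rule set_integrable_subset) auto
  then have "(LINT \<xi>:{u<..<t}|lebesgue. f \<xi>) = integral {u<..<t} f"
    by (rule set_lebesgue_integral_eq_integral(2))
  then show ?thesis using assms(1)
    by (simp add: interval_lebesgue_integral_le_eq integral_open_interval_real)
qed

text \<open>On an interval of finite measure every order reduces to order 1, through
  \<open>|x| <= 1 + |x| powr p\<close> for \<open>p >= 1\<close>.\<close>

lemma Lspace_Icc_imp_absolutely_integrable:
  assumes d: "1 \<le> d" and k: "k \<in> Lspace_Icc d T"
  shows "k absolutely_integrable_on {0..T}"
proof -
  let ?M = "lebesgue_on {0..T}"
  have fm: "finite_measure ?M" by (rule finite_measure_lebesgue_on) auto
  have meas: "k \<in> borel_measurable ?M" using k by (simp add: Lspace_Icc_def)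
  have "integrable ?M k"
  proof (cases "d = \<infinity>")
    case True
    then obtain C where "AE t in ?M. \<bar>k t\<bar> \<le> C" using k by (auto simp: Lspace_Icc_def)
    then show ?thesis using finite_measure.integrable_const_bound[OF fm _ meas] by simp
  next
    case False
    then have i: "integrable ?M (\<lambda>t. \<bar>k t\<bar> powr real_of_ereal d)" using k by (simp add: Lspace_Icc_def)
    have p: "real_of_ereal d \<ge> 1" using d False by (cases d) auto
    have "integrable ?M (\<lambda>t. 1 + \<bar>k t\<bar> powr real_of_ereal d)"
      using i fm by (intro Bochner_Integration.integrable_add finite_measure.integrable_const)
    then show ?thesis
    proof (rule Bochner_Integration.integrable_bound[OF _ meas])
      have "\<bar>x\<bar> \<le> 1 + \<bar>x\<bar> powr real_of_ereal d" for x :: real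
      proof (cases "\<bar>x\<bar> \<le> 1")
        case False
        then have "\<bar>x\<bar> powr 1 \<le> \<bar>x\<bar> powr real_of_ereal d" using p by (intro powr_mono) auto
        then show ?thesis using False by simp
      qed (simp add: add_increasing2)
      then show "AE t in ?M. norm (k t) \<le> norm (1 + \<bar>k t\<bar> powr real_of_ereal d)"
        by (intro AE_I2) (simp add: abs_of_nonneg)
    qed
  qed
  then show ?thesis by (simp add: integrable_restrict_space set_integrable_def)
qed

section \<open>Infinitesimal contraction along an evolution family\<close>

lemma evolution_familyD:
  assumes "evolution_family d \<phi>" "0 \<le> s" "s \<le> u" "u \<le> t"
  shows "\<phi> s u holomorphic_on ball 0 1" "\<phi> s u ` ball 0 1 \<subseteq> ball 0 1"
    and "z \<in> ball 0 1 \<Longrightarrow> \<phi> s u z \<in> ball 0 1"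
    and "z \<in> ball 0 1 \<Longrightarrow> \<phi> s s z = z"
    and "z \<in> ball 0 1 \<Longrightarrow> \<phi> s t z = \<phi> u t (\<phi> s u z)"
proof -
  have 1: "\<forall>s t. 0 \<le> s \<and> s \<le> t \<longrightarrow> \<phi> s t holomorphic_on ball 0 1 \<and> \<phi> s t ` ball 0 1 \<subseteq> ball 0 1"
    and 2: "\<forall>s\<ge>0. \<forall>z \<in> ball 0 1. \<phi> s s z = z"
    and 3: "\<forall>s u t. 0 \<le> s \<and> s \<le> u \<and> u \<le> t \<longrightarrow> (\<forall>z \<in> ball 0 1. \<phi> s t z = \<phi> u t (\<phi> s u z))"
    using assms(1) unfolding evolution_family_def by simp_all
  show 4: "\<phi> s u holomorphic_on ball 0 1" "\<phi> s u ` ball 0 1 \<subseteq> ball 0 1"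
    using 1 assms(2,3) by simp_all
  then show "z \<in> ball 0 1 \<Longrightarrow> \<phi> s u z \<in> ball 0 1" by blast
  show "z \<in> ball 0 1 \<Longrightarrow> \<phi> s s z = z" using 2 assms(2) by simp
  show "z \<in> ball 0 1 \<Longrightarrow> \<phi> s t z = \<phi> u t (\<phi> s u z)" using 3 assms(2-4) by blast
qed

lemma evolution_family_integral_bound:
  assumes ef: "evolution_family d \<phi>" and z: "z \<in> ball 0 1" and T: "T > 0"
  obtains k where "k integrable_on {0..T}" "\<And>x. x \<in> {0..T} \<Longrightarrow> 0 \<le> k x"
    "\<And>s u t. 0 \<le> s \<Longrightarrow> s \<le> u \<Longrightarrow> u \<le> t \<Longrightarrow> t \<le> T \<Longrightarrow> cmod (\<phi> s t z - \<phi> s u z) \<le> integral {u..t} k"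
proof -
  have d: "1 \<le> d" using ef by (simp add: evolution_family_def)
  have "\<forall>z \<in> ball 0 1. \<forall>T>0. \<exists>k \<in> Lspace_Icc d T. (\<forall>\<xi> \<in> {0..T}. 0 \<le> k \<xi>) \<and>
          (\<forall>s u t. 0 \<le> s \<and> s \<le> u \<and> u \<le> t \<and> t \<le> T \<longrightarrow>
             cmod (\<phi> s u z - \<phi> s t z) \<le> (LINT \<xi>=u..t|lebesgue. k \<xi>))"
    using ef unfolding evolution_family_def by (elim conjE)
  from this[rule_format, OF z T] obtain k where k: "k \<in> Lspace_Icc d T" "\<forall>\<xi>\<in>{0..T}. 0 \<le> k \<xi>"
    and b: "\<And>s u t. 0 \<le> s \<and> s \<le> u \<and> u \<le> t \<and> t \<le> T \<Longrightarrow> cmod (\<phi> s u z - \<phi> s t z) \<le> (LINT \<xi>=u..t|lebesgue. k \<xi>)"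
    by auto
  have ka: "k absolutely_integrable_on {0..T}" by (rule Lspace_Icc_imp_absolutely_integrable[OF d k(1)])
  show ?thesis
  proof (rule that)
    show "k integrable_on {0..T}" using ka by (rule set_lebesgue_integral_eq_integral(1))
    show "0 \<le> k x" if "x \<in> {0..T}" for x using k(2) that by blast
    fix s u t :: real assume a: "0 \<le> s" "s \<le> u" "u \<le> t" "t \<le> T"
    have "k absolutely_integrable_on {u..t}" using a by (intro set_integrable_subset[OF ka]) auto
    then show "cmod (\<phi> s t z - \<phi> s u z) \<le> integral {u..t} k"
      using b[of s u t] a by (simp add: interval_lebesgue_integral_eq_integral norm_minus_commute)
  qed
qed

lemma integral_small_interval:
  fixes k :: "real \<Rightarrow> real"
  assumes "k integrable_on {a..b}" "\<And>x. x \<in> {a..b} \<Longrightarrow> 0 \<le> k x" "e > 0"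
  shows "\<exists>d>0. \<forall>u v. a \<le> u \<longrightarrow> u \<le> v \<longrightarrow> v \<le> b \<longrightarrow> v - u < d \<longrightarrow> integral {u..v} k < e"
proof -
  have k0: "\<forall>x\<in>{a..b}. 0 \<le> k x" using assms(2) by blast
  obtain d where d: "d > 0" and small: "\<forall>(I :: unit set) u v. finite I \<longrightarrow> (\<forall>i\<in>I. a \<le> u i \<and> u i \<le> v i \<and> v i \<le> b) \<longrightarrow>
    disjoint_family_on (\<lambda>i. {u i<..<v i}) I \<longrightarrow> (\<Sum>i\<in>I. v i - u i) < d \<longrightarrow>
    (\<Sum>i\<in>I. integral {u i..v i} k) < e"
    using absolute_continuity_of_integral[OF assms(1) k0 assms(3), where 'i=unit] by (elim exE conjE)
  have "integral {u..v} k < e" if "a \<le> u" "u \<le> v" "v \<le> b" "v - u < d" for u v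
    using small[rule_format, of UNIV "\<lambda>_. u" "\<lambda>_. v"] that by (simp add: disjoint_family_on_def UNIV_unit)
  then show ?thesis using d by blast
qed

text \<open>The integral bound \<open>k\<close> for the increments depends on \<open>z\<close> but
  not on the initial time \<open>s\<close>. Hence trajectories started shortly before
  \<open>t\<close> are still near their starting points at time \<open>t\<close>.\<close>

lemma evolution_family_near_identity:
  assumes ef: "evolution_family d \<phi>" and z: "z \<in> ball 0 1" and t: "t > 0" and e: "e > 0"
  shows "\<exists>\<delta>>0. \<forall>s\<ge>0. t - \<delta> < s \<longrightarrow> s \<le> t \<longrightarrow> cmod (\<phi> s t z - z) < e"
proof -
  obtain k where k: "k integrable_on {0..t}" "\<And>x. x \<in> {0..t} \<Longrightarrow> 0 \<le> k x"
    and b: "\<And>s u t'. 0 \<le> s \<Longrightarrow> s \<le> u \<Longrightarrow> u \<le> t' \<Longrightarrow> t' \<le> t \<Longrightarrow> cmod (\<phi> s t' z - \<phi> s u z) \<le> integral {u..t'} k"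
    using evolution_family_integral_bound[OF ef z t] by blast
  obtain \<delta> where \<delta>: "\<delta> > 0" "\<forall>u v. 0 \<le> u \<longrightarrow> u \<le> v \<longrightarrow> v \<le> t \<longrightarrow> v - u < \<delta> \<longrightarrow> integral {u..v} k < e"
    using integral_small_interval[OF k e] by blast
  have "cmod (\<phi> s t z - z) < e" if s: "0 \<le> s" "t - \<delta> < s" "s \<le> t" for s
  proof -
    have "cmod (\<phi> s t z - \<phi> s s z) \<le> integral {s..t} k" using b[of s s t] s by simp
    also have "\<dots> < e" using \<delta> s by auto
    finally show ?thesis using evolution_familyD(4)[OF ef s(1) order_refl order_refl z] by simp
  qed
  then show ?thesis using \<delta>(1) by blast
qed

text \<open>Let \<psi> be the difference of the two sides of Schwarz--Pick for
  \<open>\<phi> t \<tau>\<close> at the points \<open>Z\<close> and \<open>W\<close>. By the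
  composition law it vanishes at \<open>t\<close> and is non-positive afterwards, so its derivative
  at \<open>t\<close>, which is the left-hand side, cannot be positive.\<close>

lemma pseudo_hyperbolic_contraction_derivative:
  assumes ef: "evolution_family d \<phi>" and s: "0 \<le> s" "s < t"
    and z: "z \<in> ball 0 1" and w: "w \<in> ball 0 1"
    and dz: "((\<lambda>\<tau>. \<phi> s \<tau> z) has_vector_derivative A) (at t within {s..})"
    and dw: "((\<lambda>\<tau>. \<phi> s \<tau> w) has_vector_derivative B) (at t within {s..})"
    and Z: "Z = \<phi> s t z" and W: "W = \<phi> s t w"
  shows "2 * Re (cnj (Z - W) * (A - B)) * ((1 - (cmod Z)\<^sup>2) * (1 - (cmod W)\<^sup>2))
    + (cmod (Z - W))\<^sup>2 * (2 * Re (cnj Z * A) * (1 - (cmod W)\<^sup>2) + 2 * Re (cnj W * B) * (1 - (cmod Z)\<^sup>2)) \<le> 0"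
    (is "?\<Phi> \<le> 0")
proof (rule ccontr)
  assume "\<not> ?thesis"
  then have pos: "?\<Phi> > 0" by simp
  \<comment> \<open>Since \<open>s < t\<close>, the time \<open>t\<close> is an interior point and
    the derivatives there are two-sided.\<close>
  have at: "at t within {s..} = at t" using s by (intro at_within_interior) auto
  have comp: "((\<lambda>\<tau>. Re (\<phi> s \<tau> x)) has_real_derivative Re C) (at t)"
             "((\<lambda>\<tau>. Im (\<phi> s \<tau> x)) has_real_derivative Im C) (at t)"
    if "((\<lambda>\<tau>. \<phi> s \<tau> x) has_vector_derivative C) (at t within {s..})" for x C
    using bounded_linear.has_vector_derivative[OF bounded_linear_Re that]
      bounded_linear.has_vector_derivative[OF bounded_linear_Im that]
    unfolding at has_real_derivative_iff_has_vector_derivative by auto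
  define Y where "Y = (1 - (cmod Z)\<^sup>2) * (1 - (cmod W)\<^sup>2)"
  define E where "E = (cmod (Z - W))\<^sup>2"
  define \<psi> where "\<psi> = (\<lambda>\<tau>. (cmod (\<phi> s \<tau> z - \<phi> s \<tau> w))\<^sup>2 * Y - E * ((1 - (cmod (\<phi> s \<tau> z))\<^sup>2) * (1 - (cmod (\<phi> s \<tau> w))\<^sup>2)))"
  have "(\<psi> has_real_derivative ?\<Phi>) (at t)"
  proof -
    have *: "((\<lambda>\<tau>. ((X \<tau> - U \<tau>)\<^sup>2 + (P \<tau> - Q \<tau>)\<^sup>2) * c
        - E * ((1 - ((X \<tau>)\<^sup>2 + (P \<tau>)\<^sup>2)) * (1 - ((U \<tau>)\<^sup>2 + (Q \<tau>)\<^sup>2)))) has_real_derivative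
        2 * ((X t - U t) * (X' - U') + (P t - Q t) * (P' - Q')) * c
        + E * (2 * (X t * X' + P t * P') * (1 - ((U t)\<^sup>2 + (Q t)\<^sup>2))
           + 2 * (U t * U' + Q t * Q') * (1 - ((X t)\<^sup>2 + (P t)\<^sup>2)))) (at t)"
      if [derivative_intros]: "(X has_real_derivative X') (at t)" "(P has_real_derivative P') (at t)"
         "(U has_real_derivative U') (at t)" "(Q has_real_derivative Q') (at t)" for X P U Q :: "real \<Rightarrow> real" and X' P' U' Q' c
      by (rule derivative_eq_intros refl)+ (simp add: algebra_simps)
    show ?thesis
    proof (rule DERIV_cong)
      show "(\<psi> has_real_derivative 2 * ((Re Z - Re W) * (Re A - Re B) + (Im Z - Im W) * (Im A - Im B)) * Y
        + E * (2 * (Re Z * Re A + Im Z * Im A) * (1 - (cmod W)\<^sup>2)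
           + 2 * (Re W * Re B + Im W * Im B) * (1 - (cmod Z)\<^sup>2))) (at t)"
        using *[OF comp[OF dz] comp[OF dw], of Y]
        unfolding \<psi>_def cmod_power2 minus_complex.simps Z[symmetric] W[symmetric] .
    qed (simp add: Y_def E_def algebra_simps)
  qed
  then obtain r where r: "r > 0" "\<forall>h>0. h < r \<longrightarrow> \<psi> t < \<psi> (t + h)"
    using DERIV_pos_inc_right[OF _ pos] by blast
  have "\<psi> t = 0" by (simp add: \<psi>_def Z[symmetric] W[symmetric] Y_def E_def)
  moreover have "\<psi> (t + r / 2) \<le> 0"
  proof -
    let ?u = "t + r / 2"
    have u: "s \<le> t" "t \<le> ?u" "0 \<le> t" using s r by auto
    have Zin: "Z \<in> ball 0 1" "W \<in> ball 0 1" unfolding Z W using evolution_familyD(3)[OF ef s(1) u(1,2)] z w by auto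
    have "\<phi> s ?u z = \<phi> t ?u Z" "\<phi> s ?u w = \<phi> t ?u W"
      unfolding Z W using evolution_familyD(5)[OF ef s(1) u(1,2)] z w by auto
    then show ?thesis
      using schwarz_pick[OF evolution_familyD(1,2)[OF ef u(3,2) order_refl] Zin]
      by (simp add: \<psi>_def Y_def E_def)
  qed
  moreover have "\<psi> t < \<psi> (t + r / 2)" using r by simp
  ultimately show False by linarith
qed

text \<open>The exceptional null set of times depends on the trajectory, so the contraction property is
  differentiated only along trajectories with rational starting times and starting points in a
  countable dense set; at a fixed time these still pass through a dense set of pairs of points.
  The claim is the limit in which the second point tends to \<open>0\<close>.\<close>

lemma AE_generator_inequality:
  assumes ef: "evolution_family d \<phi>" and hv: "herglotz_vector_field_of d \<phi> G"
  shows "AE t\<in>{0..} in lebesgue. \<forall>z\<in>ball 0 1.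
    Re (cnj z * G z t) \<le> Re (G 0 t * cnj z) * (1 - (cmod z)\<^sup>2)"
proof -
  obtain D :: "complex set" where D: "countable D" "\<And>X. open X \<Longrightarrow> X \<noteq> {} \<Longrightarrow> \<exists>d\<in>D. d \<in> X"
    using countable_dense_exists by blast
  define P where "P = (\<lambda>t. \<forall>s\<in>\<rat> \<inter> {0..}. \<forall>z\<in>D \<inter> ball 0 1. s \<le> t \<longrightarrow>
      ((\<lambda>\<tau>. \<phi> s \<tau> z) has_vector_derivative G (\<phi> s t z) t) (at t within {s..}))"
  have "AE t in lebesgue. P t"
    unfolding P_def
  proof (intro AE_ball_countable' )
    show "countable (\<rat> \<inter> {0::real..})" "countable (D \<inter> ball 0 1)" using D(1) countable_rat by auto
    fix s :: real and z assume "s \<in> \<rat> \<inter> {0..}" "z \<in> D \<inter> ball 0 1"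
    then show "AE t in lebesgue. s \<le> t \<longrightarrow>
      ((\<lambda>\<tau>. \<phi> s \<tau> z) has_vector_derivative G (\<phi> s t z) t) (at t within {s..})"
      using hv by (simp add: herglotz_vector_field_of_def)
  qed
  \<comment> \<open>Time 0 is discarded: the trajectories must have started strictly
    earlier.\<close>
  moreover have "AE t in lebesgue. (t::real) \<noteq> 0"
    using AE_of_negligible_exceptions[OF negligible_sing[of 0], of UNIV "\<lambda>t. t \<noteq> 0"] by auto
  ultimately show ?thesis
  proof eventually_elim
    case (elim t)
    show ?case
    proof (intro impI ballI)
      fix z0 :: complex assume t0: "t \<in> {0..}" and z0: "z0 \<in> ball 0 1"
      then have t: "t > 0" using elim by auto
      have "(\<lambda>z. G z t) holomorphic_on ball 0 1"
        using hv t unfolding herglotz_vector_field_of_def herglotz_vector_field_def by auto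
      then have cont: "isCont (\<lambda>z. G z t) z" if "z \<in> ball 0 1" for z
        using that by (metis continuous_on_eq_continuous_at holomorphic_on_imp_continuous_on open_ball)
      define \<Phi> where "\<Phi> = (\<lambda>Z W. 2 * Re (cnj (Z - W) * (G Z t - G W t)) * ((1 - (cmod Z)\<^sup>2) * (1 - (cmod W)\<^sup>2))
        + (cmod (Z - W))\<^sup>2 * (2 * Re (cnj Z * G Z t) * (1 - (cmod W)\<^sup>2) + 2 * Re (cnj W * G W t) * (1 - (cmod Z)\<^sup>2)))"
      have "\<exists>Z W. Z \<in> ball 0 1 \<and> W \<in> ball 0 1 \<and> cmod (Z - z0) < e \<and> cmod W < e \<and> \<Phi> Z W \<le> 0" if e: "e > 0" for e
      proof -
        have near: "\<exists>z\<in>D \<inter> ball 0 1. cmod (z - x) < e / 2" if x: "x \<in> ball 0 1" for x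
        proof -
          have "open (ball 0 1 \<inter> ball x (e/2))" "ball 0 1 \<inter> ball x (e/2) \<noteq> {}"
            using x e by (auto intro!: exI[of _ x])
          then show ?thesis using D(2) by (fastforce simp: dist_norm norm_minus_commute)
        qed
        obtain z where z: "z \<in> D" "z \<in> ball 0 1" "cmod (z - z0) < e / 2" using near[OF z0] by auto
        obtain w where w: "w \<in> D" "w \<in> ball 0 1" "cmod (w - 0) < e / 2" using near[of 0] by auto
        obtain \<delta>1 where \<delta>1: "\<delta>1 > 0" "\<forall>s\<ge>0. t - \<delta>1 < s \<longrightarrow> s \<le> t \<longrightarrow> cmod (\<phi> s t z - z) < e / 2"
          using evolution_family_near_identity[OF ef z(2) t half_gt_zero[OF e]] by blast
        obtain \<delta>2 where \<delta>2: "\<delta>2 > 0" "\<forall>s\<ge>0. t - \<delta>2 < s \<longrightarrow> s \<le> t \<longrightarrow> cmod (\<phi> s t w - w) < e / 2"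
          using evolution_family_near_identity[OF ef w(2) t half_gt_zero[OF e]] by blast
        \<comment> \<open>A rational start so close to \<open>t\<close> that neither trajectory
          moves by \<open>e / 2\<close> before \<open>t\<close>; at time \<open>t\<close> they pass
          near \<open>z0\<close> and near 0, which is all that continuity of \<Phi> needs.\<close>
        obtain s where s: "s \<in> \<rat>" "max 0 (t - min \<delta>1 \<delta>2) < s" "s < t"
          using Rats_dense_in_real[of "max 0 (t - min \<delta>1 \<delta>2)" t] t \<delta>1(1) \<delta>2(1) by auto
        have s0: "0 \<le> s" "s \<le> t" "t - \<delta>1 < s" "t - \<delta>2 < s" using s by auto
        have "cmod (\<phi> s t z - z) < e / 2" "cmod (\<phi> s t w - w) < e / 2" using \<delta>1(2) \<delta>2(2) s0 by auto
        then have "cmod (\<phi> s t z - z0) < e" "cmod (\<phi> s t w) < e"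
          using z(3) w(3) norm_triangle_ineq[of "\<phi> s t z - z" "z - z0"] norm_triangle_ineq[of "\<phi> s t w - w" w] by auto
        moreover have "\<phi> s t z \<in> ball 0 1" "\<phi> s t w \<in> ball 0 1"
          using evolution_familyD(3)[OF ef s0(1,2) order_refl] z(2) w(2) by auto
        moreover have "\<Phi> (\<phi> s t z) (\<phi> s t w) \<le> 0"
          unfolding \<Phi>_def using elim(1) z w s s0
          by (intro pseudo_hyperbolic_contraction_derivative[OF ef s0(1) s(3) z(2) w(2) _ _ refl refl]) (auto simp: P_def)
        ultimately show ?thesis by blast
      qed
      then have "\<forall>n. \<exists>Z W. Z \<in> ball 0 1 \<and> W \<in> ball 0 1 \<and> cmod (Z - z0) < 1 / real (Suc n) \<and> cmod W < 1 / real (Suc n) \<and> \<Phi> Z W \<le> 0"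
        by simp
      from choice[OF this] obtain Z where "\<forall>n. \<exists>W. Z n \<in> ball 0 1 \<and> W \<in> ball 0 1 \<and> cmod (Z n - z0) < 1 / real (Suc n)
         \<and> cmod W < 1 / real (Suc n) \<and> \<Phi> (Z n) W \<le> 0" by (elim exE)
      from choice[OF this] obtain W where ZW: "\<forall>n. Z n \<in> ball 0 1 \<and> W n \<in> ball 0 1 \<and> cmod (Z n - z0) < 1 / real (Suc n)
         \<and> cmod (W n) < 1 / real (Suc n) \<and> \<Phi> (Z n) (W n) \<le> 0" by (elim exE)
      have Zl: "Z \<longlonglongrightarrow> z0"
        by (rule LIM_zero_cancel, rule Lim_null_comparison[OF _ LIMSEQ_inverse_real_of_nat])
           (use ZW in \<open>auto intro!: always_eventually less_imp_le simp: inverse_eq_divide\<close>)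
      have Wl: "W \<longlonglongrightarrow> 0"
        by (rule Lim_null_comparison[OF _ LIMSEQ_inverse_real_of_nat])
           (use ZW in \<open>auto intro!: always_eventually less_imp_le simp: inverse_eq_divide\<close>)
      have "(\<lambda>n. \<Phi> (Z n) (W n)) \<longlonglongrightarrow> \<Phi> z0 0"
        unfolding \<Phi>_def
        by (intro tendsto_intros Zl Wl isCont_tendsto_compose[OF cont[OF z0]] isCont_tendsto_compose[OF cont]) auto
      then have "\<Phi> z0 0 \<le> 0" by (rule LIMSEQ_le_const2) (use ZW in auto)
      \<comment> \<open>The weights \<open>1 - |z0|^2\<close> and \<open>|z0|^2\<close> of
        \<open>Re (cnj z0 * G z0 t)\<close> add up to 1.\<close>
      then have "2 * Re (cnj z0 * (G z0 t - G 0 t)) * (1 - (cmod z0)\<^sup>2) + (cmod z0)\<^sup>2 * (2 * Re (cnj z0 * G z0 t)) \<le> 0"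
        by (simp add: \<Phi>_def)
      moreover have "Re (cnj z0 * (G z0 t - G 0 t)) = Re (cnj z0 * G z0 t) - Re (G 0 t * cnj z0)"
        by (simp add: algebra_simps)
      ultimately show "Re (cnj z0 * G z0 t) \<le> Re (G 0 t * cnj z0) * (1 - (cmod z0)\<^sup>2)"
        by (simp add: algebra_simps)
    qed
  qed
qed

section \<open>Integral formulas along trajectories\<close>

lemma absolutely_integrable_AE_bound:
  fixes f :: "'n::euclidean_space \<Rightarrow> 'm::euclidean_space"
  assumes "f integrable_on S" "g integrable_on S" "AE x\<in>S in lebesgue. norm (f x) \<le> g x"
  shows "f absolutely_integrable_on S"
proof -
  obtain N where N: "negligible N" "\<And>x. x \<in> S - N \<Longrightarrow> norm (f x) \<le> g x"
    using negligible_exceptions[OF assms(3)] by auto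
  have "(\<lambda>x. if x \<in> N then 0 else f x) absolutely_integrable_on S"
  proof (rule absolutely_integrable_integrable_bound)
    show "norm (if x \<in> N then 0 else f x) \<le> (if x \<in> N then 0 else g x)" if "x \<in> S" for x
      using N(2)[of x] that by auto
    show "(\<lambda>x. if x \<in> N then 0 else f x) integrable_on S" "(\<lambda>x. if x \<in> N then 0 else g x) integrable_on S"
      by (rule integrable_spike[OF assms(1) N(1)], simp) (rule integrable_spike[OF assms(2) N(1)], simp)
  qed
  then show ?thesis by (rule absolutely_integrable_spike[OF _ N(1)]) simp
qed

lemma herglotz_vector_field_bound:
  assumes hv: "herglotz_vector_field d G" and K: "compact K" "K \<subseteq> ball 0 1" and T: "T > 0"
  obtains k where "k integrable_on {0..T}" "\<And>x. x \<in> {0..T} \<Longrightarrow> 0 \<le> k x"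
    "AE t\<in>{0..T} in lebesgue. \<forall>z\<in>K. cmod (G z t) \<le> k t"
proof -
  have d: "1 \<le> d" and b: "\<forall>K T. compact K \<and> K \<subseteq> ball 0 1 \<and> T > 0 \<longrightarrow>
        (\<exists>k \<in> Lspace_Icc d T. (\<forall>t \<in> {0..T}. 0 \<le> k t) \<and>
           (AE t\<in>{0..T} in lebesgue. \<forall>z \<in> K. cmod (G z t) \<le> k t))"
    using hv unfolding herglotz_vector_field_def by simp_all
  obtain k where k: "k \<in> Lspace_Icc d T" "\<forall>t \<in> {0..T}. 0 \<le> k t"
    "AE t\<in>{0..T} in lebesgue. \<forall>z \<in> K. cmod (G z t) \<le> k t"
    using b[rule_format, of K T] K T by auto
  show ?thesis
  proof (rule that[OF _ _ k(3)])
    show "k integrable_on {0..T}"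
      using Lspace_Icc_imp_absolutely_integrable[OF d k(1)] by (rule set_lebesgue_integral_eq_integral(1))
  qed (use k(2) in blast)
qed

lemma herglotz_vector_field_absolutely_integrable:
  assumes hv: "herglotz_vector_field d G" and z: "z \<in> ball 0 1" and T: "T > 0"
  shows "(\<lambda>t. G z t) absolutely_integrable_on {0..T}"
proof -
  obtain k where k: "k integrable_on {0..T}" "\<And>x. x \<in> {0..T} \<Longrightarrow> 0 \<le> k x"
    and b: "AE t\<in>{0..T} in lebesgue. \<forall>z\<in>{z}. cmod (G z t) \<le> k t"
    using herglotz_vector_field_bound[OF hv, of "{z}"] z T by auto
  have "(\<lambda>t. G z t) \<in> borel_measurable (lebesgue_on {0..})"
    using hv z unfolding herglotz_vector_field_def by blast
  then have m: "(\<lambda>t. G z t) \<in> borel_measurable (lebesgue_on {0..T})"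
    by (rule measurable_restrict_mono) auto
  have "k absolutely_integrable_on {0..T}" using k by (rule nonnegative_absolutely_integrable_1)
  then have "integrable (lebesgue_on {0..T}) k" by (simp add: integrable_restrict_space set_integrable_def)
  then have "integrable (lebesgue_on {0..T}) (\<lambda>t. G z t)"
  proof (rule Bochner_Integration.integrable_bound[OF _ m])
    show "AE t in lebesgue_on {0..T}. norm (G z t) \<le> norm (k t)"
      using b by (auto simp: AE_restrict_space_iff elim: eventually_mono)
  qed
  then show ?thesis by (simp add: integrable_restrict_space set_integrable_def)
qed

lemma abs_ln_diff_le:
  fixes x y m :: real
  assumes "0 < m" "m \<le> x" "m \<le> y"
  shows "\<bar>ln x - ln y\<bar> \<le> \<bar>x - y\<bar> / m"
proof -
  have *: "ln x - ln y \<le> \<bar>x - y\<bar> / m" if "m \<le> x" "m \<le> y" for x y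
  proof -
    have "ln x - ln y \<le> (x - y) / y" using that assms(1) by (intro ln_diff_le) auto
    also have "\<dots> \<le> \<bar>x - y\<bar> / y" using that assms(1) by (intro divide_right_mono) auto
    also have "\<dots> \<le> \<bar>x - y\<bar> / m" using that assms(1) by (intro divide_left_mono) auto
    finally show ?thesis .
  qed
  show ?thesis using *[OF assms(2,3)] *[OF assms(3,2)] by (simp add: abs_minus_commute abs_le_iff)
qed

text \<open>The differential equation holds only for almost every time; the increment bound of the
  evolution family supplies the absolute continuity that permits integration. Integrability of the
  integrands comes out of the integral formulas, and the Herglotz bound on the compact trajectory
  then makes it absolute.\<close>

lemma evolution_trajectory:
  assumes ef: "evolution_family d \<phi>" and hvo: "herglotz_vector_field_of d \<phi> G"
    and z: "z \<in> ball 0 1" and T: "T > 0"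
  defines "w \<equiv> \<lambda>s. \<phi> 0 s z"
  shows "continuous_on {0..T} w"
    and "(\<lambda>s. G (w s) s) absolutely_integrable_on {0..T}"
    and "\<And>t. t \<in> {0..T} \<Longrightarrow> ((\<lambda>s. G (w s) s) has_integral w t - z) {0..t}"
    and "(\<lambda>s. - 2 * Re (cnj (w s) * G (w s) s) / (1 - (cmod (w s))\<^sup>2)) absolutely_integrable_on {0..T}"
    and "\<And>t. t \<in> {0..T} \<Longrightarrow> ((\<lambda>s. - 2 * Re (cnj (w s) * G (w s) s) / (1 - (cmod (w s))\<^sup>2))
      has_integral ln (1 - (cmod (w t))\<^sup>2) - ln (1 - (cmod z)\<^sup>2)) {0..t}"
proof -
  have hv: "herglotz_vector_field d G" using hvo by (simp add: herglotz_vector_field_of_def)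
  have w0: "w 0 = z" unfolding w_def using evolution_familyD(4)[OF ef, of 0 0 0] z by simp
  have w_in: "w s \<in> ball 0 1" if "0 \<le> s" for s
    unfolding w_def using evolution_familyD(3)[OF ef, of 0 s s] z that by simp
  obtain k where k: "k integrable_on {0..T}" "\<And>x. x \<in> {0..T} \<Longrightarrow> 0 \<le> k x"
    and kb: "\<And>s u t. 0 \<le> s \<Longrightarrow> s \<le> u \<Longrightarrow> u \<le> t \<Longrightarrow> t \<le> T \<Longrightarrow> cmod (\<phi> s t z - \<phi> s u z) \<le> integral {u..t} k"
    using evolution_family_integral_bound[OF ef z T] by blast
  have wk: "cmod (w v - w u) \<le> integral {u..v} k" if "0 \<le> u" "u \<le> v" "v \<le> T" for u v
    using kb[of 0 u v] that by (simp add: w_def)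
  show cont: "continuous_on {0..T} w"
    unfolding continuous_on_iff
  proof (intro ballI allI impI)
    fix x e :: real assume x: "x \<in> {0..T}" and e: "e > 0"
    obtain \<delta> where \<delta>: "\<delta> > 0" "\<forall>u v. 0 \<le> u \<longrightarrow> u \<le> v \<longrightarrow> v \<le> T \<longrightarrow> v - u < \<delta> \<longrightarrow> integral {u..v} k < e"
      using integral_small_interval[OF k e] by blast
    have "dist (w y) (w x) < e" if y: "y \<in> {0..T}" "dist y x < \<delta>" for y
    proof (cases "x \<le> y")
      case True
      then show ?thesis using wk[of x y] \<delta>(2)[rule_format, of x y] x y by (simp add: dist_norm)
    next
      case False
      then show ?thesis using wk[of y x] \<delta>(2)[rule_format, of y x] x y by (simp add: dist_norm norm_minus_commute)
    qed
    then show "\<exists>d>0. \<forall>x'\<in>{0..T}. dist x' x < d \<longrightarrow> dist (w x') (w x) < e" using \<delta>(1) by blast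
  qed
  have comp: "compact (w ` {0..T})" using cont by (intro compact_continuous_image) auto
  have sub: "w ` {0..T} \<subseteq> ball 0 1" using w_in by auto
  have "\<exists>x\<in>{0..T}. \<forall>y\<in>{0..T}. cmod (w y) \<le> cmod (w x)"
    using cont T by (intro continuous_attains_sup continuous_on_norm) auto
  then obtain s0 where s0: "s0 \<in> {0..T}" "\<forall>s\<in>{0..T}. cmod (w s) \<le> cmod (w s0)" by blast
  \<comment> \<open>The least value of \<open>1 - |w|^2\<close> on the interval;
    \<open>1 / m\<close> is a Lipschitz constant for \<open>ln\<close> there and transfers the
    bounds for \<open>w\<close> to the logarithm.\<close>
  define m where "m = 1 - (cmod (w s0))\<^sup>2"
  have m: "m > 0" unfolding m_def using one_minus_norm_sq_pos w_in s0(1) by simp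
  have mle: "m \<le> 1 - (cmod (w s))\<^sup>2" if "s \<in> {0..T}" for s
    unfolding m_def using s0(2) that by (simp add: power_mono)
  have m1: "m \<le> 1" unfolding m_def by simp
  have w1: "cmod (w s) \<le> 1" if "s \<in> {0..T}" for s using w_in[of s] that by simp
  have dAE: "AE t\<in>{0..} in lebesgue. (w has_vector_derivative G (w t) t) (at t within {0..})"
    using hvo z unfolding herglotz_vector_field_of_def w_def by simp
  obtain N where N: "negligible N" and dN: "\<And>t. t \<in> {0..} - N \<Longrightarrow> (w has_vector_derivative G (w t) t) (at t within {0..})"
    using negligible_exceptions[OF dAE] by auto
  show int1: "((\<lambda>s. G (w s) s) has_integral w t - z) {0..t}" if t: "t \<in> {0..T}" for t
  proof -
    have "((\<lambda>s. G (w s) s) has_integral w t - w 0) {0..t}"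
    proof (rule fundamental_theorem_of_calculus_absolutely_continuous[OF _ _ _ _ N])
      show "k integrable_on {0..t}" using t by (intro integrable_on_subinterval[OF k(1)]) auto
      show "(w has_vector_derivative G (w x) x) (at x within {0..t})" if "x \<in> {0..t} - N" for x
        by (rule has_vector_derivative_within_subset[OF dN]) (use that in auto)
    qed (use t k(2) wk in auto)
    then show ?thesis by (simp add: w0)
  qed
  obtain K where K: "K integrable_on {0..T}" "\<And>x. x \<in> {0..T} \<Longrightarrow> 0 \<le> K x"
    and KG: "AE t\<in>{0..T} in lebesgue. \<forall>x\<in>w ` {0..T}. cmod (G x t) \<le> K t"
    using herglotz_vector_field_bound[OF hv comp sub T] by blast
  have KGw: "AE t\<in>{0..T} in lebesgue. cmod (G (w t) t) \<le> K t"
    using KG by eventually_elim auto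
  show "(\<lambda>s. G (w s) s) absolutely_integrable_on {0..T}"
    using int1[of T] T KGw K(1) by (intro absolutely_integrable_AE_bound) (auto simp: integrable_on_def)
  define L where "L = (\<lambda>s. - 2 * Re (cnj (w s) * G (w s) s) / (1 - (cmod (w s))\<^sup>2))"
  have int2: "(L has_integral ln (1 - (cmod (w t))\<^sup>2) - ln (1 - (cmod (w 0))\<^sup>2)) {0..t}" if t: "t \<in> {0..T}" for t
  proof (rule fundamental_theorem_of_calculus_absolutely_continuous[OF _ _ _ _ N])
    show "(\<lambda>s. 2 / m * k s) integrable_on {0..t}"
      using t by (intro integrable_on_mult_right integrable_on_subinterval[OF k(1)]) auto
    show "0 \<le> 2 / m * k x" if "x \<in> {0..t}" for x using m k(2)[of x] t that by simp
    show "norm (ln (1 - (cmod (w v))\<^sup>2) - ln (1 - (cmod (w u))\<^sup>2)) \<le> integral {u..v} (\<lambda>s. 2 / m * k s)"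
      if uv: "0 \<le> u" "u \<le> v" "v \<le> t" for u v
    proof -
      have uv': "u \<in> {0..T}" "v \<in> {0..T}" using uv t by auto
      have "norm (ln (1 - (cmod (w v))\<^sup>2) - ln (1 - (cmod (w u))\<^sup>2)) \<le> \<bar>(cmod (w u))\<^sup>2 - (cmod (w v))\<^sup>2\<bar> / m"
        using abs_ln_diff_le[OF m mle[OF uv'(2)] mle[OF uv'(1)]] by simp
      also have "\<bar>(cmod (w u))\<^sup>2 - (cmod (w v))\<^sup>2\<bar> = \<bar>cmod (w u) - cmod (w v)\<bar> * (cmod (w u) + cmod (w v))"
      proof -
        have "(cmod (w u))\<^sup>2 - (cmod (w v))\<^sup>2 = (cmod (w u) - cmod (w v)) * (cmod (w u) + cmod (w v))"
          by (simp add: power2_eq_square algebra_simps)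
        then show ?thesis by (simp add: abs_mult)
      qed
      also have "\<dots> \<le> cmod (w v - w u) * 2"
        using w1[OF uv'(1)] w1[OF uv'(2)] norm_triangle_ineq3[of "w u" "w v"]
        by (intro mult_mono) (auto simp: norm_minus_commute)
      also have "\<dots> \<le> integral {u..v} k * 2" using wk[of u v] uv uv' by simp
      finally have "norm (ln (1 - (cmod (w v))\<^sup>2) - ln (1 - (cmod (w u))\<^sup>2)) \<le> integral {u..v} k * 2 / m"
        using m by (simp add: divide_right_mono)
      then show ?thesis by (simp add: mult.commute)
    qed
    show "((\<lambda>s. ln (1 - (cmod (w s))\<^sup>2)) has_vector_derivative L x) (at x within {0..t})" if x: "x \<in> {0..t} - N" for x
    proof -
      have "(w has_vector_derivative G (w x) x) (at x within {0..t})"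
        by (rule has_vector_derivative_within_subset[OF dN]) (use x in auto)
      note bounded_linear.has_vector_derivative[OF bounded_linear_Re this]
        bounded_linear.has_vector_derivative[OF bounded_linear_Im this]
      then have [derivative_intros]: "((\<lambda>s. Re (w s)) has_real_derivative Re (G (w x) x)) (at x within {0..t})"
         "((\<lambda>s. Im (w s)) has_real_derivative Im (G (w x) x)) (at x within {0..t})"
        by (simp_all add: has_real_derivative_iff_has_vector_derivative)
      have pos: "1 - ((Re (w x))\<^sup>2 + (Im (w x))\<^sup>2) > 0"
        using m mle[of x] x t by (simp add: cmod_power2)
      have "((\<lambda>s. ln (1 - ((Re (w s))\<^sup>2 + (Im (w s))\<^sup>2))) has_real_derivative L x) (at x within {0..t})"
        using pos by (auto intro!: derivative_eq_intros simp: L_def cmod_power2 field_simps)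
      then show ?thesis by (simp add: has_real_derivative_iff_has_vector_derivative cmod_power2)
    qed
  qed (use t in auto)
  then show "(L has_integral ln (1 - (cmod (w t))\<^sup>2) - ln (1 - (cmod z)\<^sup>2)) {0..t}" if "t \<in> {0..T}" for t
    using that by (simp add: w0)
  show "L absolutely_integrable_on {0..T}"
  proof (rule absolutely_integrable_AE_bound)
    show "L integrable_on {0..T}" using int2[of T] T by (auto simp: integrable_on_def)
    show "(\<lambda>t. 2 / m * K t) integrable_on {0..T}" by (intro integrable_on_mult_right K(1))
    show "AE t\<in>{0..T} in lebesgue. norm (L t) \<le> 2 / m * K t"
      using KGw
    proof eventually_elim
      case (elim t)
      show ?case
      proof
        assume t: "t \<in> {0..T}"
        have "\<bar>Re (cnj (w t) * G (w t) t)\<bar> \<le> cmod (w t) * cmod (G (w t) t)"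
          by (metis abs_Re_le_cmod complex_mod_cnj norm_mult)
        also have "\<dots> \<le> 1 * K t" using w1[OF t] elim t by (intro mult_mono) auto
        finally have "norm (L t) \<le> 2 * K t / (1 - (cmod (w t))\<^sup>2)"
          using mle[OF t] m by (simp add: L_def abs_mult divide_right_mono)
        also have "\<dots> \<le> 2 * K t / m" using mle[OF t] m K(2)[OF t] by (intro divide_left_mono) auto
        finally show "norm (L t) \<le> 2 / m * K t" by simp
      qed
    qed
  qed
qed

section \<open>Passage to the boundary\<close>

lemma integral_le_AE:
  fixes f g :: "'n::euclidean_space \<Rightarrow> real"
  assumes "f integrable_on S" "g integrable_on S" "AE x\<in>S in lebesgue. f x \<le> g x"
  shows "integral S f \<le> integral S g"
proof -
  obtain N where N: "negligible N" "\<And>x. x \<in> S - N \<Longrightarrow> f x \<le> g x"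
    using negligible_exceptions[OF assms(3)] by auto
  let ?f = "\<lambda>x. if x \<in> N then 0 else f x" and ?g = "\<lambda>x. if x \<in> N then 0 else g x"
  have i: "?f integrable_on S" "?g integrable_on S"
    by (rule integrable_spike[OF assms(1) N(1)], simp) (rule integrable_spike[OF assms(2) N(1)], simp)
  have "integral S f = integral S ?f" "integral S g = integral S ?g"
    by (rule integral_spike[OF N(1)], simp)+
  moreover have "integral S ?f \<le> integral S ?g" using N(2) by (intro integral_le i) auto
  ultimately show ?thesis by simp
qed

text \<open>Measurability of \<open>g\<close> is a conclusion. This suits boundary values, which are
  known only as limits of interior values and are arbitrary on a null set.\<close>

lemma dominated_convergence_AE:
  fixes f :: "nat \<Rightarrow> 'n::euclidean_space \<Rightarrow> 'm::euclidean_space"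
  assumes f: "\<And>n. f n absolutely_integrable_on S" and h: "h integrable_on S"
    and ae: "AE x\<in>S in lebesgue. (\<forall>n. norm (f n x) \<le> h x) \<and> (\<lambda>n. f n x) \<longlonglongrightarrow> g x"
  shows "g absolutely_integrable_on S" and "(\<lambda>n. integral S (f n)) \<longlonglongrightarrow> integral S g"
proof -
  obtain N where N: "negligible N"
    "\<And>x. x \<in> S - N \<Longrightarrow> (\<forall>n. norm (f n x) \<le> h x) \<and> (\<lambda>n. f n x) \<longlonglongrightarrow> g x"
    using negligible_exceptions[OF ae] by auto
  let ?f = "\<lambda>n x. if x \<in> N then 0 else f n x" and ?h = "\<lambda>x. if x \<in> N then 0 else h x"
    and ?g = "\<lambda>x. if x \<in> N then 0 else g x"
  have fi: "?f n absolutely_integrable_on S" for n by (rule absolutely_integrable_spike[OF f N(1)]) simp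
  have hi: "?h integrable_on S" by (rule integrable_spike[OF h N(1)]) simp
  have le: "norm (?f n x) \<le> ?h x" if "x \<in> S" for n x using N(2)[of x] that by auto
  have lim: "(\<lambda>n. ?f n x) \<longlonglongrightarrow> ?g x" if "x \<in> S" for x using N(2)[of x] that by auto
  have gh: "norm (?g x) \<le> ?h x" if "x \<in> S" for x
    using tendsto_norm[OF lim[OF that]] by (rule LIMSEQ_le_const2) (use le that in auto)
  have "?g absolutely_integrable_on S"
    by (rule dominated_convergence_absolutely_integrable[OF fi hi gh lim])
  then show "g absolutely_integrable_on S" by (rule absolutely_integrable_spike[OF _ N(1)]) simp
  have "(\<lambda>n. integral S (?f n)) \<longlonglongrightarrow> integral S ?g"
    by (rule dominated_convergence(2)[OF set_lebesgue_integral_eq_integral(1)[OF fi] hi le lim])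
  moreover have "integral S (f n) = integral S (?f n)" for n by (rule integral_spike[OF N(1)]) simp
  moreover have "integral S g = integral S ?g" by (rule integral_spike[OF N(1)]) simp
  ultimately show "(\<lambda>n. integral S (f n)) \<longlonglongrightarrow> integral S g" by simp
qed

text \<open>\<open>h\<close> is the pointwise lower limit where that is finite, integrable by Fatou.
  The two conclusions are used in turn: the subsequence, depending on \<open>x\<close>, provides
  boundedness while convergence is still unknown; the second clause identifies \<open>h\<close> with
  the limit once convergence has been proved.\<close>

lemma fatou_subsequence:
  fixes M :: "nat \<Rightarrow> 'n::euclidean_space \<Rightarrow> real"
  assumes S: "S \<in> sets lebesgue" and M: "\<And>n. M n absolutely_integrable_on S"
    and pos: "AE x\<in>S in lebesgue. \<forall>n. 0 \<le> M n x"
    and lim: "(\<lambda>n. integral S (M n)) \<longlonglongrightarrow> c"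
  shows "\<exists>h. h integrable_on S \<and> (\<forall>x. 0 \<le> h x) \<and>
    (AE x\<in>S in lebesgue. (\<exists>r :: nat \<Rightarrow> nat. strict_mono r \<and> (\<forall>n. M (r n) x \<le> h x + 1)) \<and>
       (\<forall>l. (\<lambda>n. M n x) \<longlonglongrightarrow> l \<longrightarrow> l = h x))"
proof -
  let ?\<mu> = "lebesgue_on S"
  have Mi: "integrable ?\<mu> (M n)" for n using M S by (simp add: integrable_restrict_space set_integrable_def)
  have [measurable]: "M n \<in> borel_measurable ?\<mu>" for n using Mi by blast
  have pos': "AE x in ?\<mu>. \<forall>n. 0 \<le> M n x" using pos S by (simp add: AE_restrict_space_iff)
  define F where "F = (\<lambda>x. liminf (\<lambda>n. ennreal (M n x)))"
  have [measurable]: "F \<in> borel_measurable ?\<mu>" unfolding F_def by measurable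
  have "integral\<^sup>N ?\<mu> F \<le> liminf (\<lambda>n. \<integral>\<^sup>+ x. ennreal (M n x) \<partial>?\<mu>)"
    unfolding F_def by (rule nn_integral_liminf) measurable
  also have "(\<lambda>n. \<integral>\<^sup>+ x. ennreal (M n x) \<partial>?\<mu>) = (\<lambda>n. ennreal (integral S (M n)))"
  proof
    fix n
    have "AE x in ?\<mu>. 0 \<le> M n x" using pos' by eventually_elim simp
    then show "(\<integral>\<^sup>+ x. ennreal (M n x) \<partial>?\<mu>) = ennreal (integral S (M n))"
      using nn_integral_eq_integral[OF Mi] lebesgue_integral_eq_integral[OF Mi S] by simp
  qed
  also have "liminf (\<lambda>n. ennreal (integral S (M n))) = ennreal c"
    by (intro lim_imp_Liminf tendsto_ennrealI lim) simp
  finally have Fc: "integral\<^sup>N ?\<mu> F \<le> ennreal c" .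
  then have Ffin: "AE x in ?\<mu>. F x \<noteq> \<infinity>"
    by (intro nn_integral_noteq_infinite) (auto simp: top_unique)
  define h where "h = (\<lambda>x. enn2real (F x))"
  have [measurable]: "h \<in> borel_measurable ?\<mu>" unfolding h_def by measurable
  have "(\<integral>\<^sup>+ x. ennreal (h x) \<partial>?\<mu>) \<le> integral\<^sup>N ?\<mu> F"
    unfolding h_def by (intro nn_integral_mono) (simp add: ennreal_enn2real_if)
  also have "\<dots> < \<infinity>" using Fc by (simp add: le_less_trans)
  finally have "integrable ?\<mu> h" by (intro integrableI_nonneg) (auto simp: h_def)
  then have "h integrable_on S" using S by (rule integrable_on_lebesgue_on)
  moreover have "\<forall>x. 0 \<le> h x" by (simp add: h_def)
  moreover have "AE x\<in>S in lebesgue. (\<exists>r :: nat \<Rightarrow> nat. strict_mono r \<and> (\<forall>n. M (r n) x \<le> h x + 1)) \<and>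
       (\<forall>l. (\<lambda>n. M n x) \<longlonglongrightarrow> l \<longrightarrow> l = h x)"
  proof -
    have "AE x\<in>S in lebesgue. F x \<noteq> \<infinity>" using Ffin S by (simp add: AE_restrict_space_iff)
    with pos show ?thesis
    proof eventually_elim
      case (elim x)
      show ?case
      proof
        assume x: "x \<in> S"
        then have Fh: "F x = ennreal (h x)" and M0: "\<forall>n. 0 \<le> M n x"
          using elim by (auto simp: h_def less_top)
        have "\<not> (\<forall>\<^sub>F n in sequentially. h x + 1 < M n x)"
        proof
          assume "\<forall>\<^sub>F n in sequentially. h x + 1 < M n x"
          then have "\<forall>\<^sub>F n in sequentially. ennreal (h x + 1) \<le> ennreal (M n x)"
            by eventually_elim (simp add: ennreal_leI)
          then have "ennreal (h x + 1) \<le> F x" unfolding F_def by (rule Liminf_bounded)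
          then show False unfolding Fh by (simp add: h_def)
        qed
        then have "\<forall>N. \<exists>n\<ge>N. M n x \<le> h x + 1" by (auto simp: eventually_sequentially not_less)
        then have "infinite {n. M n x \<le> h x + 1}" by (simp add: infinite_nat_iff_unbounded_le)
        then obtain r :: "nat \<Rightarrow> nat" where "strict_mono r" "\<forall>n. r n \<in> {n. M n x \<le> h x + 1}"
          using infinite_enumerate by blast
        moreover have "l = h x" if l: "(\<lambda>n. M n x) \<longlonglongrightarrow> l" for l
        proof -
          have "l \<ge> 0" using l by (rule LIMSEQ_le_const) (use M0 in auto)
          have "F x = ennreal l" unfolding F_def by (intro lim_imp_Liminf tendsto_ennrealI l) simp
          then show ?thesis using \<open>l \<ge> 0\<close> by (simp add: h_def)
        qed
        ultimately show "(\<exists>r :: nat \<Rightarrow> nat. strict_mono r \<and> (\<forall>n. M (r n) x \<le> h x + 1)) \<and>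
           (\<forall>l. (\<lambda>n. M n x) \<longlonglongrightarrow> l \<longrightarrow> l = h x)" by blast
      qed
    qed
  qed
  ultimately show ?thesis by blast
qed

text \<open>The inequality for \<open>G\<close> bounds the logarithmic derivative of
  \<open>1 - |w|^2\<close> from below by \<open>- 2 * |G(0,x)|\<close>, since the part coming from
  \<open>Re q\<close> can only increase it. The bound does not depend on \<open>z\<close>, so it
  survives as \<open>z\<close> tends to the circle.\<close>

lemma log_distance_decrease_bound:
  assumes ef: "evolution_family d \<phi>" and hvo: "herglotz_vector_field_of d \<phi> G"
    and z: "z \<in> ball 0 1" and st: "0 \<le> s" "s \<le> t" "t \<le> T" and T: "T > 0"
  shows "ln (1 - (cmod (\<phi> 0 t z))\<^sup>2) - ln (1 - (cmod (\<phi> 0 s z))\<^sup>2) \<ge> - 2 * integral {0..T} (\<lambda>s. cmod (G 0 s))"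
proof -
  define w where "w = (\<lambda>s. \<phi> 0 s z)"
  define L where "L = (\<lambda>s. - 2 * Re (cnj (w s) * G (w s) s) / (1 - (cmod (w s))\<^sup>2))"
  have hv: "herglotz_vector_field d G" using hvo by (simp add: herglotz_vector_field_of_def)
  have w_in: "w s \<in> ball 0 1" if "0 \<le> s" for s
    unfolding w_def using evolution_familyD(3)[OF ef, of 0 s s] z that by simp
  have tr: "(L has_integral ln (1 - (cmod (w t))\<^sup>2) - ln (1 - (cmod z)\<^sup>2)) {0..t}" if "t \<in> {0..T}" for t
    using evolution_trajectory(5)[OF ef hvo z T that] unfolding L_def w_def .
  have a: "(\<lambda>s. cmod (G 0 s)) integrable_on {0..T}"
    using herglotz_vector_field_absolutely_integrable[OF hv _ T, of 0]
    by (simp add: absolutely_integrable_on_def)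
  have Li: "L integrable_on {0..T}" using tr[of T] T by (auto simp: integrable_on_def)
  have sub: "L integrable_on {s..t}" "(\<lambda>s. cmod (G 0 s)) integrable_on {s..t}" "L integrable_on {0..t}"
    using integrable_on_subinterval[OF Li] integrable_on_subinterval[OF a] st by auto
  have "integral {0..s} L + integral {s..t} L = integral {0..t} L"
    using st sub by (intro Henstock_Kurzweil_Integration.integral_combine) auto
  moreover have "integral {0..s} L = ln (1 - (cmod (w s))\<^sup>2) - ln (1 - (cmod z)\<^sup>2)"
    "integral {0..t} L = ln (1 - (cmod (w t))\<^sup>2) - ln (1 - (cmod z)\<^sup>2)"
    using tr[of s] tr[of t] st by (auto intro!: integral_unique)
  ultimately have eq: "ln (1 - (cmod (w t))\<^sup>2) - ln (1 - (cmod (w s))\<^sup>2) = integral {s..t} L" by simp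
  have "AE x\<in>{s..t} in lebesgue. - 2 * cmod (G 0 x) \<le> L x"
    using AE_generator_inequality[OF ef hvo]
  proof eventually_elim
    case (elim x)
    show ?case
    proof
      assume x: "x \<in> {s..t}"
      then have x0: "0 \<le> x" using st by simp
      define p where "p = 1 - (cmod (w x))\<^sup>2"
      have p: "p > 0" unfolding p_def using one_minus_norm_sq_pos w_in[OF x0] .
      have "Re (cnj (w x) * G (w x) x) \<le> Re (G 0 x * cnj (w x)) * p"
        unfolding p_def using elim x0 w_in[OF x0] by blast
      also have "\<dots> \<le> cmod (G 0 x) * p"
      proof (rule mult_right_mono)
        have "Re (G 0 x * cnj (w x)) \<le> cmod (G 0 x) * cmod (w x)"
          by (metis complex_Re_le_cmod complex_mod_cnj norm_mult)
        also have "\<dots> \<le> cmod (G 0 x)" using w_in[OF x0] by (simp add: mult_left_le)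
        finally show "Re (G 0 x * cnj (w x)) \<le> cmod (G 0 x)" .
      qed (use p in simp)
      finally show "- 2 * cmod (G 0 x) \<le> L x" using p by (simp add: L_def p_def[symmetric] pos_le_divide_eq)
    qed
  qed
  then have "integral {s..t} (\<lambda>x. - 2 * cmod (G 0 x)) \<le> integral {s..t} L"
    using sub by (intro integral_le_AE integrable_on_mult_right) auto
  moreover have "integral {s..t} (\<lambda>x. cmod (G 0 x)) \<le> integral {0..T} (\<lambda>x. cmod (G 0 x))"
    using st a sub(2) by (intro integral_subset_le) auto
  ultimately show ?thesis using eq by (simp add: w_def)
qed

text \<open>Julia's inequality compares \<open>|\<sigma> t - w n t|^2\<close> with
  \<open>\<alpha> t * p n 0 * p n t\<close>. Uniformity in \<open>t\<close> needs two consequences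
  of \<open>log_distance_decrease_bound\<close>: \<open>p n 0\<close> is at most a constant times
  \<open>p n t\<close>, and \<open>\<alpha> t\<close> is at most the same constant times
  \<open>\<alpha> T\<close>, which replaces an appeal to continuity of \<alpha>.\<close>

lemma trajectories_in_stolz_region:
  assumes ef: "evolution_family d \<phi>" and hvo: "herglotz_vector_field_of d \<phi> G"
    and reg: "regular_contact_point_of_family \<phi> \<sigma>\<^sub>0" and T: "T > 0"
  defines "\<sigma> \<equiv> \<lambda>t. angular_lim (\<phi> 0 t) \<sigma>\<^sub>0" and "\<alpha> \<equiv> \<lambda>t. cmod (angular_deriv (\<phi> 0 t) \<sigma>\<^sub>0)"
    and "w \<equiv> \<lambda>n t. \<phi> 0 t (radial_points \<sigma>\<^sub>0 n)"
  shows "\<And>t. 0 \<le> t \<Longrightarrow> t \<le> T \<Longrightarrow> \<alpha> t > 0"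
    and "\<exists>B\<ge>0. \<forall>n. \<forall>t\<in>{0..T}. cmod (\<sigma> t - w n t) \<le> B * (1 - (cmod (w n t))\<^sup>2)"
proof -
  define E where "E = exp (2 * integral {0..T} (\<lambda>s. cmod (G 0 s)))"
  define p where "p = (\<lambda>n t. 1 - (cmod (w n t))\<^sup>2)"
  have E0: "E > 0" by (simp add: E_def)
  have reg': "regular_contact_point (\<phi> 0 t) \<sigma>\<^sub>0" if "0 \<le> t" for t
    using reg that by (simp add: regular_contact_point_of_family_def)
  have \<sigma>0: "\<sigma>\<^sub>0 \<in> sphere 0 1" using reg'[of 0] by (simp add: regular_contact_point_def)
  have r_in: "radial_points \<sigma>\<^sub>0 n \<in> ball 0 1" for n by (rule radial_points_in_disc[OF \<sigma>0])
  have w_in: "w n t \<in> ball 0 1" if "0 \<le> t" for n t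
    unfolding w_def using evolution_familyD(3)[OF ef, of 0 t t] r_in that by simp
  have p0: "p n t > 0" if "0 \<le> t" for n t unfolding p_def using one_minus_norm_sq_pos w_in[OF that] .
  have w0: "w n 0 = radial_points \<sigma>\<^sub>0 n" for n
    unfolding w_def using evolution_familyD(4)[OF ef, of 0 0 0] r_in by simp
  have pE: "p n s \<le> E * p n t" if "0 \<le> s" "s \<le> t" "t \<le> T" for n s t
  proof -
    have "ln (p n s) \<le> ln E + ln (p n t)"
      using log_distance_decrease_bound[OF ef hvo r_in that T, of n]
      by (simp add: p_def w_def E_def)
    also have "\<dots> = ln (E * p n t)" using E0 p0[of t n] that by (simp add: ln_mult)
    finally show ?thesis using E0 p0[of t n] p0[of s n] that by (simp add: mult_pos_pos)
  qed
  have hol: "\<phi> 0 t holomorphic_on ball 0 1" "\<phi> 0 t ` ball 0 1 \<subseteq> ball 0 1" if "0 \<le> t" for t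
    using evolution_familyD(1,2)[OF ef, of 0 t t] that by auto
  note julia = julia_at_regular_contact_point[OF hol reg']
  have ratio: "(\<lambda>n. p n t / p n 0) \<longlonglongrightarrow> \<alpha> t" if "0 \<le> t" for t
    using julia(3)[OF that that that] by (simp add: p_def w0 \<alpha>_def) (simp add: w_def)
  \<comment> \<open>A bound uniform in \<open>n\<close> passes to the limit; positivity of \<alpha>
    is what later gives \<open>ln (\<alpha> t)\<close> as the limit of the logarithms.\<close>
  have alow: "\<alpha> t \<ge> 1 / E" if t: "0 \<le> t" "t \<le> T" for t
    using ratio[OF t(1)]
  proof (rule LIMSEQ_le_const)
    have "1 / E \<le> p n t / p n 0" for n
      using pE[of 0 t n] t E0 p0[of 0 n] by (simp add: field_simps)
    then show "\<exists>N. \<forall>n\<ge>N. 1 / E \<le> p n t / p n 0" by blast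
  qed
  then show "\<alpha> t > 0" if "0 \<le> t" "t \<le> T" for t
    using that E0 by (meson less_le_trans zero_less_divide_1_iff)
  have aup: "\<alpha> t \<le> E * \<alpha> T" if t: "0 \<le> t" "t \<le> T" for t
  proof (rule LIMSEQ_le[OF ratio[OF t(1)]])
    show "(\<lambda>n. E * (p n T / p n 0)) \<longlonglongrightarrow> E * \<alpha> T" using ratio[of T] T by (intro tendsto_intros) auto
    have "p n t / p n 0 \<le> E * (p n T / p n 0)" for n
      using pE[OF t order_refl, of n] p0[of 0 n] by (simp add: divide_right_mono)
    then show "\<exists>N. \<forall>n\<ge>N. p n t / p n 0 \<le> E * (p n T / p n 0)" by blast
  qed
  \<comment> \<open>The square root of \<open>E * \<alpha> T * E\<close>, with one factor
    \<open>E\<close> from \<open>aup\<close> and one from \<open>pE\<close>.\<close>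
  define B where "B = E * sqrt (\<alpha> T)"
  have aT: "\<alpha> T \<ge> 0" by (simp add: \<alpha>_def)
  have "cmod (\<sigma> t - w n t) \<le> B * p n t" if t: "t \<in> {0..T}" for n t
  proof -
    have t': "0 \<le> t" "t \<le> T" using t by auto
    define h where "h = 1 / (real n + 2)"
    have h: "0 < h" "h \<le> 1/2" by (simp_all add: h_def field_simps)
    have s0: "cmod \<sigma>\<^sub>0 = 1" using \<sigma>0 by simp
    have d0: "cmod (\<sigma>\<^sub>0 - w n 0) = h"
    proof -
      have "\<sigma>\<^sub>0 - w n 0 = \<sigma>\<^sub>0 * of_real h" by (simp add: w0 radial_points_def h_def algebra_simps)
      then show ?thesis using s0 h by (simp add: norm_mult)
    qed
    have "cmod (w n 0) = cmod (of_real (1 - h))" using s0 by (simp add: w0 radial_points_def h_def norm_mult)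
    then have c0: "cmod (w n 0) = 1 - h" using h unfolding norm_of_real by simp
    have ph: "h \<le> p n 0" unfolding p_def c0 using h by (simp add: power2_eq_square algebra_simps)
    have "(cmod (\<sigma> t - w n t))\<^sup>2 * p n 0 \<le> \<alpha> t * (cmod (\<sigma>\<^sub>0 - w n 0))\<^sup>2 * p n t"
      using julia(4)[OF t'(1) t'(1) t'(1) r_in, of n] by (simp add: p_def \<sigma>_def \<alpha>_def w0) (simp add: w_def)
    also have "\<dots> \<le> \<alpha> t * (p n 0)\<^sup>2 * p n t"
      unfolding d0 using ph h p0[OF t'(1), of n] by (intro mult_right_mono mult_left_mono power_mono) (auto simp: \<alpha>_def)
    finally have "(cmod (\<sigma> t - w n t))\<^sup>2 \<le> \<alpha> t * p n 0 * p n t"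
      using p0[of 0 n] by (simp add: power2_eq_square mult_ac)
    also have "\<dots> \<le> (E * \<alpha> T) * (E * p n t) * p n t"
      using aup[OF t'] pE[of 0 t n] t' aT E0 p0[OF t'(1), of n] p0[of 0 n]
      by (intro mult_right_mono mult_mono) (auto simp: \<alpha>_def intro!: mult_nonneg_nonneg less_imp_le)
    also have "\<dots> = (B * p n t)\<^sup>2" using aT by (simp add: B_def power2_eq_square mult_ac)
    finally have "(cmod (\<sigma> t - w n t))\<^sup>2 \<le> (B * p n t)\<^sup>2" .
    then show ?thesis
      by (rule power2_le_imp_le) (use aT E0 p0[OF t'(1), of n] in \<open>simp add: B_def\<close>)
  qed
  moreover have "B \<ge> 0" using aT E0 by (simp add: B_def)
  ultimately show "\<exists>B\<ge>0. \<forall>n. \<forall>t\<in>{0..T}. cmod (\<sigma> t - w n t) \<le> B * (1 - (cmod (w n t))\<^sup>2)"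
    unfolding p_def by blast
qed

section \<open>Boundary values of the vector field on a bounded time interval\<close>

lemma generator_boundary_values_relation:
  fixes a \<sigma> :: complex and \<beta> \<delta> :: real
  assumes \<sigma>: "cmod \<sigma> = 1"
  shows "- \<i> * cnj \<sigma> * (a - cnj a * \<sigma>\<^sup>2 - \<sigma> * (\<i> * \<beta>)) = of_real (Im (- 2 * cnj a * \<sigma> - \<i> * \<beta> + \<delta> / 2))"
proof -
  have "cnj \<sigma> * \<sigma> = 1" using \<sigma> by (simp add: mult.commute[of "cnj _"] complex_norm_square[symmetric])
  then have "- \<i> * cnj \<sigma> * (a - cnj a * \<sigma>\<^sup>2 - \<sigma> * (\<i> * \<beta>)) = - \<i> * (a * cnj \<sigma>) + \<i> * cnj a * \<sigma> - \<beta>"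
    by (simp add: algebra_simps power2_eq_square) (simp add: mult.assoc[symmetric])
  also have "\<dots> = of_real (Im (- 2 * cnj a * \<sigma> - \<i> * \<beta> + \<delta> / 2))"
    by (simp add: complex_eq_iff)
  finally show ?thesis .
qed

lemma boundary_data_on_interval:
  assumes ef: "evolution_family d \<phi>" and hvo: "herglotz_vector_field_of d \<phi> G"
    and reg: "regular_contact_point_of_family \<phi> \<sigma>\<^sub>0" and T: "T > 0"
  defines "\<sigma> \<equiv> \<lambda>t. angular_lim (\<phi> 0 t) \<sigma>\<^sub>0"
  defines "G\<sigma> \<equiv> \<lambda>t. angular_lim (\<lambda>z. G z t) (\<sigma> t)" and "G'\<sigma> \<equiv> \<lambda>t. angular_deriv (\<lambda>z. G z t) (\<sigma> t)"
  shows "AE t\<in>{0..T} in lebesgue. (\<exists>l. has_angular_limit (\<lambda>z. G z t) (\<sigma> t) l)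
      \<and> (\<exists>l. has_angular_derivative (\<lambda>z. G z t) (\<sigma> t) l)
      \<and> - \<i> * cnj (\<sigma> t) * G\<sigma> t = of_real (Im (G'\<sigma> t))"
    and "G\<sigma> absolutely_integrable_on {0..T}" and "G'\<sigma> absolutely_integrable_on {0..T}"
    and "\<And>t. t \<in> {0..T} \<Longrightarrow> (G\<sigma> has_integral \<sigma> t - \<sigma> 0) {0..t}"
    and "\<And>t. t \<in> {0..T} \<Longrightarrow> ((\<lambda>s. Re (G'\<sigma> s)) has_integral ln (cmod (angular_deriv (\<phi> 0 t) \<sigma>\<^sub>0))) {0..t}"
proof -
  define \<alpha> where "\<alpha> = (\<lambda>t. cmod (angular_deriv (\<phi> 0 t) \<sigma>\<^sub>0))"
  define w where "w = (\<lambda>n t. \<phi> 0 t (radial_points \<sigma>\<^sub>0 n))"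
  define p where "p = (\<lambda>n t. 1 - (cmod (w n t))\<^sup>2)"
  define g where "g = (\<lambda>n t. G (w n t) t)"
  define L where "L = (\<lambda>n t. - 2 * Re (cnj (w n t) * g n t) / p n t)"
  \<comment> \<open>Since \<open>L = 2 * R - 2 * Re (G 0 t * cnj w)\<close> with
    \<open>R >= 0\<close> for almost every time, adding \<open>2 * |G(0,t)|\<close> makes the
    integrand non-negative, as Fatou's lemma requires.\<close>
  define M where "M = (\<lambda>n t. L n t + 2 * cmod (G 0 t))"
  define R where "R = (\<lambda>t z. (Re (G 0 t * cnj z) * (1 - (cmod z)\<^sup>2) - Re (cnj z * G z t)) / (1 - (cmod z)\<^sup>2))"
  have hv: "herglotz_vector_field d G" using hvo by (simp add: herglotz_vector_field_of_def)
  have reg': "regular_contact_point (\<phi> 0 t) \<sigma>\<^sub>0" if "0 \<le> t" for t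
    using reg that by (simp add: regular_contact_point_of_family_def)
  have \<sigma>0: "\<sigma>\<^sub>0 \<in> sphere 0 1" using reg'[of 0] by (simp add: regular_contact_point_def)
  have r_in: "radial_points \<sigma>\<^sub>0 n \<in> ball 0 1" for n by (rule radial_points_in_disc[OF \<sigma>0])
  have w_in: "w n t \<in> ball 0 1" if "0 \<le> t" for n t
    unfolding w_def using evolution_familyD(3)[OF ef, of 0 t t] r_in that by simp
  have p0: "p n t > 0" if "0 \<le> t" for n t unfolding p_def using one_minus_norm_sq_pos w_in[OF that] .
  have p1: "p n t \<le> 1" for n t by (simp add: p_def)
  have w0: "w n 0 = radial_points \<sigma>\<^sub>0 n" for n
    unfolding w_def using evolution_familyD(4)[OF ef, of 0 0 0] r_in by simp
  have hol: "\<phi> 0 t holomorphic_on ball 0 1" "\<phi> 0 t ` ball 0 1 \<subseteq> ball 0 1" if "0 \<le> t" for t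
    using evolution_familyD(1,2)[OF ef, of 0 t t] that by auto
  note julia = julia_at_regular_contact_point[OF hol reg']
  have \<sigma>_in: "\<sigma> t \<in> sphere 0 1" if "0 \<le> t" for t using julia(1)[OF that that that] by (simp add: \<sigma>_def)
  have w_lim: "(\<lambda>n. w n t) \<longlonglongrightarrow> \<sigma> t" if "0 \<le> t" for t
    using julia(2)[OF that that that] by (simp add: \<sigma>_def w_def)
  have p_lim: "(\<lambda>n. p n t / p n 0) \<longlonglongrightarrow> \<alpha> t" if "0 \<le> t" for t
    using julia(3)[OF that that that] by (simp add: p_def w0 \<alpha>_def) (simp add: w_def)
  note stolz = trajectories_in_stolz_region[OF ef hvo reg T, folded \<sigma>_def \<alpha>_def]
  have \<alpha>_pos: "\<alpha> t > 0" if "0 \<le> t" "t \<le> T" for t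
    using stolz(1)[OF that] by (simp add: \<alpha>_def)
  obtain B where B0: "B \<ge> 0" and B: "\<And>n t. t \<in> {0..T} \<Longrightarrow> cmod (\<sigma> t - w n t) \<le> B * p n t"
    using stolz(2) unfolding \<sigma>_def w_def p_def by blast
  \<comment> \<open>\<open>1 - |w|^2 <= 2 * (1 - |w|)\<close> accounts for \<open>2 * B\<close>; the
    extra 2 makes the inequality strict and the aperture exceed 1 even if
    \<open>B = 0\<close>.\<close>
  have w_filter: "filterlim (\<lambda>n. w n t) (at (\<sigma> t) within stolz_region (\<sigma> t) (2 * B + 2)) sequentially"
    if t: "t \<in> {0..T}" for t
  proof -
    have t0: "0 \<le> t" using t by simp
    have "w n t \<in> stolz_region (\<sigma> t) (2 * B + 2)" "w n t \<noteq> \<sigma> t" for n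
    proof -
      have w1: "cmod (w n t) < 1" using w_in[OF t0, of n] by simp
      have "p n t = (1 + cmod (w n t)) * (1 - cmod (w n t))" by (simp add: p_def power2_eq_square algebra_simps)
      also have "\<dots> \<le> 2 * (1 - cmod (w n t))" using w1 by (intro mult_right_mono) auto
      finally have "B * p n t \<le> B * (2 * (1 - cmod (w n t)))" using B0 by (intro mult_left_mono)
      then have "cmod (\<sigma> t - w n t) \<le> 2 * B * (1 - cmod (w n t))"
        using B[OF t, of n] by (simp add: algebra_simps)
      also have "\<dots> < (2 * B + 2) * (1 - cmod (w n t))" using w1 by (intro mult_strict_right_mono) auto
      finally show "w n t \<in> stolz_region (\<sigma> t) (2 * B + 2)" using w1 by (simp add: stolz_region_def)
      show "w n t \<noteq> \<sigma> t" using w1 \<sigma>_in[OF t0] by auto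
    qed
    then show ?thesis using w_lim[OF t0] by (simp add: filterlim_at)
  qed
  have B2: "2 * B + 2 > 1" using B0 by simp
  have traj: "continuous_on {0..T} (w n)" "g n absolutely_integrable_on {0..T}"
    "L n absolutely_integrable_on {0..T}" for n
    using evolution_trajectory(1,2,4)[OF ef hvo r_in T, of n] by (simp_all add: w_def g_def L_def p_def)
  have g_int: "(g n has_integral w n t - w n 0) {0..t}" if "t \<in> {0..T}" for n t
    using evolution_trajectory(3)[OF ef hvo r_in T that, of n] unfolding w0 by (simp add: w_def g_def)
  have L_int: "(L n has_integral ln (p n t / p n 0)) {0..t}" if "t \<in> {0..T}" for n t
  proof -
    have "ln (p n t / p n 0) = ln (p n t) - ln (p n 0)" using p0[of t n] p0[of 0 n] that by (simp add: ln_div)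
    then show ?thesis
      using evolution_trajectory(5)[OF ef hvo r_in T that, of n] by (simp add: L_def p_def w0) (simp add: w_def g_def)
  qed
  have a_int: "(\<lambda>t. G 0 t) absolutely_integrable_on {0..T}" "(\<lambda>t. G (1/2) t) absolutely_integrable_on {0..T}"
    using herglotz_vector_field_absolutely_integrable[OF hv _ T] by simp_all
  then have an_int: "(\<lambda>t. cmod (G 0 t)) absolutely_integrable_on {0..T}"
       "(\<lambda>t. cmod (G 0 t)) integrable_on {0..T}" "(\<lambda>t. cmod (G (1/2) t)) integrable_on {0..T}"
    by (auto simp: absolutely_integrable_norm absolutely_integrable_on_def)
  have LR: "L n t = 2 * R t (w n t) - 2 * Re (G 0 t * cnj (w n t))" if "0 \<le> t" for n t
    using p0[OF that, of n] by (simp add: L_def R_def p_def g_def field_simps)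
  have Re_a: "\<bar>Re (G 0 t * cnj (w n t))\<bar> \<le> cmod (G 0 t)" if "0 \<le> t" for n t
  proof -
    have "\<bar>Re (G 0 t * cnj (w n t))\<bar> \<le> cmod (G 0 t) * cmod (w n t)"
      by (metis abs_Re_le_cmod complex_mod_cnj norm_mult)
    also have "\<dots> \<le> cmod (G 0 t)" using w_in[OF that, of n] by (simp add: mult_left_le)
    finally show ?thesis .
  qed
  have gen: "AE t\<in>{0..T} in lebesgue. \<forall>z\<in>ball 0 1. Re (cnj z * G z t) \<le> Re (G 0 t * cnj z) * (1 - (cmod z)\<^sup>2)"
    using AE_generator_inequality[OF ef hvo] by eventually_elim auto
  have R_pos: "0 \<le> R t z" if "\<forall>z\<in>ball 0 1. Re (cnj z * G z t) \<le> Re (G 0 t * cnj z) * (1 - (cmod z)\<^sup>2)" "z \<in> ball 0 1" for t z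
    using that one_minus_norm_sq_pos[OF that(2)] by (simp add: R_def)
  have RM: "2 * R t (w n t) \<le> M n t" if "0 \<le> t" for n t
    using LR[OF that, of n] Re_a[OF that, of n] by (simp add: M_def)
  have M_pos: "AE t\<in>{0..T} in lebesgue. \<forall>n. 0 \<le> M n t"
    using gen
  proof eventually_elim
    case (elim t)
    show ?case
    proof (intro impI allI)
      fix n assume t: "t \<in> {0..T}"
      then have "0 \<le> R t (w n t)" using R_pos elim w_in by simp
      then show "0 \<le> M n t" using RM[of t n] t by simp
    qed
  qed
  have M_int: "M n absolutely_integrable_on {0..T}" for n
    unfolding M_def using traj(3)[of n] an_int(1) by (intro set_integral_add(1) set_integrable_mult_right) auto
  have M_lim: "(\<lambda>n. integral {0..T} (M n)) \<longlonglongrightarrow> ln (\<alpha> T) + integral {0..T} (\<lambda>t. 2 * cmod (G 0 t))"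
  proof -
    have "integral {0..T} (M n) = ln (p n T / p n 0) + integral {0..T} (\<lambda>t. 2 * cmod (G 0 t))" for n
    proof -
      have LT: "(L n has_integral ln (p n T / p n 0)) {0..T}" using L_int T by simp
      have "(\<lambda>t. 2 * cmod (G 0 t)) integrable_on {0..T}" using an_int(2) by (rule integrable_on_mult_right)
      then show ?thesis unfolding M_def
        using integral_add[OF has_integral_integrable[OF LT]] integral_unique[OF LT] by simp
    qed
    moreover have "(\<lambda>n. ln (p n T / p n 0)) \<longlonglongrightarrow> ln (\<alpha> T)"
      using p_lim[of T] \<alpha>_pos[of T] T by (intro tendsto_ln) auto
    ultimately show ?thesis by (simp add: tendsto_add)
  qed
  obtain h where h: "h integrable_on {0..T}" "\<And>t. 0 \<le> h t"
    and h_ae: "AE t\<in>{0..T} in lebesgue. (\<exists>r :: nat \<Rightarrow> nat. strict_mono r \<and> (\<forall>n. M (r n) t \<le> h t + 1)) \<and>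
       (\<forall>l. (\<lambda>n. M n t) \<longlonglongrightarrow> l \<longrightarrow> l = h t)"
    using fatou_subsequence[OF _ M_int M_pos M_lim] by auto
  \<comment> \<open>Chosen in anticipation of \<open>\<delta> <= 2 * h t\<close>. \<open>D\<close>
    is \<open>2 * |G(0,t)| + |\<beta>| + \<delta> * B^2\<close> with the bound for
    \<open>|\<beta>|\<close> inserted and its \<open>3 * \<delta>\<close> rounded up to
    \<open>4 * \<delta>\<close>. In \<open>K\<close> the first term bounds \<open>2 * R\<close>, the
    second the rest of \<open>L\<close>.\<close>
  define D where "D = (\<lambda>t. 6 * cmod (G 0 t) + 2 * cmod (G (1/2) t) + (4 + B\<^sup>2) * (2 * h t))"
  define K where "K = (\<lambda>t. 4 * B\<^sup>2 * h t + 2 * cmod (G 0 t))"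
  have D_int: "D integrable_on {0..T}" and K_int: "K integrable_on {0..T}"
    unfolding D_def K_def by (intro integrable_add integrable_on_mult_right an_int h(1))+
  define Q where "Q = (\<lambda>t. (\<exists>l. has_angular_limit (\<lambda>z. G z t) (\<sigma> t) l)
      \<and> (\<exists>l. has_angular_derivative (\<lambda>z. G z t) (\<sigma> t) l)
      \<and> - \<i> * cnj (\<sigma> t) * G\<sigma> t = of_real (Im (G'\<sigma> t))
      \<and> (\<forall>n. cmod (g n t) \<le> D t) \<and> (\<lambda>n. g n t) \<longlonglongrightarrow> G\<sigma> t
      \<and> (\<forall>n. \<bar>L n t\<bar> \<le> K t) \<and> (\<lambda>n. L n t) \<longlonglongrightarrow> Re (G'\<sigma> t))"
  have main: "AE t\<in>{0..T} in lebesgue. Q t"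
    using gen h_ae
  proof eventually_elim
    case (elim t)
    show ?case
    proof
      assume t: "t \<in> {0..T}"
      then have t0: "0 \<le> t" by simp
      have ge: "\<forall>z\<in>ball 0 1. Re (cnj z * G z t) \<le> Re (G 0 t * cnj z) * (1 - (cmod z)\<^sup>2)"
        using elim(1) t by blast
      \<comment> \<open>This subsequence depends on \<open>t\<close>. It only serves to meet the
        hypothesis of \<open>boundary_behaviour_of_generator\<close>; the limits obtained from there
        hold along the whole sequence.\<close>
      obtain r :: "nat \<Rightarrow> nat" where r: "strict_mono r" "\<And>n. M (r n) t \<le> h t + 1" using elim(2) t by blast
      have h_lim: "l = h t" if "(\<lambda>n. M n t) \<longlonglongrightarrow> l" for l using elim(2) t that by blast
      have Rb: "R t (w (r n) t) \<le> (h t + 1) / 2" for n using RM[OF t0, of "r n"] r(2)[of n] by simp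
      have H_hol: "(\<lambda>z. G z t) holomorphic_on ball 0 1" using hv t0 unfolding herglotz_vector_field_def by blast
      have xr: "(\<lambda>n. w (r n) t) \<longlonglongrightarrow> \<sigma> t" using LIMSEQ_subseq_LIMSEQ[OF w_lim[OF t0] r(1)] by (simp add: o_def)
      obtain \<beta> \<delta> :: real where \<delta>0: "\<delta> \<ge> 0"
        and lim: "has_angular_limit (\<lambda>z. G z t) (\<sigma> t) (G 0 t - cnj (G 0 t) * (\<sigma> t)\<^sup>2 - \<sigma> t * (\<i> * \<beta>))"
        and der: "has_angular_derivative (\<lambda>z. G z t) (\<sigma> t) (- 2 * cnj (G 0 t) * \<sigma> t - \<i> * \<beta> + \<delta> / 2)"
        and Rlim: "\<forall>M>1. (R t \<longlongrightarrow> \<delta> / 4) (at (\<sigma> t) within stolz_region (\<sigma> t) M)"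
        and R_le: "\<forall>z\<in>ball 0 1. R t z * (1 - (cmod z)\<^sup>2)\<^sup>2 \<le> \<delta> * (cmod (\<sigma> t - z))\<^sup>2"
        and G_le: "\<forall>z\<in>ball 0 1. cmod (G z t) * (1 - (cmod z)\<^sup>2)
          \<le> (2 * cmod (G 0 t) + \<bar>\<beta>\<bar>) * (1 - (cmod z)\<^sup>2) + \<delta> * (cmod (\<sigma> t - z))\<^sup>2"
        and \<beta>_le: "\<bar>\<beta>\<bar> \<le> 4 * cmod (G 0 t) + 2 * cmod (G (1/2) t) + 3 * \<delta>"
        using boundary_behaviour_of_generator[OF H_hol ge \<sigma>_in[OF t0] w_in[OF t0] xr Rb[unfolded R_def]]
        unfolding R_def by blast
      have G\<sigma>_eq: "G\<sigma> t = G 0 t - cnj (G 0 t) * (\<sigma> t)\<^sup>2 - \<sigma> t * (\<i> * \<beta>)"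
        unfolding G\<sigma>_def by (rule angular_lim_eq[OF \<sigma>_in[OF t0] lim])
      have G'\<sigma>_eq: "G'\<sigma> t = - 2 * cnj (G 0 t) * \<sigma> t - \<i> * \<beta> + \<delta> / 2"
        unfolding G'\<sigma>_def by (rule angular_deriv_eq[OF \<sigma>_in[OF t0] der])
      have g_lim: "(\<lambda>n. g n t) \<longlonglongrightarrow> G\<sigma> t"
        using filterlim_compose[OF _ w_filter[OF t]] lim B2 unfolding has_angular_limit_def G\<sigma>_eq g_def by blast
      have "(\<lambda>n. R t (w n t)) \<longlonglongrightarrow> \<delta> / 4"
        using filterlim_compose[OF _ w_filter[OF t]] Rlim B2 by blast
      then have "(\<lambda>n. 2 * R t (w n t) - 2 * Re (G 0 t * cnj (w n t))) \<longlonglongrightarrow> 2 * (\<delta> / 4) - 2 * Re (G 0 t * cnj (\<sigma> t))"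
        by (intro tendsto_diff tendsto_mult tendsto_const tendsto_Re tendsto_cnj w_lim[OF t0])
      moreover have "2 * (\<delta> / 4) - 2 * Re (G 0 t * cnj (\<sigma> t)) = Re (G'\<sigma> t)" by (simp add: G'\<sigma>_eq)
      ultimately have L_lim: "(\<lambda>n. L n t) \<longlonglongrightarrow> Re (G'\<sigma> t)" using LR[OF t0] by simp
      \<comment> \<open>Now the whole sequence converges, so its limit is \<open>h t\<close>; this
        bounds the so far uncontrolled \<delta> by an integrable function of time.\<close>
      have "(\<lambda>n. M n t) \<longlonglongrightarrow> Re (G'\<sigma> t) + 2 * cmod (G 0 t)" unfolding M_def by (intro tendsto_intros L_lim)
      then have "h t = Re (G'\<sigma> t) + 2 * cmod (G 0 t)" using h_lim by metis
      moreover have "\<bar>Re (G 0 t * cnj (\<sigma> t))\<bar> \<le> cmod (G 0 t)"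
        using abs_Re_le_cmod[of "G 0 t * cnj (\<sigma> t)"] \<sigma>_in[OF t0] by (simp add: norm_mult)
      ultimately have \<delta>h: "\<delta> \<le> 2 * h t" by (simp add: G'\<sigma>_eq)
      have sB: "\<delta> * (cmod (\<sigma> t - w n t))\<^sup>2 \<le> (2 * h t) * (B * p n t)\<^sup>2" for n
        using \<delta>h \<delta>0 B[OF t, of n] by (intro mult_mono power_mono) auto
      have "cmod (g n t) \<le> D t" for n
      proof -
        have pn: "p n t > 0" by (rule p0[OF t0])
        \<comment> \<open>The Stolz bound yields \<open>p^2\<close> where \<open>G_le\<close> has
          \<open>p\<close>; as \<open>p <= 1\<close>, one power is given up so that \<open>p\<close>
          can be cancelled.\<close>
        have "p n t * p n t \<le> p n t" using p1[of n t] pn by (simp add: mult_left_le)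
        then have "(2 * h t * B\<^sup>2) * (p n t * p n t) \<le> (2 * h t * B\<^sup>2) * p n t"
          by (rule mult_left_mono) (use h(2)[of t] in simp)
        then have "(2 * h t) * (B * p n t)\<^sup>2 \<le> (2 * h t) * B\<^sup>2 * p n t"
          by (simp add: power_mult_distrib power2_eq_square mult_ac)
        then have "cmod (g n t) * p n t \<le> (2 * cmod (G 0 t) + \<bar>\<beta>\<bar> + (2 * h t) * B\<^sup>2) * p n t"
          using G_le[rule_format, OF w_in[OF t0, of n]] sB[of n] by (simp add: g_def p_def distrib_right)
        then have "cmod (g n t) \<le> 2 * cmod (G 0 t) + \<bar>\<beta>\<bar> + (2 * h t) * B\<^sup>2" using pn by simp
        also have "\<dots> \<le> D t" using \<beta>_le \<delta>h h(2)[of t] by (simp add: D_def algebra_simps)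
        finally show ?thesis .
      qed
      moreover have "\<bar>L n t\<bar> \<le> K t" for n
      proof -
        have pn: "p n t > 0" by (rule p0[OF t0])
        have "R t (w n t) * (p n t)\<^sup>2 \<le> (2 * h t) * B\<^sup>2 * (p n t)\<^sup>2"
          using R_le[rule_format, OF w_in[OF t0, of n]] sB[of n] by (simp add: p_def power_mult_distrib mult_ac)
        then have "R t (w n t) \<le> (2 * h t) * B\<^sup>2" using pn by simp
        moreover have "0 \<le> R t (w n t)" using elim(1) t by (intro R_pos w_in[OF t0]) blast
        moreover have "0 \<le> (2 * h t) * B\<^sup>2" using h(2)[of t] by simp
        ultimately show ?thesis using LR[OF t0, of n] Re_a[OF t0, of n] by (simp add: K_def mult_ac)
      qed
      moreover have "- \<i> * cnj (\<sigma> t) * G\<sigma> t = of_real (Im (G'\<sigma> t))"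
        unfolding G\<sigma>_eq G'\<sigma>_eq using \<sigma>_in[OF t0] by (intro generator_boundary_values_relation) simp
      ultimately show "Q t" unfolding Q_def using lim der g_lim L_lim by blast
    qed
  qed
  show "AE t\<in>{0..T} in lebesgue. (\<exists>l. has_angular_limit (\<lambda>z. G z t) (\<sigma> t) l)
      \<and> (\<exists>l. has_angular_derivative (\<lambda>z. G z t) (\<sigma> t) l)
      \<and> - \<i> * cnj (\<sigma> t) * G\<sigma> t = of_real (Im (G'\<sigma> t))"
    using main by eventually_elim (auto simp: Q_def)
  have g_dom: "AE s\<in>{0..t} in lebesgue. (\<forall>n. norm (g n s) \<le> D s) \<and> (\<lambda>n. g n s) \<longlonglongrightarrow> G\<sigma> s"
    and L_dom: "AE s\<in>{0..t} in lebesgue. (\<forall>n. norm (L n s) \<le> K s) \<and> (\<lambda>n. L n s) \<longlonglongrightarrow> Re (G'\<sigma> s)"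
    if "t \<in> {0..T}" for t
    using main by (eventually_elim, use that in \<open>auto simp: Q_def\<close>)+
  have sub: "g n absolutely_integrable_on {0..t}" "L n absolutely_integrable_on {0..t}"
    "D integrable_on {0..t}" "K integrable_on {0..t}" if "t \<in> {0..T}" for n t
    using that by (auto intro!: set_integrable_subset[OF traj(2)] set_integrable_subset[OF traj(3)]
        integrable_on_subinterval[OF D_int] integrable_on_subinterval[OF K_int])
  note g_conv = dominated_convergence_AE[OF sub(1) sub(3) g_dom]
  note L_conv = dominated_convergence_AE[OF sub(2) sub(4) L_dom]
  have TT: "T \<in> {0..T}" using T by simp
  show G\<sigma>_int: "G\<sigma> absolutely_integrable_on {0..T}" by (rule g_conv(1)[OF TT TT TT])
  have ReG': "(\<lambda>s. Re (G'\<sigma> s)) absolutely_integrable_on {0..T}" by (rule L_conv(1)[OF TT TT TT])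
  show "(G\<sigma> has_integral \<sigma> t - \<sigma> 0) {0..t}" if t: "t \<in> {0..T}" for t
  proof -
    have "G\<sigma> integrable_on {0..t}"
      using g_conv(1)[OF t t t] by (rule set_lebesgue_integral_eq_integral(1))
    moreover have "integral {0..t} G\<sigma> = \<sigma> t - \<sigma> 0"
    proof (rule LIMSEQ_unique[OF g_conv(2)[OF t t t]])
      have "(\<lambda>n. w n t - w n 0) \<longlonglongrightarrow> \<sigma> t - \<sigma> 0" using t by (intro tendsto_diff w_lim) auto
      then show "(\<lambda>n. integral {0..t} (g n)) \<longlonglongrightarrow> \<sigma> t - \<sigma> 0" using integral_unique[OF g_int[OF t]] by simp
    qed
    ultimately show ?thesis by (simp add: has_integral_iff)
  qed
  show "((\<lambda>s. Re (G'\<sigma> s)) has_integral ln (cmod (angular_deriv (\<phi> 0 t) \<sigma>\<^sub>0))) {0..t}" if t: "t \<in> {0..T}" for t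
  proof -
    have "(\<lambda>s. Re (G'\<sigma> s)) integrable_on {0..t}"
      using L_conv(1)[OF t t t] by (rule set_lebesgue_integral_eq_integral(1))
    moreover have "integral {0..t} (\<lambda>s. Re (G'\<sigma> s)) = ln (\<alpha> t)"
    proof (rule LIMSEQ_unique[OF L_conv(2)[OF t t t]])
      have "(\<lambda>n. ln (p n t / p n 0)) \<longlonglongrightarrow> ln (\<alpha> t)"
        using p_lim[of t] \<alpha>_pos[of t] t by (intro tendsto_ln) auto
      then show "(\<lambda>n. integral {0..t} (L n)) \<longlonglongrightarrow> ln (\<alpha> t)" using integral_unique[OF L_int[OF t]] by simp
    qed
    ultimately show ?thesis by (simp add: has_integral_iff \<alpha>_def)
  qed
  \<comment> \<open>The imaginary part of \<open>G'\<sigma>\<close> is \<open>v\<close>, and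
    \<open>\<i> * v = cnj \<sigma> * G\<sigma>\<close>. To integrate this product without studying
    \<sigma> as a function of time, it is again exhibited as a dominated limit, of continuous
    functions times integrable ones.\<close>
  have abs0: "(\<lambda>t. of_real (Re (G'\<sigma> t)) + \<i> * (- \<i> * cnj (\<sigma> t) * G\<sigma> t)) absolutely_integrable_on {0..T}"
  proof -
    have "(\<lambda>t. cnj (\<sigma> t) * G\<sigma> t) absolutely_integrable_on {0..T}"
    proof (rule dominated_convergence_AE(1)[where f = "\<lambda>n t. cnj (w n t) * g n t" and h = D])
      show "(\<lambda>t. cnj (w n t) * g n t) absolutely_integrable_on {0..T}" for n
      proof (rule absolutely_integrable_bounded_measurable_product[OF bilinear_times])
        have c: "continuous_on {0..T} (\<lambda>t. cnj (w n t))" using traj(1) by (intro continuous_on_cnj)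
        then show "(\<lambda>t. cnj (w n t)) \<in> borel_measurable (lebesgue_on {0..T})"
          by (rule continuous_imp_measurable_on_sets_lebesgue) simp
        show "bounded ((\<lambda>t. cnj (w n t)) ` {0..T})"
          by (intro compact_imp_bounded compact_continuous_image c) simp
      qed (use traj(2) in auto)
      show "AE t\<in>{0..T} in lebesgue. (\<forall>n. norm (cnj (w n t) * g n t) \<le> D t) \<and> (\<lambda>n. cnj (w n t) * g n t) \<longlonglongrightarrow> cnj (\<sigma> t) * G\<sigma> t"
        using main
      proof eventually_elim
        case (elim t)
        show ?case
        proof (intro impI conjI allI)
          assume t: "t \<in> {0..T}"
          then have t0: "0 \<le> t" and q: "Q t" using elim by auto
          fix n
          have "norm (cnj (w n t) * g n t) \<le> 1 * D t"
            unfolding norm_mult using w_in[OF t0, of n] q by (intro mult_mono) (auto simp: Q_def)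
          then show "norm (cnj (w n t) * g n t) \<le> D t" by simp
        next
          assume t: "t \<in> {0..T}"
          then have t0: "0 \<le> t" and q: "Q t" using elim by auto
          show "(\<lambda>n. cnj (w n t) * g n t) \<longlonglongrightarrow> cnj (\<sigma> t) * G\<sigma> t"
            using q by (intro tendsto_mult tendsto_cnj w_lim[OF t0]) (simp add: Q_def)
        qed
      qed
    qed (rule D_int)
    moreover have "(\<lambda>t. complex_of_real (Re (G'\<sigma> t))) absolutely_integrable_on {0..T}"
      using absolutely_integrable_linear[OF ReG' bounded_linear_of_real] by (simp add: o_def)
    ultimately have "(\<lambda>t. of_real (Re (G'\<sigma> t)) + cnj (\<sigma> t) * G\<sigma> t) absolutely_integrable_on {0..T}"
      by (intro set_integral_add(1))
    then show ?thesis by (simp add: mult.assoc[symmetric])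
  qed
  obtain N where N: "negligible N" "\<And>t. t \<in> {0..T} - N \<Longrightarrow> Q t"
    using negligible_exceptions[OF main] by auto
  show "G'\<sigma> absolutely_integrable_on {0..T}"
  proof (rule absolutely_integrable_spike[OF abs0 N(1)])
    fix t assume "t \<in> {0..T} - N"
    then have "- \<i> * cnj (\<sigma> t) * G\<sigma> t = of_real (Im (G'\<sigma> t))" using N(2) by (simp add: Q_def)
    then show "G'\<sigma> t = of_real (Re (G'\<sigma> t)) + \<i> * (- \<i> * cnj (\<sigma> t) * G\<sigma> t)"
      by (metis complex_eq)
  qed
qed

section \<open>From bounded time intervals to the half-line\<close>

lemma AE_atLeast_of_intervals:
  assumes "\<And>T. T > 0 \<Longrightarrow> AE t\<in>{0..T::real} in lebesgue. P t"
  shows "AE t\<in>{0..} in lebesgue. P t"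
proof -
  have "AE t in lebesgue. \<forall>n::nat. t \<in> {0..real (Suc n)} \<longrightarrow> P t"
    unfolding AE_all_countable using assms by simp
  then show ?thesis
  proof eventually_elim
    case (elim t)
    show ?case
    proof
      assume "t \<in> {0..}"
      moreover obtain n where "t \<le> real n" using real_arch_simple by blast
      ultimately show "P t" using elim[rule_format, of n] by simp
    qed
  qed
qed

lemma L1_loc_on_atLeast:
  assumes "\<And>T. T > 0 \<Longrightarrow> f absolutely_integrable_on {0..T}"
  shows "L1_loc_on {0..} f"
  unfolding L1_loc_on_def
proof (intro allI impI)
  fix K :: "real set" assume K: "compact K \<and> K \<subseteq> {0..}"
  then obtain b where b: "\<forall>x\<in>K. \<bar>x\<bar> \<le> b" using compact_imp_bounded bounded_real by metis
  have "K \<subseteq> {0..max 1 b}" using K b by fastforce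
  moreover have "K \<in> sets lebesgue" using K by (simp add: borel_compact)
  ultimately show "f absolutely_integrable_on K"
    using set_integrable_subset[OF assms[of "max 1 b"]] by simp
qed

theorem theorem3p5:
  fixes \<phi> :: "real \<Rightarrow> real \<Rightarrow> complex \<Rightarrow> complex"
    and G :: "complex \<Rightarrow> real \<Rightarrow> complex"
    and d :: ereal and \<sigma>\<^sub>0 :: complex
  assumes "evolution_family d \<phi>"
    and "herglotz_vector_field_of d \<phi> G"
    and "regular_contact_point_of_family \<phi> \<sigma>\<^sub>0"
  shows "let \<Lambda> = spectral_function \<phi> \<sigma>\<^sub>0;
             \<sigma> = (\<lambda>t. angular_lim (\<phi> 0 t) \<sigma>\<^sub>0);
             G\<sigma> = (\<lambda>t. angular_lim (\<lambda>z. G z t) (\<sigma> t));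
             G'\<sigma> = (\<lambda>t. angular_deriv (\<lambda>z. G z t) (\<sigma> t));
             v = (\<lambda>t. - \<i> * cnj (\<sigma> t) * G\<sigma> t)
         in
           (AE t\<in>{0..} in lebesgue.
              (\<exists>l. has_angular_limit (\<lambda>z. G z t) (\<sigma> t) l) \<and> v t \<in> \<real>) \<and>
           L1_loc_on {0..} G\<sigma> \<and>
           (locally_absolutely_continuous_on {0..} \<sigma> \<and>
            (\<forall>s\<ge>0. \<forall>t\<ge>0. \<sigma> t = \<sigma> s + (LINT \<xi>=s..t|lebesgue. G\<sigma> \<xi>))) \<and>
           (AE t\<in>{0..} in lebesgue.
              (\<exists>l. has_angular_derivative (\<lambda>z. G z t) (\<sigma> t) l) \<and>
              complex_of_real (Im (G'\<sigma> t)) = v t) \<and>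
           (L1_loc_on {0..} G'\<sigma> \<and>
            (\<forall>t\<ge>0. \<Lambda> t = - (LINT \<xi>=0..t|lebesgue. Re (G'\<sigma> \<xi>))))"
proof -
  define \<sigma> where "\<sigma> = (\<lambda>t. angular_lim (\<phi> 0 t) \<sigma>\<^sub>0)"
  define G\<sigma> where "G\<sigma> = (\<lambda>t. angular_lim (\<lambda>z. G z t) (\<sigma> t))"
  define G'\<sigma> where "G'\<sigma> = (\<lambda>t. angular_deriv (\<lambda>z. G z t) (\<sigma> t))"
  note data = boundary_data_on_interval[OF assms, folded \<sigma>_def, folded G\<sigma>_def G'\<sigma>_def]
  have ae: "AE t\<in>{0..} in lebesgue. (\<exists>l. has_angular_limit (\<lambda>z. G z t) (\<sigma> t) l)
      \<and> (\<exists>l. has_angular_derivative (\<lambda>z. G z t) (\<sigma> t) l)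
      \<and> - \<i> * cnj (\<sigma> t) * G\<sigma> t = of_real (Im (G'\<sigma> t))"
    using data(1) by (intro AE_atLeast_of_intervals) (simp add: \<sigma>_def G\<sigma>_def G'\<sigma>_def)
  have G\<sigma>_abs: "G\<sigma> absolutely_integrable_on {0..T}" and G'\<sigma>_abs: "G'\<sigma> absolutely_integrable_on {0..T}"
    if "T > 0" for T
    using data(2,3)[OF that] by (simp_all add: \<sigma>_def G\<sigma>_def G'\<sigma>_def)
  \<comment> \<open>The data require an interval of positive length, and \<open>t\<close> may be 0;
    hence \<open>t + 1\<close>.\<close>
  have \<sigma>_int0: "(G\<sigma> has_integral \<sigma> t - \<sigma> 0) {0..t}"
    and G'_int: "((\<lambda>s. Re (G'\<sigma> s)) has_integral ln (cmod (angular_deriv (\<phi> 0 t) \<sigma>\<^sub>0))) {0..t}" if "0 \<le> t" for t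
    using data(4,5)[of "t + 1" t] that by (simp_all add: \<sigma>_def G\<sigma>_def G'\<sigma>_def)
  have G\<sigma>_sub: "G\<sigma> absolutely_integrable_on {u..v}" if "0 \<le> u" "u \<le> v" for u v
    by (rule set_integrable_subset[OF G\<sigma>_abs[of "v + 1"]]) (use that in auto)
  have \<sigma>_int: "integral {u..v} G\<sigma> = \<sigma> v - \<sigma> u" if "0 \<le> u" "u \<le> v" for u v
  proof -
    have "integral {0..u} G\<sigma> + integral {u..v} G\<sigma> = integral {0..v} G\<sigma>"
      using that \<sigma>_int0[of v] by (intro Henstock_Kurzweil_Integration.integral_combine) (auto simp: integrable_on_def)
    then show ?thesis using integral_unique[OF \<sigma>_int0[of u]] integral_unique[OF \<sigma>_int0[of v]] that by (simp add: algebra_simps)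
  qed
  have \<sigma>_LINT: "\<sigma> t = \<sigma> s + (LINT \<xi>=s..t|lebesgue. G\<sigma> \<xi>)" if "0 \<le> s" "0 \<le> t" for s t
  proof (cases "s \<le> t")
    case True
    then show ?thesis using that by (simp add: interval_lebesgue_integral_eq_integral G\<sigma>_sub \<sigma>_int)
  next
    case False
    then have "(LINT \<xi>=s..t|lebesgue. G\<sigma> \<xi>) = - (LINT \<xi>=t..s|lebesgue. G\<sigma> \<xi>)"
      by (intro interval_lebesgue_integral_gt_eq') simp
    then show ?thesis using that False by (simp add: interval_lebesgue_integral_eq_integral G\<sigma>_sub \<sigma>_int)
  qed
  have \<sigma>_ac: "locally_absolutely_continuous_on {0..} \<sigma>"
    unfolding locally_absolutely_continuous_on_def
  proof (intro allI impI, elim conjE)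
    fix a b :: real assume ab: "a \<le> b" "{a..b} \<subseteq> {0..}"
    then have a: "0 \<le> a" by auto
    show "absolutely_continuous_Icc a b \<sigma>"
    proof (rule absolutely_continuous_Icc_of_integral_bound)
      show "(\<lambda>t. cmod (G\<sigma> t)) integrable_on {a..b}"
        using G\<sigma>_sub[OF a ab(1)] by (simp add: absolutely_integrable_on_def)
      show "norm (\<sigma> v - \<sigma> u) \<le> integral {u..v} (\<lambda>t. cmod (G\<sigma> t))" if "a \<le> u" "u \<le> v" "v \<le> b" for u v
      proof -
        have "0 \<le> u" using a that by simp
        then show ?thesis using G\<sigma>_sub[of u v] \<sigma>_int[of u v] that
          by (metis absolutely_integrable_on_def integral_norm_bound_integral order_refl)
      qed
    qed simp
  qed
  have \<Lambda>: "spectral_function \<phi> \<sigma>\<^sub>0 t = - (LINT \<xi>=0..t|lebesgue. Re (G'\<sigma> \<xi>))" if t: "0 \<le> t" for t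
  proof -
    have "G'\<sigma> absolutely_integrable_on {0..t}"
      by (rule set_integrable_subset[OF G'\<sigma>_abs[of "t + 1"]]) (use t in auto)
    then have "(\<lambda>s. Re (G'\<sigma> s)) absolutely_integrable_on {0..t}"
      using absolutely_integrable_linear[OF _ bounded_linear_Re] by (simp add: o_def)
    then have "(LINT \<xi>=0..t|lebesgue. Re (G'\<sigma> \<xi>)) = integral {0..t} (\<lambda>s. Re (G'\<sigma> s))"
      unfolding zero_ereal_def using t by (intro interval_lebesgue_integral_eq_integral)
    also have "\<dots> = ln (cmod (angular_deriv (\<phi> 0 t) \<sigma>\<^sub>0))" by (rule integral_unique[OF G'_int[OF t]])
    finally show ?thesis by (simp add: spectral_function_def)
  qed
  have 1: "AE t\<in>{0..} in lebesgue. (\<exists>l. has_angular_limit (\<lambda>z. G z t) (\<sigma> t) l) \<and> - \<i> * cnj (\<sigma> t) * G\<sigma> t \<in> \<real>"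
    using ae
  proof eventually_elim
    case (elim t)
    show ?case
    proof
      assume "t \<in> {0..}"
      with elim have "\<exists>l. has_angular_limit (\<lambda>z. G z t) (\<sigma> t) l" "- \<i> * cnj (\<sigma> t) * G\<sigma> t = of_real (Im (G'\<sigma> t))" by blast+
      then show "(\<exists>l. has_angular_limit (\<lambda>z. G z t) (\<sigma> t) l) \<and> - \<i> * cnj (\<sigma> t) * G\<sigma> t \<in> \<real>"
        using Reals_of_real by metis
    qed
  qed
  have 2: "AE t\<in>{0..} in lebesgue. (\<exists>l. has_angular_derivative (\<lambda>z. G z t) (\<sigma> t) l) \<and>
      complex_of_real (Im (G'\<sigma> t)) = - \<i> * cnj (\<sigma> t) * G\<sigma> t"
    using ae
  proof eventually_elim
    case (elim t)
    show ?case
    proof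
      assume "t \<in> {0..}"
      with elim have "\<exists>l. has_angular_derivative (\<lambda>z. G z t) (\<sigma> t) l" "- \<i> * cnj (\<sigma> t) * G\<sigma> t = of_real (Im (G'\<sigma> t))" by blast+
      then show "(\<exists>l. has_angular_derivative (\<lambda>z. G z t) (\<sigma> t) l) \<and>
        complex_of_real (Im (G'\<sigma> t)) = - \<i> * cnj (\<sigma> t) * G\<sigma> t" by (intro conjI) (simp_all only:)
    qed
  qed
  have 3: "L1_loc_on {0..} G\<sigma>" "L1_loc_on {0..} G'\<sigma>"
    by (rule L1_loc_on_atLeast[OF G\<sigma>_abs], assumption) (rule L1_loc_on_atLeast[OF G'\<sigma>_abs], assumption)
  have 4: "\<forall>s\<ge>0. \<forall>t\<ge>0. \<sigma> t = \<sigma> s + (LINT \<xi>=s..t|lebesgue. G\<sigma> \<xi>)"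
    using \<sigma>_LINT by blast
  have 5: "\<forall>t\<ge>0. spectral_function \<phi> \<sigma>\<^sub>0 t = - (LINT \<xi>=0..t|lebesgue. Re (G'\<sigma> \<xi>))"
    using \<Lambda> by blast
  show ?thesis
    using 1 2 3 \<sigma>_ac 4 5 unfolding Let_def G\<sigma>_def G'\<sigma>_def \<sigma>_def by (intro conjI)
qed

end
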